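(* (1) For every $G \in \mathcal{B}$, $r^G + t^G \leq \operatorname{rk}(G)+1$. (2) For every torsion-free abelian group $G$ of finite rank with $\mathcal{P}(G) = \mathcal{C}(n,k)$ (where $1\le k\le n$), $r^G + t^G = n+1$.
   Context: All groups are torsion-free abelian groups of finite rank. If $G$ has rank $n$ and $G = A_1\oplus\cdots\oplus A_t$ with every $A_i$ nonzero and indecomposable of rank $r_i$, then $G$ is said to realize the (unordered) partition $(r_1,\dots,r_t)$ of $n$. $\mathcal{P}(G)$ is the set of all partitions of $\operatorname{rk}(G)$ realized by $G$. $r^G$ is the largest rank of an indecomposable direct summand of $G$, and $t^G$ is the largest number of summands in an indecomposable decomposition of $G$. $\mathcal{C}(n,k)$ is the set of all partitions of $n$ into exactly $k$ parts. Types are isomorphism classes of rank-one groups, with $\sigma\le\tau$ iff there is a nonzero homomorphism from a group of type $\sigma$ to one of type $\tau$. A completely decomposable group is a direct sum of rank-one groups; its homogeneous decomposition is $A=\bigoplus_{\rho\in T_{cr}(A)}A_\rho$, where $A_\rho\neq 0$ is a direct sum of rank-one groups of type $\rho$, and the index set $T_{cr}(A)$ is the critical typeset of $A$. An almost completely decomposable group is a group $X$ containing a completely decomposable subgroup of finite index; the completely decomposable subgroups of least index in $X$ are its regulating subgroups, and the regulator $R(X)$ is the intersection of all regulating subgroups (it is completely decomposable, fully invariant, and of finite index in $X$). Put $T_{cr}(X)=T_{cr}(R(X))$. $X$ is block-rigid if $T_{cr}(X)$ is an antichain. $\mathcal{B}$ is the class of all block-rigid almost completely decomposable groups $X$ such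 that $X/R(X)$ is cyclic. *)

theory Defs
  imports "HOL-Algebra.Algebra" "HOL-Library.Multiset"
begin

text \<open>Abelian groups are written multiplicatively, as in HOL-Algebra.\<close>

abbreviation restrict_grp :: "'a monoid \<Rightarrow> 'a set \<Rightarrow> 'a monoid"  (infixl \<open>\<restriction>\<restriction>\<close> 90)
  where "G \<restriction>\<restriction> H \<equiv> G\<lparr>carrier := H\<rparr>"


subsection \<open>Torsion-free abelian groups of finite rank\<close>

definition torsion_free :: "'a monoid \<Rightarrow> bool" where
  "torsion_free G \<longleftrightarrow>
     (\<forall>x\<in>carrier G. \<forall>m::nat. m > 0 \<longrightarrow> x [^]\<^bsub>G\<^esub> m = \<one>\<^bsub>G\<^esub> \<longrightarrow> x = \<one>\<^bsub>G\<^esub>)"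

definition int_independent :: "'a monoid \<Rightarrow> 'a set \<Rightarrow> bool" where
  "int_independent G S \<longleftrightarrow> finite S \<and> S \<subseteq> carrier G \<and>
     (\<forall>c :: 'a \<Rightarrow> int. (\<Otimes>\<^bsub>G\<^esub>x\<in>S. x [^]\<^bsub>G\<^esub> c x) = \<one>\<^bsub>G\<^esub> \<longrightarrow> (\<forall>x\<in>S. c x = 0))"

definition finite_rank :: "'a monoid \<Rightarrow> bool" where
  "finite_rank G \<longleftrightarrow> finite (card ` {S. int_independent G S})"

definition rk :: "'a monoid \<Rightarrow> nat" where
  "rk G = Max (card ` {S. int_independent G S})"

definition tffr_group :: "'a monoid \<Rightarrow> bool" where
  "tffr_group G \<longleftrightarrow> comm_group G \<and> torsion_free G \<and> finite_rank G"


subsection \<open>Direct decompositions\<close>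

text \<open>For a finite index set the external direct sum is the product group.\<close>

definition internal_direct_sum :: "'a monoid \<Rightarrow> 'i set \<Rightarrow> ('i \<Rightarrow> 'a set) \<Rightarrow> bool" where
  "internal_direct_sum G I A \<longleftrightarrow> finite I \<and> (\<forall>i\<in>I. subgroup (A i) G) \<and>
     (\<lambda>x. \<Otimes>\<^bsub>G\<^esub>i\<in>I. x i) \<in> iso (product_group I (\<lambda>i. G \<restriction>\<restriction> A i)) G"

definition direct_sum2 :: "'a monoid \<Rightarrow> 'a set \<Rightarrow> 'a set \<Rightarrow> bool" where
  "direct_sum2 G B C \<longleftrightarrow> subgroup B G \<and> subgroup C G \<and>
     B \<inter> C = {\<one>\<^bsub>G\<^esub>} \<and> B <#>\<^bsub>G\<^esub> C = carrier G"

definition direct_summand :: "'a monoid \<Rightarrow> 'a set \<Rightarrow> bool" where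
  "direct_summand G B \<longleftrightarrow> (\<exists>C. direct_sum2 G B C)"

text \<open>The trivial group counts as indecomposable here; it is excluded explicitly from
  indecomposable decompositions.\<close>

definition indecomposable :: "'a monoid \<Rightarrow> bool" where
  "indecomposable G \<longleftrightarrow>
     (\<forall>B C. direct_sum2 G B C \<longrightarrow> B = {\<one>\<^bsub>G\<^esub>} \<or> C = {\<one>\<^bsub>G\<^esub>})"

definition indec_decomposition :: "'a monoid \<Rightarrow> nat \<Rightarrow> (nat \<Rightarrow> 'a set) \<Rightarrow> bool" where
  "indec_decomposition G t A \<longleftrightarrow> internal_direct_sum G {..<t} A \<and>
     (\<forall>i<t. A i \<noteq> {\<one>\<^bsub>G\<^esub>} \<and> indecomposable (G \<restriction>\<restriction> A i))"

text \<open>An unordered partition is the multiset of its parts.\<close>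

definition realized_partitions :: "'a monoid \<Rightarrow> nat multiset set"  (\<open>\<P>\<close>) where
  "\<P> G = {p. \<exists>t A. indec_decomposition G t A \<and>
                p = image_mset (\<lambda>i. rk (G \<restriction>\<restriction> A i)) (mset_set {..<t})}"

definition partitions_into :: "nat \<Rightarrow> nat \<Rightarrow> nat multiset set"  (\<open>\<C>\<close>) where
  "\<C> n k = {p. sum_mset p = n \<and> size p = k \<and> 0 \<notin># p}"

definition max_indec_rank :: "'a monoid \<Rightarrow> nat" where
  "max_indec_rank G =
     Max {rk (G \<restriction>\<restriction> B) | B. direct_summand G B \<and> indecomposable (G \<restriction>\<restriction> B)}"

definition max_num_summands :: "'a monoid \<Rightarrow> nat" where
  "max_num_summands G = Max {t. \<exists>A. indec_decomposition G t A}"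


subsection \<open>Types and completely decomposable groups\<close>

definition rank_one :: "'a monoid \<Rightarrow> bool" where
  "rank_one A \<longleftrightarrow> tffr_group A \<and> rk A = 1"

text \<open>Isomorphism classes are taken among the groups whose elements lie in one fixed HOL type.\<close>

definition grp_types :: "'a monoid set set" where
  "grp_types = {A. rank_one A} // {(A, B). rank_one A \<and> rank_one B \<and> A \<cong> B}"

definition type_le :: "'a monoid set \<Rightarrow> 'a monoid set \<Rightarrow> bool" where
  "type_le \<sigma> \<tau> \<longleftrightarrow>
     (\<exists>A\<in>\<sigma>. \<exists>B\<in>\<tau>. \<exists>h\<in>hom A B. \<exists>x\<in>carrier A. h x \<noteq> \<one>\<^bsub>B\<^esub>)"

definition type_antichain :: "'a monoid set set \<Rightarrow> bool" where
  "type_antichain T \<longleftrightarrow> (\<forall>\<sigma>\<in>T. \<forall>\<tau>\<in>T. type_le \<sigma> \<tau> \<longrightarrow> \<sigma> = \<tau>)"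

definition completely_decomposable :: "'a monoid \<Rightarrow> bool" where
  "completely_decomposable A \<longleftrightarrow> comm_group A \<and>
     (\<exists>m B. internal_direct_sum A {..<m::nat} B \<and> (\<forall>i<m. rank_one (A \<restriction>\<restriction> B i)))"

definition homogeneous_cd :: "'a monoid \<Rightarrow> 'a monoid set \<Rightarrow> bool" where
  "homogeneous_cd A \<rho> \<longleftrightarrow> comm_group A \<and>
     (\<exists>m B. internal_direct_sum A {..<m::nat} B \<and> (\<forall>i<m. A \<restriction>\<restriction> B i \<in> \<rho>))"

text \<open>The critical typeset as a relation: \<open>T\<close> is the index set of a homogeneous decomposition
  of \<open>A\<close>.  Such a \<open>T\<close> exists iff \<open>A\<close> is completely decomposable, and is then unique.\<close>

definition is_critical_typeset :: "'a monoid \<Rightarrow> 'a monoid set set \<Rightarrow> bool" where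
  "is_critical_typeset A T \<longleftrightarrow> comm_group A \<and> T \<subseteq> grp_types \<and>
     (\<exists>D. internal_direct_sum A T D \<and>
          (\<forall>\<rho>\<in>T. D \<rho> \<noteq> {\<one>\<^bsub>A\<^esub>} \<and> homogeneous_cd (A \<restriction>\<restriction> D \<rho>) \<rho>))"


subsection \<open>Almost completely decomposable groups\<close>

definition cd_finite_index :: "'a monoid \<Rightarrow> 'a set \<Rightarrow> bool" where
  "cd_finite_index G A \<longleftrightarrow> subgroup A G \<and> completely_decomposable (G \<restriction>\<restriction> A) \<and>
     finite (rcosets\<^bsub>G\<^esub> A)"

definition almost_completely_decomposable :: "'a monoid \<Rightarrow> bool" where
  "almost_completely_decomposable G \<longleftrightarrow> tffr_group G \<and> (\<exists>A. cd_finite_index G A)"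

definition regulating :: "'a monoid \<Rightarrow> 'a set \<Rightarrow> bool" where
  "regulating G A \<longleftrightarrow> cd_finite_index G A \<and>
     (\<forall>B. cd_finite_index G B \<longrightarrow> card (rcosets\<^bsub>G\<^esub> A) \<le> card (rcosets\<^bsub>G\<^esub> B))"

definition regulator :: "'a monoid \<Rightarrow> 'a set" where
  "regulator G = \<Inter>{A. regulating G A}"

definition block_rigid :: "'a monoid \<Rightarrow> bool" where
  "block_rigid G \<longleftrightarrow>
     (\<exists>T. is_critical_typeset (G \<restriction>\<restriction> regulator G) T \<and> type_antichain T)"

definition class_B :: "'a monoid set"  (\<open>\<B>\<close>) where
  "\<B> = {G. almost_completely_decomposable G \<and> block_rigid G \<and>
            cyclic_group (G Mod regulator G)}"

end

theory Submission
  imports Defs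
begin

text \<open>
  For the inequality, let \<open>R\<close> be the regulator of \<open>G\<close> and \<open>e\<close> a positive integer with
  \<open>G\<^sup>e \<subseteq> R\<close>.  Composing \<open>x \<mapsto> x\<^sup>e\<close> with the projections of \<open>R\<close> onto its homogeneous
  components gives endomorphisms \<open>q\<^sub>\<rho>\<close> of \<open>G\<close>.  The critical types form an antichain, so every
  endomorphism of \<open>G\<close> commutes with all \<open>q\<^sub>\<rho>\<close>; hence each direct summand \<open>A\<close> has a set \<open>T(A)\<close> of
  types with \<open>q\<^sub>\<rho> \<noteq> 1\<close> on \<open>A\<close>, and \<open>card T(A) \<le> rk A\<close>.  If \<open>G = A\<^sub>1 \<oplus> \<dots> \<oplus> A\<^sub>t\<close> and a set
  \<open>U\<close> of types is separated from its complement by all \<open>T(A\<^sub>i)\<close>, the projection onto the \<open>U\<close>-part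
  maps \<open>G\<close> to \<open>G\<close>, and so it splits every summand \<open>B\<close>.  For indecomposable \<open>B\<close> it follows that
  \<open>T(B)\<close> lies in one connected component of the hypergraph with edges \<open>T(A\<^sub>i)\<close>, whence
  \<open>card T(B) - 1 \<le> (\<Sum>i. card T(A\<^sub>i) - 1) \<le> rk G - t\<close>.  Finally \<open>rk B \<le> card T(B)\<close>: since
  \<open>G / R\<close> is cyclic, \<open>B\<close> is generated modulo its homogeneous components by one element, whose
  image under \<open>q\<^sub>\<rho>\<close> lies in a rank-one summand of the \<open>\<rho>\<close>-component (a special case of a theorem of
  Baer); the complements of these rank-one groups split off from \<open>B\<close>.

  The equation holds because every indecomposable summand occurs in some indecomposable
  decomposition, so its rank is a part of a partition of \<open>n\<close> into \<open>k\<close> parts, and the partition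
  \<open>(n - k + 1, 1, \<dots>, 1)\<close> is realized.
\<close>

section \<open>Rank and direct decompositions\<close>

lemma hom_finprod:
  assumes "comm_group G" "comm_group H" "f \<in> hom G H" "g \<in> A \<rightarrow> carrier G"
  shows "f (finprod G g A) = finprod H (\<lambda>x. f (g x)) A"
proof -
  interpret G: comm_group G by fact
  interpret H: comm_group H by fact
  interpret f: group_hom G H f by unfold_locales fact
  show ?thesis
    using assms(4)
  proof (induction A rule: infinite_finite_induct)
    case (insert a A)
    then have "g \<in> A \<rightarrow> carrier G" "g a \<in> carrier G" by auto
    moreover from this have "(\<lambda>x. f (g x)) \<in> A \<rightarrow> carrier H" using f.hom_closed by blast
    ultimately show ?case using insert by simp
  qed auto
qed

text \<open>\<open>comm_group\<close> also covers extended records, while rank, decompositions and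
  \<open>G \<restriction>\<restriction> H\<close> live on plain \<open>monoid\<close> records. With
  the record type fixed, every lemma of this context can be interpreted again for a subgroup of
  \<open>G\<close>.\<close>

locale plain_comm_group = comm_group G for G :: "'a monoid" (structure)

context plain_comm_group
begin

lemma restrict_plain_comm_group:
  assumes "subgroup H G" shows "plain_comm_group (G \<restriction>\<restriction> H)"
  unfolding plain_comm_group_def
  using subgroup.subset[OF assms]
  by (intro group.group_comm_groupI) (auto intro: subgroup_imp_group assms m_comm)

lemma finprod_in_subgroup:
  assumes "subgroup H G" "f \<in> A \<rightarrow> H"
  shows "finprod G f A \<in> H"
  using assms(2)
proof (induction A rule: infinite_finite_induct)
  case (insert a A)
  then have "f \<in> A \<rightarrow> H" "f a \<in> H" "f \<in> A \<rightarrow> carrier G" "f a \<in> carrier G"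
    using subgroup.subset[OF assms(1)] by auto
  then show ?case using insert subgroup.m_closed[OF assms(1)] by simp
qed (use assms(1) in \<open>auto simp: subgroup.one_closed\<close>)

lemma finprod_restrict:
  assumes "subgroup H G" "f \<in> A \<rightarrow> H"
  shows "finprod (G \<restriction>\<restriction> H) f A = finprod G f A"
proof -
  interpret H: plain_comm_group "G \<restriction>\<restriction> H"
    by (rule restrict_plain_comm_group) fact
  show ?thesis
    using assms(2)
  proof (induction A rule: infinite_finite_induct)
    case (insert a A)
    then have "f \<in> A \<rightarrow> H" "f a \<in> H" "f \<in> A \<rightarrow> carrier G" "f a \<in> carrier G"
      using subgroup.subset[OF assms(1)] by auto
    then show ?case using insert by simp
  qed auto
qed

text \<open>Powers and finite products of elements of \<open>H\<close> are the same in
  \<open>H\<close> and in \<open>G\<close>. The rank of a subgroup can thus be measured by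
  independent sets of \<open>G\<close> that lie in it.\<close>

lemma int_independent_restrict:
  assumes "subgroup H G"
  shows "int_independent (G \<restriction>\<restriction> H) S \<longleftrightarrow> int_independent G S \<and> S \<subseteq> H"
proof -
  have "(\<Otimes>\<^bsub>G \<restriction>\<restriction> H\<^esub>x\<in>S. x [^]\<^bsub>G \<restriction>\<restriction> H\<^esub> c x) = (\<Otimes>x\<in>S. x [^] c x)"
    if "S \<subseteq> H" for c :: "'a \<Rightarrow> int"
  proof -
    interpret H: plain_comm_group "G \<restriction>\<restriction> H"
    by (rule restrict_plain_comm_group) fact
    have "(\<Otimes>\<^bsub>G \<restriction>\<restriction> H\<^esub>x\<in>S. x [^]\<^bsub>G \<restriction>\<restriction> H\<^esub> c x) = (\<Otimes>\<^bsub>G \<restriction>\<restriction> H\<^esub>x\<in>S. x [^] c x)"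
      using that int_pow_consistent[OF assms] subgroup_int_pow_closed[OF assms]
      by (intro H.finprod_cong) (auto simp: simp_implies_def)
    also have "\<dots> = (\<Otimes>x\<in>S. x [^] c x)"
      using that by (intro finprod_restrict[OF assms]) (auto intro: subgroup_int_pow_closed[OF assms])
    finally show ?thesis .
  qed
  then show ?thesis
    using subgroup.subset[OF assms] unfolding int_independent_def by auto
qed

lemma int_independent_empty: "int_independent G {}"
  by (simp add: int_independent_def)

lemma torsion_free_int:
  assumes "torsion_free G" "x \<in> carrier G" "x [^] (n::int) = \<one>" "n \<noteq> 0"
  shows "x = \<one>"
proof -
  obtain k where k: "n = int k \<or> n = - int k" by (metis int_cases2)
  have "x [^] k = \<one>"
    using k assms(2,3) int_pow_int[of G x k] int_pow_neg_int[of x k] inv_eq_1_iff[of "x [^] k"] by auto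
  moreover have "k > 0" using k assms(4) by auto
  ultimately show ?thesis using assms(1,2) unfolding torsion_free_def by blast
qed

lemma mult_inv_eq_one_imp_eq:
  assumes "x \<otimes> inv y = \<one>" "x \<in> carrier G" "y \<in> carrier G"
  shows "x = y"
proof -
  have "x = x \<otimes> inv y \<otimes> y" using assms(2,3) by (simp add: m_assoc)
  also have "\<dots> = y" using assms by simp
  finally show ?thesis .
qed

lemma torsion_free_int_pow_inj:
  assumes "torsion_free G" "x \<in> carrier G" "y \<in> carrier G" "x [^] (n::int) = y [^] n" "n \<noteq> 0"
  shows "x = y"
proof -
  have "(x \<otimes> inv y) [^] n = \<one>"
    using assms int_pow_distrib[of x "inv y" n] int_pow_inv[of y n] by simp
  then have "x \<otimes> inv y = \<one>" using assms torsion_free_int[of "x \<otimes> inv y" n] by simp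
  then show ?thesis using assms(2,3) by (rule mult_inv_eq_one_imp_eq)
qed

lemma card_le_rk:
  assumes "finite_rank G" "int_independent G S"
  shows "card S \<le> rk G"
  using assms unfolding finite_rank_def rk_def by (intro Max_ge) auto

lemma finite_rank_restrict:
  assumes "finite_rank G" "subgroup H G"
  shows "finite_rank (G \<restriction>\<restriction> H)"
  using assms(1) unfolding finite_rank_def
  by (rule rev_finite_subset) (auto simp: int_independent_restrict[OF assms(2)])

lemma rk_attained:
  assumes "finite_rank G"
  obtains S where "int_independent G S" "card S = rk G"
proof -
  have "rk G \<in> card ` {S. int_independent G S}"
    unfolding rk_def using assms int_independent_empty unfolding finite_rank_def by (intro Max_in) auto
  then show thesis using that by auto
qed

lemma rk_restrict_attained:
  assumes "finite_rank G" "subgroup H G"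
  obtains S where "int_independent G S" "S \<subseteq> H" "card S = rk (G \<restriction>\<restriction> H)"
proof -
  interpret H: plain_comm_group "G \<restriction>\<restriction> H"
    by (rule restrict_plain_comm_group) fact
  show thesis
    using H.rk_attained[OF finite_rank_restrict[OF assms]] that
    by (auto simp: int_independent_restrict[OF assms(2)])
qed

lemma card_le_rk_restrict:
  assumes "finite_rank G" "subgroup H G" "int_independent G S" "S \<subseteq> H"
  shows "card S \<le> rk (G \<restriction>\<restriction> H)"
proof -
  interpret H: plain_comm_group "G \<restriction>\<restriction> H"
    by (rule restrict_plain_comm_group) fact
  show ?thesis
    using H.card_le_rk[OF finite_rank_restrict[OF assms(1,2)]] assms
    by (auto simp: int_independent_restrict[OF assms(2)])
qed

lemma rk_restrict_le:
  assumes "finite_rank G" "subgroup H G"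
  shows "rk (G \<restriction>\<restriction> H) \<le> rk G"
  using rk_restrict_attained[OF assms] card_le_rk[OF assms(1)] by metis

lemma int_independent_singleton:
  assumes "torsion_free G" "x \<in> carrier G" "x \<noteq> \<one>"
  shows "int_independent G {x}"
  using assms torsion_free_int unfolding int_independent_def by auto

lemma one_notin_int_independent:
  assumes "int_independent G S" shows "\<one> \<notin> S"
proof
  assume "\<one> \<in> S"
  define c :: "'a \<Rightarrow> int" where "c = (\<lambda>x. if x = \<one> then 1 else 0)"
  have "(\<Otimes>x\<in>S. x [^] c x) = \<one>"
    by (intro finprod_one_eqI) (auto simp: c_def)
  then have "c \<one> = 0" using assms \<open>\<one> \<in> S\<close> unfolding int_independent_def by blast
  then show False by (simp add: c_def)
qed

lemma rk_trivial: "rk (G \<restriction>\<restriction> {\<one>}) = 0"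
proof -
  have "card ` {S. int_independent (G \<restriction>\<restriction> {\<one>}) S} = {0}"
    using one_notin_int_independent int_independent_empty
    by (auto simp: int_independent_restrict[OF triv_subgroup] subset_singleton_iff intro!: image_eqI[of _ _ "{}"])
  then show ?thesis by (simp add: rk_def)
qed

lemma rk_restrict_pos:
  assumes "torsion_free G" "finite_rank G" "subgroup H G" "H \<noteq> {\<one>}"
  shows "rk (G \<restriction>\<restriction> H) \<ge> 1"
proof -
  obtain x where "x \<in> H" "x \<noteq> \<one>" using assms(3,4) subgroup.one_closed by blast
  then show ?thesis
    using card_le_rk_restrict[OF assms(2,3) int_independent_singleton[OF assms(1)], of x]
      subgroup.mem_carrier[OF assms(3)] by auto
qed

end

text \<open>Projections as endomorphisms of \<open>G\<close> carry the same information as the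
  isomorphism from the product group, as the two conversions below show, and they compose with other
  homomorphisms without a detour through tuples.\<close>

definition proj_family :: "'a monoid \<Rightarrow> 'i set \<Rightarrow> ('i \<Rightarrow> 'a set) \<Rightarrow> ('i \<Rightarrow> 'a \<Rightarrow> 'a) \<Rightarrow> bool" where
  "proj_family G I A p \<longleftrightarrow> finite I \<and>
     (\<forall>i\<in>I. subgroup (A i) G \<and> p i \<in> hom G G \<and> p i ` carrier G \<subseteq> A i \<and>
        (\<forall>y\<in>A i. p i y = y) \<and> (\<forall>j\<in>I. j \<noteq> i \<longrightarrow> (\<forall>y\<in>A j. p i y = \<one>\<^bsub>G\<^esub>))) \<and>
     (\<forall>x\<in>carrier G. (\<Otimes>\<^bsub>G\<^esub>i\<in>I. p i x) = x)"

context plain_comm_group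
begin

lemma proj_family_subgroup:
  assumes "proj_family G I A p" "i \<in> I"
  shows "subgroup (A i) G"
  using assms unfolding proj_family_def by blast

lemma proj_family_finite: "proj_family G I A p \<Longrightarrow> finite I"
  unfolding proj_family_def by blast

lemma proj_family_hom: "proj_family G I A p \<Longrightarrow> i \<in> I \<Longrightarrow> p i \<in> hom G G"
  unfolding proj_family_def by blast

lemma proj_family_id: "proj_family G I A p \<Longrightarrow> i \<in> I \<Longrightarrow> y \<in> A i \<Longrightarrow> p i y = y"
  unfolding proj_family_def by blast

lemma proj_family_other:
  "proj_family G I A p \<Longrightarrow> i \<in> I \<Longrightarrow> j \<in> I \<Longrightarrow> i \<noteq> j \<Longrightarrow> y \<in> A j \<Longrightarrow> p i y = \<one>"
  unfolding proj_family_def by metis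

lemma proj_family_sum: "proj_family G I A p \<Longrightarrow> x \<in> carrier G \<Longrightarrow> (\<Otimes>i\<in>I. p i x) = x"
  unfolding proj_family_def by blast

lemma proj_family_in:
  assumes "proj_family G I A p" "i \<in> I" "x \<in> carrier G"
  shows "p i x \<in> A i"
  using assms unfolding proj_family_def by blast

lemma proj_family_closed:
  assumes "proj_family G I A p" "i \<in> I" "x \<in> carrier G"
  shows "p i x \<in> carrier G"
  using assms unfolding proj_family_def by (meson hom_in_carrier)

text \<open>The projections are the coordinates of the inverse of the product isomorphism.\<close>

lemma internal_direct_sum_imp_proj_family:
  assumes "internal_direct_sum G I A"
  obtains p where "proj_family G I A p"
proof -
  let ?P = "product_group I (\<lambda>i. G \<restriction>\<restriction> A i)"
  let ?F = "\<lambda>x. \<Otimes>i\<in>I. x i"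
  define q where "q = inv_into (carrier ?P) ?F"
  have I: "finite I" and sub: "\<And>i. i \<in> I \<Longrightarrow> subgroup (A i) G" and F: "?F \<in> iso ?P G"
    using assms by (auto simp: internal_direct_sum_def)
  have "group ?P"
    by (rule product_group) (use sub in \<open>simp add: subgroup_imp_group\<close>)
  then have q: "q \<in> iso G ?P"
    unfolding q_def using F by (rule group.iso_set_sym)
  have bij: "bij_betw ?F (carrier ?P) (carrier G)" using F by (simp add: iso_def)
  have qF: "q (?F x) = x" if "x \<in> carrier ?P" for x
    unfolding q_def using inv_into_f_f[of ?F "carrier ?P" x] bij that unfolding bij_betw_def by blast
  have Fq: "?F (q x) = x" if "x \<in> carrier G" for x
    unfolding q_def using f_inv_into_f[of x ?F "carrier ?P"] bij that unfolding bij_betw_def by blast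
  have qin: "q x \<in> carrier ?P" if "x \<in> carrier G" for x
    using q that by (auto simp: iso_def hom_def)
  have q_single: "q y i = (if i = j then y else \<one>)" if "j \<in> I" "y \<in> A j" "i \<in> I" for i j y
  proof -
    \<comment> \<open>The tuple with entry \<open>y\<close> at \<open>j\<close> and
      \<open>\<one>\<close> elsewhere has product \<open>y\<close>, so the inverse sends
      \<open>y\<close> to it.\<close>
    let ?z = "\<lambda>i\<in>I. if i = j then y else \<one>"
    have z: "?z \<in> carrier ?P" using that sub by (auto simp: subgroup.one_closed)
    have "?F ?z = (\<Otimes>i\<in>I. if j = i then y else \<one>)"
      using that subgroup.mem_carrier[OF sub] by (intro finprod_cong) (auto simp: simp_implies_def)
    also have "\<dots> = y"
      using finprod_singleton[of j I "\<lambda>_. y"] that I subgroup.mem_carrier[OF sub] by auto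
    finally have "q y = ?z" using qF[OF z] by simp
    then show ?thesis using that by simp
  qed
  have "proj_family G I A (\<lambda>i x. q x i)"
    unfolding proj_family_def
  proof (intro conjI ballI impI)
    fix i assume i: "i \<in> I"
    show "(\<lambda>x. q x i) \<in> hom G G"
    proof (rule homI)
      fix x y assume xy: "x \<in> carrier G" "y \<in> carrier G"
      show "q x i \<in> carrier G" using qin[OF xy(1)] i subgroup.mem_carrier[OF sub] by auto
      have "q (x \<otimes> y) = q x \<otimes>\<^bsub>?P\<^esub> q y" using q xy by (auto simp: iso_def hom_def)
      then show "q (x \<otimes> y) i = q x i \<otimes> q y i" using i by simp
    qed
    show "(\<lambda>x. q x i) ` carrier G \<subseteq> A i" using qin i by fastforce
  qed (use I sub q_single Fq in auto)
  then show thesis by (rule that)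
qed

lemma proj_family_imp_internal_direct_sum:
  assumes p: "proj_family G I A p"
  shows "internal_direct_sum G I A"
proof -
  let ?P = "product_group I (\<lambda>i. G \<restriction>\<restriction> A i)"
  let ?F = "\<lambda>x. \<Otimes>i\<in>I. x i"
  have I: "finite I" and sub: "\<And>i. i \<in> I \<Longrightarrow> subgroup (A i) G" using p by (auto simp: proj_family_def)
  have mem: "x i \<in> carrier G" if "x \<in> carrier ?P" "i \<in> I" for x i
    using that subgroup.mem_carrier[OF sub] by auto
  have "?F \<in> hom ?P G"
  proof (rule homI)
    fix x y assume xy: "x \<in> carrier ?P" "y \<in> carrier ?P"
    show "?F x \<in> carrier G" using mem xy by (intro finprod_closed) auto
    have "?F (x \<otimes>\<^bsub>?P\<^esub> y) = (\<Otimes>i\<in>I. x i \<otimes> y i)"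
      using mem xy by (intro finprod_cong) (auto simp: simp_implies_def)
    also have "\<dots> = ?F x \<otimes> ?F y" using mem xy by (intro finprod_multf) auto
    finally show "?F (x \<otimes>\<^bsub>?P\<^esub> y) = ?F x \<otimes> ?F y" .
  qed
  moreover have "bij_betw ?F (carrier ?P) (carrier G)"
  proof (rule bij_betw_byWitness[where f' = "\<lambda>x. \<lambda>i\<in>I. p i x"])
    show "\<forall>x\<in>carrier ?P. (\<lambda>i\<in>I. p i (?F x)) = x"
    proof
      fix x assume x: "x \<in> carrier ?P"
      have "p i (?F x) = x i" if i: "i \<in> I" for i
      proof -
        have "p i (?F x) = (\<Otimes>j\<in>I. p i (x j))"
          using p i x mem by (intro hom_finprod) (auto simp: proj_family_def comm_group_axioms)
        also have "\<dots> = (\<Otimes>j\<in>I. if i = j then x j else \<one>)"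
        proof (rule finprod_cong')
          show "(\<lambda>j. if i = j then x j else \<one>) \<in> I \<rightarrow> carrier G" using x mem by auto
          fix j assume j: "j \<in> I"
          then have "x j \<in> A j" using x by auto
          then show "p i (x j) = (if i = j then x j else \<one>)"
            using p i j by (auto simp: proj_family_def)
        qed simp
        also have "\<dots> = x i" using x mem i I by (intro finprod_singleton) auto
        finally show ?thesis .
      qed
      then show "(\<lambda>i\<in>I. p i (?F x)) = x" using x by (intro ext) (auto simp: PiE_def extensional_def)
    qed
    show "\<forall>x\<in>carrier G. ?F (\<lambda>i\<in>I. p i x) = x"
    proof
      fix x assume x: "x \<in> carrier G"
      have "?F (\<lambda>i\<in>I. p i x) = (\<Otimes>i\<in>I. p i x)"
        using proj_family_closed[OF p] x by (intro finprod_cong') auto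
      also have "\<dots> = x" using p x by (auto simp: proj_family_def)
      finally show "?F (\<lambda>i\<in>I. p i x) = x" .
    qed
    show "?F ` carrier ?P \<subseteq> carrier G" using mem by (auto intro!: finprod_closed)
    show "(\<lambda>x. \<lambda>i\<in>I. p i x) ` carrier G \<subseteq> carrier ?P" using proj_family_in[OF p] by auto
  qed
  ultimately show ?thesis using I sub by (auto simp: internal_direct_sum_def iso_def)
qed

lemma mult_eq_swap:
  assumes "a \<otimes> b = c \<otimes> d" "a \<in> carrier G" "b \<in> carrier G" "c \<in> carrier G" "d \<in> carrier G"
  shows "inv c \<otimes> a = d \<otimes> inv b"
proof -
  have "inv c \<otimes> a = inv c \<otimes> (a \<otimes> b) \<otimes> inv b"
    using assms(2-) by (simp add: m_assoc)
  also have "\<dots> = inv c \<otimes> (c \<otimes> d) \<otimes> inv b" using assms(1) by simp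
  also have "\<dots> = d \<otimes> inv b" using assms(2-) by (simp add: m_assoc[symmetric])
  finally show ?thesis .
qed

text \<open>Two decompositions of one element differ by an element of \<open>B \<inter> C\<close>,
  so the \<open>B\<close>-part is well defined. It is a homomorphism because the product of two
  decompositions decomposes the product.\<close>

lemma direct_sum2_projection:
  assumes "direct_sum2 G B C"
  obtains f where "f \<in> hom G G" "\<And>x. x \<in> carrier G \<Longrightarrow> f x \<in> B"
    "\<And>x. x \<in> carrier G \<Longrightarrow> x \<otimes> inv (f x) \<in> C"
    "\<And>x. x \<in> B \<Longrightarrow> f x = x" "\<And>x. x \<in> C \<Longrightarrow> f x = \<one>"
proof -
  have B: "subgroup B G" and C: "subgroup C G" and BC: "B \<inter> C = {\<one>}" "B <#> C = carrier G"
    using assms by (auto simp: direct_sum2_def)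
  have [simp]: "\<And>x. x \<in> B \<Longrightarrow> x \<in> carrier G" "\<And>x. x \<in> C \<Longrightarrow> x \<in> carrier G"
    using B C by (auto dest: subgroup.mem_carrier)
  have uniq: "b = b'" if "b \<in> B" "b' \<in> B" "c \<in> C" "c' \<in> C" "b \<otimes> c = b' \<otimes> c'" for b b' c c'
  proof -
    have "inv b' \<otimes> b = c' \<otimes> inv c"
      using that by (intro mult_eq_swap) simp_all
    moreover have "inv b' \<otimes> b \<in> B" "c' \<otimes> inv c \<in> C"
      using that B C by (auto simp: subgroup.m_closed subgroup.m_inv_closed)
    ultimately have "inv b' \<otimes> b \<in> B \<inter> C" by simp
    then have "inv b' \<otimes> b = \<one>" using BC(1) by simp
    then have "inv b = inv b'" using that inv_equality[of "inv b'" b] by simp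
    then show ?thesis using that inv_inj by (simp add: inj_on_def)
  qed
  have ex: "\<exists>b\<in>B. \<exists>c\<in>C. x = b \<otimes> c" if "x \<in> carrier G" for x
    using that unfolding BC(2)[symmetric] set_mult_def by auto
  define f where "f x = (SOME b. b \<in> B \<and> (\<exists>c\<in>C. x = b \<otimes> c))" for x
  have f: "f x \<in> B \<and> (\<exists>c\<in>C. x = f x \<otimes> c)" if "x \<in> carrier G" for x
    unfolding f_def by (rule someI_ex) (use ex[OF that] in blast)
  have feq: "f (b \<otimes> c) = b" if bc: "b \<in> B" "c \<in> C" for b c
  proof -
    obtain c' where "c' \<in> C" "b \<otimes> c = f (b \<otimes> c) \<otimes> c'" using f[of "b \<otimes> c"] bc by auto
    then show ?thesis using uniq[of b "f (b \<otimes> c)" c c'] f[of "b \<otimes> c"] bc by auto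
  qed
  show thesis
  proof (rule that[of f])
    show "f \<in> hom G G"
    proof (rule homI)
      fix x y assume xy: "x \<in> carrier G" "y \<in> carrier G"
      show "f x \<in> carrier G" using f xy by auto
      obtain c d where cd: "c \<in> C" "x = f x \<otimes> c" "d \<in> C" "y = f y \<otimes> d" using f xy by blast
      have m: "f x \<in> carrier G" "f y \<in> carrier G" using f xy by auto
      have "x \<otimes> y = (f x \<otimes> c) \<otimes> (f y \<otimes> d)" using cd by simp
      also have "\<dots> = (f x \<otimes> f y) \<otimes> (c \<otimes> d)" using cd(1,3) m by (simp add: m_ac)
      finally have "x \<otimes> y = (f x \<otimes> f y) \<otimes> (c \<otimes> d)" .
      then show "f (x \<otimes> y) = f x \<otimes> f y"
        using feq[of "f x \<otimes> f y" "c \<otimes> d"] f xy cd B C by (auto simp: subgroup.m_closed)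
    qed
  next
    fix x assume x: "x \<in> carrier G"
    then show "f x \<in> B" using f by auto
    obtain c where c: "c \<in> C" "x = f x \<otimes> c" using f x by blast
    have "x \<otimes> inv (f x) = (f x \<otimes> c) \<otimes> inv (f x)" using c by simp
    also have "\<dots> = c" using c(1) f x by (simp add: m_comm[of "f x" c] m_assoc)
    finally show "x \<otimes> inv (f x) \<in> C" using c by simp
  next
    show "f x = x" if "x \<in> B" for x
      using feq[of x \<one>] that C by (auto simp: subgroup.one_closed)
    show "f x = \<one>" if "x \<in> C" for x
      using feq[of \<one> x] that B by (auto simp: subgroup.one_closed)
  qed
qed

lemma int_pow_finprod:
  assumes "f \<in> A \<rightarrow> carrier G"
  shows "(\<Otimes>x\<in>A. f x) [^] (n::int) = (\<Otimes>x\<in>A. f x [^] n)"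
  using assms
proof (induction A rule: infinite_finite_induct)
  case (insert a A)
  then have "f \<in> A \<rightarrow> carrier G" "f a \<in> carrier G" by auto
  moreover from this have "(\<lambda>x. f x [^] n) \<in> A \<rightarrow> carrier G" by auto
  ultimately show ?case using insert by (simp add: int_pow_distrib)
qed auto

lemma finprod_single:
  assumes "finite A" "i \<in> A" "f \<in> A \<rightarrow> carrier G" "\<And>j. j \<in> A \<Longrightarrow> j \<noteq> i \<Longrightarrow> f j = \<one>"
  shows "(\<Otimes>j\<in>A. f j) = f i"
proof -
  have "(\<Otimes>j\<in>A. f j) = (\<Otimes>j\<in>A. if i = j then f j else \<one>)"
    using assms by (intro finprod_cong') auto
  also have "\<dots> = f i" using assms by (intro finprod_singleton) auto
  finally show ?thesis .
qed

lemma hom_pow: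
  assumes "f \<in> hom G G" "x \<in> carrier G"
  shows "f (x [^] (n::int)) = f x [^] n"
  using assms hom_int_pow[of f G G x n] is_group by auto

lemma hom_one_end:
  assumes "f \<in> hom G G" shows "f \<one> = \<one>"
  using assms hom_one[of f G G] is_group by auto

section \<open>Ranks of direct sums\<close>

lemma proj_family_apply_pow_sum:
  assumes p: "proj_family G I A p" and i: "i \<in> I"
    and S: "\<And>j. j \<in> I \<Longrightarrow> S j \<subseteq> A j" "\<And>j. j \<in> I \<Longrightarrow> finite (S j)"
    and dis: "\<And>j k. j \<in> I \<Longrightarrow> k \<in> I \<Longrightarrow> j \<noteq> k \<Longrightarrow> S j \<inter> S k = {}"
  shows "p i (\<Otimes>x\<in>(\<Union>j\<in>I. S j). x [^] (c x :: int)) = (\<Otimes>x\<in>S i. x [^] c x)"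
proof -
  have sub: "\<And>j. j \<in> I \<Longrightarrow> A j \<subseteq> carrier G"
    using proj_family_subgroup[OF p] subgroup.subset by blast
  have I: "finite I" and pi: "p i \<in> hom G G"
    using proj_family_finite[OF p] proj_family_hom[OF p i] by auto
  have mem: "x \<in> carrier G" if "x \<in> (\<Union>j\<in>I. S j)" for x using that S sub by blast
  have "p i (\<Otimes>x\<in>(\<Union>j\<in>I. S j). x [^] c x) = (\<Otimes>x\<in>(\<Union>j\<in>I. S j). p i (x [^] c x))"
    using mem pi by (intro hom_finprod) (auto simp: comm_group_axioms)
  \<comment> \<open>\<open>p i\<close> fixes the factors from \<open>S i\<close> and sends all
    others to \<open>\<one>\<close>, so a relation on the union yields one on \<open>S i\<close>
    alone.\<close>
  also have "\<dots> = (\<Otimes>x\<in>S i. x [^] c x)"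
  proof (rule finprod_mono_neutral_cong_right)
    show "\<And>x. x \<in> (\<Union>j\<in>I. S j) - S i \<Longrightarrow> p i (x [^] c x) = \<one>"
    proof -
      fix x assume "x \<in> (\<Union>j\<in>I. S j) - S i"
      then obtain j where j: "j \<in> I" "x \<in> S j" "j \<noteq> i" by auto
      then have "p i x = \<one>" using proj_family_other[OF p i j(1)] S(1)[OF j(1)] by auto
      then show "p i (x [^] c x) = \<one>" using hom_pow[OF pi mem, of x "c x"] j by auto
    qed
    show "p i (x [^] c x) = x [^] c x" if "x \<in> S i" for x
    proof -
      have "p i x = x" using proj_family_id[OF p i] S(1)[OF i] that by auto
      then show ?thesis using hom_pow[OF pi mem, of x "c x"] that i by auto
    qed
    show "(\<lambda>x. p i (x [^] c x)) \<in> (\<Union>j\<in>I. S j) \<rightarrow> carrier G"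
      using mem hom_in_carrier[OF pi] by auto
  qed (use I S i in auto)
  finally show ?thesis .
qed

lemma proj_family_int_independent_Union:
  assumes p: "proj_family G I A p"
    and S: "\<And>j. j \<in> I \<Longrightarrow> S j \<subseteq> A j" "\<And>j. j \<in> I \<Longrightarrow> int_independent G (S j)"
  shows "int_independent G (\<Union>j\<in>I. S j)" "card (\<Union>j\<in>I. S j) = (\<Sum>j\<in>I. card (S j))"
proof -
  have I: "finite I" and fin: "\<And>j. j \<in> I \<Longrightarrow> finite (S j)" and carr: "\<And>j. j \<in> I \<Longrightarrow> S j \<subseteq> carrier G"
    using proj_family_finite[OF p] S by (auto simp: int_independent_def)
  \<comment> \<open>An element of two different summands is \<open>\<one>\<close>, which belongs to
    no independent set.\<close>
  have dis: "S j \<inter> S k = {}" if jk: "j \<in> I" "k \<in> I" "j \<noteq> k" for j k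
  proof -
    have "x = \<one>" if "x \<in> S j" "x \<in> S k" for x
    proof -
      have "x \<in> A j" "x \<in> A k" using that jk S by auto
      then show ?thesis using proj_family_id[OF p jk(1), of x] proj_family_other[OF p jk, of x] by simp
    qed
    then show ?thesis using one_notin_int_independent[OF S(2)[OF jk(1)]] by blast
  qed
  show "card (\<Union>j\<in>I. S j) = (\<Sum>j\<in>I. card (S j))"
    using I fin dis by (intro card_UN_disjoint) auto
  have "c x = 0" if eq: "(\<Otimes>x\<in>(\<Union>j\<in>I. S j). x [^] (c x :: int)) = \<one>" and x: "x \<in> S i" "i \<in> I" for c x i
  proof -
    have "(\<Otimes>x\<in>S i. x [^] c x) = p i \<one>"
      using proj_family_apply_pow_sum[OF p x(2) S(1) fin dis, of c] eq by simp
    also have "\<dots> = \<one>" using p x(2) by (intro hom_one_end proj_family_hom)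
    finally show ?thesis using S(2)[OF x(2)] x(1) unfolding int_independent_def by blast
  qed
  then show "int_independent G (\<Union>j\<in>I. S j)"
    using I fin carr unfolding int_independent_def by blast
qed

text \<open>Independent sets of maximal size in the summands have an independent union in
  \<open>G\<close>.\<close>

lemma sum_rk_le_rk:
  assumes fr: "finite_rank G" and p: "internal_direct_sum G I A"
  shows "(\<Sum>i\<in>I. rk (G \<restriction>\<restriction> A i)) \<le> rk G"
proof -
  obtain p where p: "proj_family G I A p" using internal_direct_sum_imp_proj_family[OF p] .
  have "\<exists>S. int_independent G S \<and> S \<subseteq> A i \<and> card S = rk (G \<restriction>\<restriction> A i)" if "i \<in> I" for i
    using rk_restrict_attained[OF fr, of "A i"] proj_family_subgroup[OF p that] by metis
  then obtain S where S: "\<And>i. i \<in> I \<Longrightarrow> int_independent G (S i) \<and> S i \<subseteq> A i \<and> card (S i) = rk (G \<restriction>\<restriction> A i)"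
    by metis
  then show ?thesis
    using proj_family_int_independent_Union[OF p, of S] card_le_rk[OF fr, of "\<Union>j\<in>I. S j"] by simp
qed

lemma card_summands_le_rk:
  assumes "torsion_free G" and fr: "finite_rank G" and p: "internal_direct_sum G I A"
    and nz: "\<And>i. i \<in> I \<Longrightarrow> A i \<noteq> {\<one>}"
  shows "card I \<le> rk G"
proof -
  have "card I = (\<Sum>i\<in>I. 1)" by simp
  also have "\<dots> \<le> (\<Sum>i\<in>I. rk (G \<restriction>\<restriction> A i))"
    using assms by (intro sum_mono rk_restrict_pos) (auto simp: internal_direct_sum_def)
  also have "\<dots> \<le> rk G" by (rule sum_rk_le_rk) fact+
  finally show ?thesis .
qed

section \<open>Refinement to indecomposable decompositions\<close>

lemma internal_direct_sum_split:
  assumes A: "internal_direct_sum G {..<t} A" and j: "j < t"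
    and UW: "direct_sum2 (G \<restriction>\<restriction> A j) U W"
  shows "internal_direct_sum G {..<Suc t} (A(j := U, t := W))"
proof -
  obtain p where p: "proj_family G {..<t} A p" using internal_direct_sum_imp_proj_family[OF A] .
  have Aj: "subgroup (A j) G" using proj_family_subgroup[OF p] j by auto
  interpret H: plain_comm_group "G \<restriction>\<restriction> A j" by (rule restrict_plain_comm_group) fact
  obtain f where f: "f \<in> hom (G \<restriction>\<restriction> A j) (G \<restriction>\<restriction> A j)" "\<And>x. x \<in> A j \<Longrightarrow> f x \<in> U"
    "\<And>x. x \<in> A j \<Longrightarrow> x \<otimes> inv (f x) \<in> W"
    "\<And>x. x \<in> U \<Longrightarrow> f x = x" "\<And>x. x \<in> W \<Longrightarrow> f x = \<one>"
  proof -
    obtain f where f: "f \<in> hom (G \<restriction>\<restriction> A j) (G \<restriction>\<restriction> A j)" "\<And>x. x \<in> A j \<Longrightarrow> f x \<in> U"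
    "\<And>x. x \<in> A j \<Longrightarrow> x \<otimes> inv\<^bsub>G \<restriction>\<restriction> A j\<^esub> (f x) \<in> W"
    "\<And>x. x \<in> U \<Longrightarrow> f x = x" "\<And>x. x \<in> W \<Longrightarrow> f x = \<one>"
      using H.direct_sum2_projection[OF UW] by auto
    have "inv\<^bsub>G \<restriction>\<restriction> A j\<^esub> (f x) = inv (f x)" if "x \<in> A j" for x
      using m_inv_consistent[OF Aj, of "f x"] f(1) that by (auto simp: hom_def)
    then show thesis using f that by simp
  qed
  have "subgroup U (G \<restriction>\<restriction> A j)" "subgroup W (G \<restriction>\<restriction> A j)"
    using UW by (auto simp: direct_sum2_def)
  then have UA: "U \<subseteq> A j" "W \<subseteq> A j" and UWs: "subgroup U G" "subgroup W G"
    using incl_subgroup[OF Aj] subgroup.subset[of _ "G \<restriction>\<restriction> A j"] by auto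
  \<comment> \<open>\<open>p j\<close> is followed by the two projections of \<open>A j\<close>:
    onto \<open>U\<close> at the old index \<open>j\<close> and onto \<open>W\<close> at the fresh
    index \<open>t\<close>. All other projections stay.\<close>
  define q where "q i x = (if i = t then p j x \<otimes> inv (f (p j x)) else if i = j then f (p j x) else p i x)" for i x
  have Ac: "A i \<subseteq> carrier G" if "i < t" for i
    using proj_family_subgroup[OF p, of i] subgroup.subset that by auto
  have pj: "p j x \<in> A j" if "x \<in> carrier G" for x using proj_family_in[OF p] j that by auto
  have fA: "f x \<in> A j" if "x \<in> A j" for x using f(2) UA that by auto
  have phom: "p i (x \<otimes> y) = p i x \<otimes> p i y" if "i < t" "x \<in> carrier G" "y \<in> carrier G" for i x y
    using proj_family_hom[OF p, of i] that by (auto simp: hom_def)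
  have fhom: "f (x \<otimes> y) = f x \<otimes> f y" if "x \<in> A j" "y \<in> A j" for x y
    using f(1) that by (auto simp: hom_def)
  have fone: "f \<one> = \<one>" using f(5) UWs subgroup.one_closed by blast
  have pid: "p i y = y" if "i < t" "y \<in> A i" for i y using proj_family_id[OF p] that by auto
  have pz: "p i y = \<one>" if "i < t" "k < t" "i \<noteq> k" "y \<in> A k" for i k y
    using proj_family_other[OF p] that by auto
  let ?A = "A(j := U, t := W)"
  have "proj_family G {..<Suc t} ?A q"
    unfolding proj_family_def
  proof (intro conjI ballI impI)
    show "finite {..<Suc t}" by simp
  next
    fix i assume i: "i \<in> {..<Suc t}"
    show "subgroup (?A i) G" using i UWs proj_family_subgroup[OF p] by auto
    show "q i ` carrier G \<subseteq> ?A i"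
      using i j f(2,3) pj proj_family_in[OF p] by (auto simp: q_def)
    show "q i \<in> hom G G"
    proof (rule homI)
      fix x y assume xy: "x \<in> carrier G" "y \<in> carrier G"
      note c = subsetD[OF Ac[OF j] pj[OF xy(1)]] subsetD[OF Ac[OF j] pj[OF xy(2)]]
        subsetD[OF Ac[OF j] fA[OF pj[OF xy(1)]]] subsetD[OF Ac[OF j] fA[OF pj[OF xy(2)]]]
      show "q i x \<in> carrier G"
        using i xy c proj_family_closed[OF p] by (auto simp: q_def)
      have e: "p j (x \<otimes> y) = p j x \<otimes> p j y" "f (p j x \<otimes> p j y) = f (p j x) \<otimes> f (p j y)"
        using phom[OF j xy] fhom[OF pj[OF xy(1)] pj[OF xy(2)]] by auto
      show "q i (x \<otimes> y) = q i x \<otimes> q i y"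
        using i xy phom[of i x y] c by (auto simp: q_def e inv_mult m_ac)
    qed
    fix y assume y: "y \<in> ?A i"
    show "q i y = y"
    proof (cases "i = t")
      case True
      then have "y \<in> W" "y \<in> A j" using y UA by auto
      then show ?thesis using True f(5) pid[OF j] Ac[OF j] by (auto simp: q_def)
    next
      case False
      show ?thesis using False i y UA f(4) pid[of i y] by (auto simp: q_def split: if_splits)
    qed
  next
    fix i k y assume i: "i \<in> {..<Suc t}" and k: "k \<in> {..<Suc t}" "k \<noteq> i" and y: "y \<in> ?A k"
    consider "k = t" "y \<in> W" "y \<in> A j" | "k = j" "k \<noteq> t" "y \<in> U" "y \<in> A j" | "k < t" "k \<noteq> j" "y \<in> A k"
      using k y UA by (auto split: if_splits)
    then show "q i y = \<one>"
    proof cases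
      case 1
      then show ?thesis using i k j f(5) pid[OF j] pz[of i j y] by (auto simp: q_def)
    next
      case 2
      then show ?thesis using i k j f(4) pid[OF j] pz[of i j y] Ac[OF j] by (auto simp: q_def)
    next
      case 3
      then show ?thesis using i k j pz[of i k y] pz[of j k y] fone by (auto simp: q_def)
    qed
  next
    fix x assume x: "x \<in> carrier G"
    note c = subsetD[OF Ac[OF j] pj[OF x]] subsetD[OF Ac[OF j] fA[OF pj[OF x]]]
    have mem: "(\<lambda>i. p i x) \<in> {..<t} \<rightarrow> carrier G" using proj_family_closed[OF p] x by auto
    \<comment> \<open>\<open>J\<close> holds the untouched indices; the factors at \<open>t\<close>
      and \<open>j\<close> multiply to \<open>p j x\<close>.\<close>
    obtain J where J: "{..<t} = insert j J" "j \<notin> J" "finite J" "t \<notin> J" "J \<subseteq> {..<t}"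
      using j by (intro that[of "{..<t} - {j}"]) auto
    then have decomp: "{..<Suc t} = insert t (insert j J)" by (simp add: lessThan_Suc)
    have memq: "(\<lambda>i. q i x) \<in> J \<rightarrow> carrier G" "q t x \<in> carrier G" "q j x \<in> carrier G"
      using proj_family_closed[OF p _ x] c j J by (auto simp: q_def)
    have "(\<Otimes>i\<in>{..<Suc t}. q i x) = q t x \<otimes> (q j x \<otimes> (\<Otimes>i\<in>J. q i x))"
      unfolding decomp using memq J j by simp
    also have "\<dots> = (q t x \<otimes> q j x) \<otimes> (\<Otimes>i\<in>J. q i x)"
      using memq by (simp add: m_assoc)
    also have "q t x \<otimes> q j x = p j x" using c j by (simp add: q_def m_assoc)
    also have "(\<Otimes>i\<in>J. q i x) = (\<Otimes>i\<in>J. p i x)"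
      using mem J by (intro finprod_cong') (auto simp: q_def)
    also have "p j x \<otimes> \<dots> = (\<Otimes>i\<in>insert j (J). p i x)"
      using mem c J by simp
    also have "\<dots> = x" using J(1) proj_family_sum[OF p x] by simp
    finally show "(\<Otimes>i\<in>{..<Suc t}. q i x) = x" .
  qed
  then show ?thesis by (rule proj_family_imp_internal_direct_sum)
qed

text \<open>The number of nontrivial summands is bounded by the rank, so a decomposition containing
  \<open>P\<close> with as many summands as possible exists. A decomposable summand could still be
  split, and it is never a member of \<open>P\<close>.\<close>

lemma indec_refinement:
  assumes tf: "torsion_free G" and fr: "finite_rank G"
    and A0: "internal_direct_sum G {..<t0::nat} A0" "\<And>i. i < t0 \<Longrightarrow> A0 i \<noteq> {\<one>}"
    and P: "P \<subseteq> A0 ` {..<t0}" "\<And>B. B \<in> P \<Longrightarrow> indecomposable (G \<restriction>\<restriction> B)"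
  shows "\<exists>t A. indec_decomposition G t A \<and> P \<subseteq> A ` {..<t}"
proof -
  define Q where "Q t \<longleftrightarrow> (\<exists>A. internal_direct_sum G {..<t} A \<and> (\<forall>i<t. A i \<noteq> {\<one>}) \<and> P \<subseteq> A ` {..<t})" for t :: nat
  have "Q t0" unfolding Q_def using A0 P by blast
  moreover have bound: "t \<le> rk G" if "Q t" for t
  proof -
    obtain A where "internal_direct_sum G {..<t} A" "\<forall>i<t. A i \<noteq> {\<one>}" using \<open>Q t\<close> unfolding Q_def by blast
    then show ?thesis using card_summands_le_rk[OF tf fr, of "{..<t}" A] by auto
  qed
  ultimately obtain t where t: "Q t" "\<And>s. Q s \<Longrightarrow> s \<le> t"
    using Greatest_le_nat[of Q _ "rk G"] GreatestI_nat[of Q t0 "rk G"] by metis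
  then obtain A where A: "internal_direct_sum G {..<t} A" "\<forall>i<t. A i \<noteq> {\<one>}" "P \<subseteq> A ` {..<t}"
    unfolding Q_def by blast
  have "indecomposable (G \<restriction>\<restriction> A j)" if j: "j < t" for j
  proof (cases "A j \<in> P")
    case True then show ?thesis using P by blast
  next
    case False
    show ?thesis
      unfolding indecomposable_def
    proof (intro allI impI, rule ccontr)
      fix U W assume UW: "direct_sum2 (G \<restriction>\<restriction> A j) U W"
        and n: "\<not> (U = {\<one>\<^bsub>G \<restriction>\<restriction> A j\<^esub>} \<or> W = {\<one>\<^bsub>G \<restriction>\<restriction> A j\<^esub>})"
      \<comment> \<open>A proper splitting of \<open>A j\<close> gives \<open>t + 1\<close>
        nontrivial summands; the members of \<open>P\<close> sit at indices other than
        \<open>j\<close> and survive.\<close>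
      let ?A = "A(j := U, t := W)"
      have "P \<subseteq> ?A ` {..<Suc t}"
      proof
        fix B assume B: "B \<in> P"
        then obtain i where i: "i < t" "B = A i" using A(3) by auto
        then have "i \<noteq> j" using B False by auto
        then show "B \<in> ?A ` {..<Suc t}" using i by (intro image_eqI[of _ _ i]) auto
      qed
      then have "Q (Suc t)"
        unfolding Q_def using internal_direct_sum_split[OF A(1) j UW] A(2) n by (intro exI[of _ ?A]) auto
      then show False using t(2) by fastforce
    qed
  qed
  then show ?thesis using A unfolding indec_decomposition_def by blast
qed

lemma proj_family_single: "proj_family G {..<Suc 0} (\<lambda>_. carrier G) (\<lambda>_ x. x)"
  unfolding proj_family_def by (auto simp: subgroup_self hom_def lessThan_Suc)

lemma exists_indec_decomposition:
  assumes "torsion_free G" "finite_rank G"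
  shows "\<exists>t A. indec_decomposition G t A"
proof (cases "carrier G = {\<one>}")
  case True
  \<comment> \<open>The trivial group decomposes into no summands at all.\<close>
  have "proj_family G {..<0::nat} (\<lambda>_. carrier G) (\<lambda>_ x. x)" using True by (simp add: proj_family_def)
  then show ?thesis using proj_family_imp_internal_direct_sum
    by (intro exI[of _ 0] exI[of _ "\<lambda>_. carrier G"]) (auto simp: indec_decomposition_def)
next
  case False
  show ?thesis
    using indec_refinement[OF assms proj_family_imp_internal_direct_sum[OF proj_family_single], of "{}"] False by auto
qed

text \<open>The decomposition of \<open>G\<close> into \<open>B\<close> and a complement is refined
  with \<open>B\<close> protected. If the complement is trivial, the starting point is
  \<open>G\<close> as its own single summand.\<close>

lemma indec_summand_extends:
  assumes tf: "torsion_free G" and fr: "finite_rank G"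
    and B: "direct_summand G B" "indecomposable (G \<restriction>\<restriction> B)" "B \<noteq> {\<one>}"
  shows "\<exists>t A i. indec_decomposition G t A \<and> i < t \<and> A i = B"
proof -
  obtain C where BC: "direct_sum2 G B C" using B by (auto simp: direct_summand_def)
  have "\<exists>t A. indec_decomposition G t A \<and> {B} \<subseteq> A ` {..<t}"
  proof (cases "C = {\<one>}")
    case True
    then have "B = carrier G"
      using BC subgroup.mem_carrier[of B G] by (force simp: direct_sum2_def set_mult_def)
    then show ?thesis
      using indec_refinement[OF tf fr proj_family_imp_internal_direct_sum[OF proj_family_single], of "{B}"] B by auto
  next
    case False
    have "internal_direct_sum G {..<Suc (Suc 0)} ((\<lambda>_. carrier G)(0 := B, Suc 0 := C))"
      using BC by (intro internal_direct_sum_split proj_family_imp_internal_direct_sum[OF proj_family_single]) auto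
    then show ?thesis
      by (rule indec_refinement[OF tf fr]) (use B False in \<open>auto simp: less_Suc_eq\<close>)
  qed
  then show ?thesis by auto
qed

section \<open>The maxima behind \<open>max_num_summands\<close> and
  \<open>max_indec_rank\<close>\<close>

lemma indec_decomposition_le_rk:
  assumes "torsion_free G" "finite_rank G" "indec_decomposition G t A"
  shows "t \<le> rk G"
  using card_summands_le_rk[OF assms(1,2), of "{..<t}" A] assms(3) by (auto simp: indec_decomposition_def)

text \<open>\<open>Max\<close> is informative only for finite nonempty sets: finiteness comes from
  the bound by the rank, nonemptiness from the existence of an indecomposable decomposition.\<close>

lemma max_num_summands_attained:
  assumes "torsion_free G" "finite_rank G"
  shows "\<exists>A. indec_decomposition G (max_num_summands G) A"
proof -
  have "max_num_summands G \<in> {t. \<exists>A. indec_decomposition G t A}"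
    unfolding max_num_summands_def
    using exists_indec_decomposition[OF assms] indec_decomposition_le_rk[OF assms]
    by (intro Max_in) (auto intro: finite_subset[of _ "{..rk G}"])
  then show ?thesis by simp
qed

lemma finite_indec_ranks:
  assumes "finite_rank G"
  shows "finite {rk (G \<restriction>\<restriction> B) | B. direct_summand G B \<and> indecomposable (G \<restriction>\<restriction> B)}"
  by (rule finite_subset[of _ "{..rk G}"])
     (auto simp: direct_summand_def direct_sum2_def intro: rk_restrict_le[OF assms])

text \<open>Counting as indecomposable, the trivial summand makes the set of ranks behind
  \<open>max_indec_rank\<close> nonempty for every \<open>G\<close>.\<close>

lemma trivial_direct_summand: "direct_summand G {\<one>}" "indecomposable (G \<restriction>\<restriction> {\<one>})"
proof -
  show "direct_summand G {\<one>}" unfolding direct_summand_def direct_sum2_def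
    by (rule exI[of _ "carrier G"]) (auto simp: triv_subgroup subgroup_self set_mult_def)
  show "indecomposable (G \<restriction>\<restriction> {\<one>})"
    unfolding indecomposable_def direct_sum2_def by (auto dest!: subgroup.subset)
qed

lemma max_indec_rank_attained:
  assumes "finite_rank G"
  shows "\<exists>B. direct_summand G B \<and> indecomposable (G \<restriction>\<restriction> B) \<and> rk (G \<restriction>\<restriction> B) = max_indec_rank G"
proof -
  have "max_indec_rank G \<in> {rk (G \<restriction>\<restriction> B) | B. direct_summand G B \<and> indecomposable (G \<restriction>\<restriction> B)}"
    unfolding max_indec_rank_def using trivial_direct_summand
    by (intro Max_in finite_indec_ranks[OF assms]) auto
  then show ?thesis by auto
qed

end

section \<open>Realized partitions\<close>

text \<open>The other \<open>k - 1\<close> parts are positive and therefore sum to at least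
  \<open>k - 1\<close>.\<close>

lemma partitions_into_part_le:
  assumes "p \<in> \<C> n k" "x \<in># p"
  shows "x + k \<le> n + 1"
proof -
  obtain q where q: "p = add_mset x q" using assms(2) by (metis insert_DiffM)
  have "0 \<notin># q" using assms q by (auto simp: partitions_into_def)
  then have "size q \<le> sum_mset q"
  proof (induction q)
    case (add y q)
    then have "size q \<le> sum_mset q" "1 \<le> y" by auto
    then show ?case by simp
  qed simp
  then show ?thesis using assms q by (auto simp: partitions_into_def)
qed

text \<open>The hook partition attains the preceding bound on a part.\<close>

lemma partitions_into_hook:
  assumes "1 \<le> k" "k \<le> n"
  shows "add_mset (n + 1 - k) (replicate_mset (k - 1) 1) \<in> \<C> n k"
  using assms by (auto simp: partitions_into_def sum_mset_replicate_mset)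

context plain_comm_group
begin

text \<open>The kernel of the projection onto \<open>A i\<close> is a complement.\<close>

lemma internal_direct_sum_summand:
  assumes "internal_direct_sum G I A" "i \<in> I"
  shows "direct_summand G (A i)"
proof -
  obtain p where p: "proj_family G I A p" using internal_direct_sum_imp_proj_family[OF assms(1)] .
  note h = proj_family_hom[OF p assms(2)]
  interpret h: group_hom G G "p i" by unfold_locales (rule h)
  have s: "subgroup (A i) G" by (rule proj_family_subgroup[OF p assms(2)])
  note [simp] = proj_family_id[OF p assms(2)] subgroup.mem_carrier[OF s]
  have "direct_sum2 G (A i) (kernel G G (p i))"
    unfolding direct_sum2_def
  proof (intro conjI)
    show "subgroup (kernel G G (p i)) G" by (rule h.subgroup_kernel)
    show "A i \<inter> kernel G G (p i) = {\<one>}"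
      using subgroup.one_closed[OF s] by (auto simp: kernel_def)
    show "A i <#> kernel G G (p i) = carrier G"
    proof
      show "A i <#> kernel G G (p i) \<subseteq> carrier G" by (auto simp: set_mult_def kernel_def)
      show "carrier G \<subseteq> A i <#> kernel G G (p i)"
      proof
        fix x assume x: "x \<in> carrier G"
        have px: "p i x \<in> A i" using proj_family_in[OF p assms(2) x] .
        then have "inv (p i x) \<otimes> x \<in> kernel G G (p i)" using x by (auto simp: kernel_def)
        moreover have "x = p i x \<otimes> (inv (p i x) \<otimes> x)" using x px by (simp add: m_assoc[symmetric])
        ultimately show "x \<in> A i <#> kernel G G (p i)" using px unfolding set_mult_def by blast
      qed
    qed
  qed (rule s)
  then show ?thesis by (auto simp: direct_summand_def)
qed

theorem rank_plus_summands_of_full_partition_set: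
  assumes "torsion_free G" "finite_rank G" "1 \<le> k" "k \<le> n" and eq: "\<P> G = \<C> n k"
  shows "max_indec_rank G + max_num_summands G = n + 1"
proof -
  let ?p = "\<lambda>t A. image_mset (\<lambda>i. rk (G \<restriction>\<restriction> A i)) (mset_set {..<t})"
  have inC: "?p t A \<in> \<C> n k" if "indec_decomposition G t A" for t A
    using that eq by (auto simp: realized_partitions_def)
  \<comment> \<open>The multiset \<open>?p t A\<close> has size \<open>t\<close>, so every
    indecomposable decomposition has exactly \<open>k\<close> summands.\<close>
  have t: "max_num_summands G = k"
    using max_num_summands_attained[OF assms(1,2)] inC by (auto simp: partitions_into_def)
  have le: "max_indec_rank G \<le> n + 1 - k"
  proof -
    obtain B where B: "direct_summand G B" "indecomposable (G \<restriction>\<restriction> B)" "rk (G \<restriction>\<restriction> B) = max_indec_rank G"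
      using max_indec_rank_attained[OF assms(2)] by blast
    show ?thesis
    proof (cases "B = {\<one>}")
      case True then show ?thesis using B rk_trivial by simp
    next
      case False
      obtain t A i where A: "indec_decomposition G t A" "i < t" "A i = B"
        using indec_summand_extends[OF assms(1,2) B(1,2) False] by blast
      then have "rk (G \<restriction>\<restriction> B) \<in># ?p t A" by auto
      then show ?thesis using partitions_into_part_le[OF inC[OF A(1)]] B(3) by fastforce
    qed
  qed
  have ge: "n + 1 - k \<le> max_indec_rank G"
  proof -
    obtain t A where A: "indec_decomposition G t A" "?p t A = add_mset (n + 1 - k) (replicate_mset (k - 1) 1)"
      using partitions_into_hook[OF assms(3,4)] unfolding eq[symmetric] realized_partitions_def by auto
    have "n + 1 - k \<in># ?p t A" unfolding A(2) by simp
    then obtain i where i: "i < t" "rk (G \<restriction>\<restriction> A i) = n + 1 - k" by auto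
    then have "direct_summand G (A i)" "indecomposable (G \<restriction>\<restriction> A i)"
      using A(1) internal_direct_sum_summand[of "{..<t}" A i] by (auto simp: indec_decomposition_def)
    then show ?thesis
      unfolding max_indec_rank_def using i by (intro Max_ge finite_indec_ranks[OF assms(2)]) force
  qed
  show ?thesis using le ge t assms by simp
qed

end

section \<open>Connected hypergraphs and an upper bound for the rank\<close>

text \<open>Fraction-free Gaussian elimination on the equations indexed by \<open>Z\<close> in the
  unknowns indexed by \<open>S\<close>, one equation at a time.\<close>

lemma integer_kernel_nontrivial:
  fixes f :: "'a \<Rightarrow> 'b \<Rightarrow> int"
  assumes "finite Z" "finite S" "card Z < card S"
  shows "\<exists>c :: 'a \<Rightarrow> int. (\<exists>x\<in>S. c x \<noteq> 0) \<and> (\<forall>z\<in>Z. (\<Sum>x\<in>S. c x * f x z) = 0)"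
  using assms
proof (induction Z arbitrary: S f rule: finite_induct)
  case empty
  then obtain x where "x \<in> S" by fastforce
  then show ?case by (intro exI[of _ "\<lambda>_. 1"]) auto
next
  case (insert y Z)
  show ?case
  proof (cases "\<forall>x\<in>S. f x y = 0")
    case True
    obtain c where "\<exists>x\<in>S. c x \<noteq> 0" "\<forall>z\<in>Z. (\<Sum>x\<in>S. c x * f x z) = 0"
      using insert.IH[of S f] insert.prems insert.hyps by auto
    then show ?thesis using True by (intro exI[of _ c]) auto
  next
    case False
    then obtain w where w: "w \<in> S" "f w y \<noteq> 0" by auto
    let ?S = "S - {w}"
    have "card Z < card ?S" using insert.prems insert.hyps w by simp
    \<comment> \<open>Cross-multiplication with the coefficients of equation \<open>y\<close>
      removes the unknown \<open>w\<close> from the remaining equations without division.\<close>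
    then obtain c where c: "\<exists>x\<in>?S. c x \<noteq> 0"
      "\<forall>z\<in>Z. (\<Sum>x\<in>?S. c x * (f w y * f x z - f x y * f w z)) = 0"
      using insert.IH[of ?S "\<lambda>x z. f w y * f x z - f x y * f w z"] insert.prems(1) by auto
    \<comment> \<open>Scaling the solution by \<open>f w y\<close> makes room for an integral value
      at \<open>w\<close>, chosen so that equation \<open>y\<close> holds as well.\<close>
    define d where "d x = (if x = w then - (\<Sum>x\<in>?S. c x * f x y) else c x * f w y)" for x
    have split: "(\<Sum>x\<in>S. d x * f x z) = d w * f w z + (\<Sum>x\<in>?S. c x * f w y * f x z)" for z
    proof -
      have "(\<Sum>x\<in>S. d x * f x z) = d w * f w z + (\<Sum>x\<in>?S. d x * f x z)"
        using insert.prems w by (simp add: sum.remove)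
      also have "(\<Sum>x\<in>?S. d x * f x z) = (\<Sum>x\<in>?S. c x * f w y * f x z)"
        by (rule sum.cong) (auto simp: d_def)
      finally show ?thesis .
    qed
    have "(\<Sum>x\<in>S. d x * f x z) = (\<Sum>x\<in>?S. c x * (f w y * f x z - f x y * f w z))" for z
      unfolding split by (simp add: d_def algebra_simps sum_distrib_left sum_distrib_right sum_subtractf)
    then have "\<forall>z\<in>insert y Z. (\<Sum>x\<in>S. d x * f x z) = 0" using c(2) by (auto simp: mult.commute)
    moreover obtain x where "x \<in> ?S" "c x \<noteq> 0" using c(1) by blast
    then have "x \<in> S" "d x \<noteq> 0" using w by (auto simp: d_def)
    ultimately show ?thesis by blast
  qed
qed

text \<open>Starting from one vertex of \<open>T\<close>, an edge meeting the vertices reached so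
  far contributes at most \<open>card (E i) - 1\<close> new ones. For a maximal set \<open>J\<close>
  of edges obeying this count, every edge lies inside \<open>U J\<close> or is disjoint from it.
  Separation then puts all of \<open>T\<close> into \<open>U J\<close>.\<close>

lemma connected_hypergraph_card:
  fixes E :: "'i \<Rightarrow> 't set"
  assumes I: "finite I" and E: "\<And>i. i \<in> I \<Longrightarrow> finite (E i)" and "finite T"
    and sep: "\<And>U. (\<And>i. i \<in> I \<Longrightarrow> E i \<subseteq> U \<or> E i \<inter> U = {}) \<Longrightarrow> T \<subseteq> U \<or> T \<inter> U = {}"
  shows "card T \<le> 1 + (\<Sum>i\<in>I. card (E i) - 1)"
proof (cases "T = {}")
  case False
  then obtain x where x: "x \<in> T" by blast
  define U where "U J = insert x (\<Union>i\<in>J. E i)" for J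
  define Q where "Q J \<longleftrightarrow> J \<subseteq> I \<and> card (U J) \<le> 1 + (\<Sum>i\<in>J. card (E i) - 1)" for J
  have "finite {J. Q J}" using I by (auto simp: Q_def intro: finite_subset[of _ "Pow I"])
  moreover have "Q {}" by (simp add: Q_def U_def)
  ultimately obtain J where J: "Q J" "\<And>J'. Q J' \<Longrightarrow> J \<subseteq> J' \<Longrightarrow> J' = J"
    using finite_has_maximal[of "{J. Q J}"] by auto
  have finU: "finite (U J)" and JI: "J \<subseteq> I" "finite J"
    using J(1) I E by (auto simp: Q_def U_def intro: finite_subset)
  have "E i \<subseteq> U J \<or> E i \<inter> U J = {}" if i: "i \<in> I" for i
  proof (cases "i \<in> J")
    case True then show ?thesis by (auto simp: U_def)
  next
    case False
    \<comment> \<open>If the count fails after adding \<open>E i\<close>, then all vertices of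
      \<open>E i\<close> were new.\<close>
    have "\<not> Q (insert i J)" using J(2)[of "insert i J"] False by auto
    then have gt: "card (U (insert i J)) > 1 + (\<Sum>i\<in>insert i J. card (E i) - 1)"
      using JI i by (auto simp: Q_def)
    have "U (insert i J) = U J \<union> E i" by (auto simp: U_def)
    then have "card (U (insert i J)) + card (U J \<inter> E i) = card (U J) + card (E i)"
      using card_Un_Int[OF finU E[OF i]] by simp
    moreover have "card (U J) \<le> 1 + (\<Sum>i\<in>J. card (E i) - 1)" using J(1) by (simp add: Q_def)
    ultimately have "card (U J \<inter> E i) = 0" using gt False JI by simp
    then show ?thesis using finU by auto
  qed
  then have "T \<subseteq> U J" using sep[of "U J"] x by (auto simp: U_def)
  then have "card T \<le> card (U J)" using finU by (rule card_mono[rotated])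
  also have "\<dots> \<le> 1 + (\<Sum>i\<in>J. card (E i) - 1)" using J(1) by (simp add: Q_def)
  also have "\<dots> \<le> 1 + (\<Sum>i\<in>I. card (E i) - 1)" using JI I by (simp add: sum_mono2)
  finally show ?thesis .
qed simp

context plain_comm_group
begin

text \<open>Suitable powers of the elements of an independent set are written in the
  \<open>a z\<close>. With more elements than generators, \<open>integer_kernel_nontrivial\<close>
  combines them so that the exponent of every \<open>a z\<close> cancels, which is a forbidden
  relation.\<close>

lemma rk_restrict_le_card:
  assumes fr: "finite_rank G" and H: "subgroup H G"
    and Z: "finite Z" "a \<in> Z \<rightarrow> carrier G"
    and dep: "\<And>x. x \<in> H \<Longrightarrow> \<exists>m c. m \<noteq> (0::int) \<and> x [^] m = (\<Otimes>z\<in>Z. a z [^] (c z :: int))"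
  shows "rk (G \<restriction>\<restriction> H) \<le> card Z"
proof (rule ccontr)
  assume less: "\<not> ?thesis"
  obtain S where S: "int_independent G S" "S \<subseteq> H" "card S = rk (G \<restriction>\<restriction> H)"
    using rk_restrict_attained[OF fr H] .
  have fin: "finite S" and Sc: "S \<subseteq> carrier G" using S(1) by (auto simp: int_independent_def)
  obtain m f where mf: "\<And>x. x \<in> H \<Longrightarrow> m x \<noteq> (0::int)"
    "\<And>x. x \<in> H \<Longrightarrow> x [^] m x = (\<Otimes>z\<in>Z. a z [^] (f x z :: int))"
    using dep by metis
  obtain c where c: "\<exists>x\<in>S. c x \<noteq> 0" "\<forall>z\<in>Z. (\<Sum>x\<in>S. c x * f x z) = 0"
    using integer_kernel_nontrivial[OF Z(1) fin, of f] less S(3) by auto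
  have zc: "a z [^] (k::int) \<in> carrier G" if "z \<in> Z" for z k using that Z by blast
  \<comment> \<open>The factor \<open>m x\<close> brings \<open>x\<close> into the span of the
    \<open>a z\<close>; the factor \<open>c x\<close> is the one that makes exponents cancel over
    all of \<open>S\<close>.\<close>
  have "(\<Otimes>x\<in>F. x [^] (m x * c x)) = (\<Otimes>z\<in>Z. a z [^] (\<Sum>x\<in>F. c x * f x z))" if "F \<subseteq> S" for F
    using finite_subset[OF that fin] that
  proof (induction F rule: finite_induct)
    case empty then show ?case by simp
  next
    case (insert x F)
    have x: "x \<in> H" "x \<in> carrier G" and F: "F \<subseteq> S" "F \<subseteq> carrier G" using insert S Sc by auto
    have "x [^] (m x * c x) = (x [^] m x) [^] c x" using x by (simp add: int_pow_pow)
    also have "\<dots> = (\<Otimes>z\<in>Z. (a z [^] f x z) [^] c x)"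
      unfolding mf(2)[OF x(1)] using zc by (intro int_pow_finprod) auto
    also have "\<dots> = (\<Otimes>z\<in>Z. a z [^] (c x * f x z))"
      using Z zc by (intro finprod_cong') (auto simp: int_pow_pow mult.commute Pi_iff)
    finally have e: "x [^] (m x * c x) = (\<Otimes>z\<in>Z. a z [^] (c x * f x z))" .
    have "(\<Otimes>x\<in>insert x F. x [^] (m x * c x)) = x [^] (m x * c x) \<otimes> (\<Otimes>x\<in>F. x [^] (m x * c x))"
      using insert x F by (intro finprod_insert) auto
    also have "\<dots> = (\<Otimes>z\<in>Z. a z [^] (c x * f x z)) \<otimes> (\<Otimes>z\<in>Z. a z [^] (\<Sum>x\<in>F. c x * f x z))"
      using e insert.IH F by simp
    also have "\<dots> = (\<Otimes>z\<in>Z. a z [^] (c x * f x z) \<otimes> a z [^] (\<Sum>x\<in>F. c x * f x z))"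
      using zc by (intro finprod_multf[symmetric]) auto
    also have "\<dots> = (\<Otimes>z\<in>Z. a z [^] (\<Sum>x\<in>insert x F. c x * f x z))"
      using Z zc insert.hyps by (intro finprod_cong') (auto simp: int_pow_mult Pi_iff)
    finally show ?case .
  qed
  from this[of S] have "(\<Otimes>x\<in>S. x [^] (m x * c x)) = (\<Otimes>z\<in>Z. a z [^] (\<Sum>x\<in>S. c x * f x z))" by simp
  also have "\<dots> = \<one>" using c(2) by (intro finprod_one_eqI) simp
  finally have "(\<Otimes>x\<in>S. x [^] (m x * c x)) = \<one>" .
  moreover have "\<forall>c :: 'a \<Rightarrow> int. (\<Otimes>x\<in>S. x [^] c x) = \<one> \<longrightarrow> (\<forall>x\<in>S. c x = 0)"
    using S(1) by (simp add: int_independent_def)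
  ultimately have "\<forall>x\<in>S. m x * c x = 0" using spec[of _ "\<lambda>x. m x * c x"] by fastforce
  then show False using c(1) mf(1) S(2) by auto
qed

end

section \<open>Homogeneous completely decomposable groups\<close>

text \<open>An elementwise form of having rank at most one, visibly preserved by homomorphic images.
  In a torsion-free group both exponents are nonzero as soon as \<open>x\<close> and
  \<open>y\<close> are nontrivial.\<close>

definition pairwise_dependent :: "'a monoid \<Rightarrow> 'a set \<Rightarrow> bool" where
  "pairwise_dependent G L \<longleftrightarrow>
     (\<forall>x\<in>L. \<forall>y\<in>L. \<exists>(m::int) (n::int). (m \<noteq> 0 \<or> n \<noteq> 0) \<and> x [^]\<^bsub>G\<^esub> m = y [^]\<^bsub>G\<^esub> n)"

definition cyclic_span :: "'a monoid \<Rightarrow> 'a \<Rightarrow> 'a set" where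
  "cyclic_span G h = range (\<lambda>k::int. h [^]\<^bsub>G\<^esub> k)"

text \<open>Internal direct sums of copies of one group \<open>S\<close>, built up one copy at a
  time so that proofs can induct on the number of summands. In the application \<open>S\<close> is a
  rank-one group representing a critical type.\<close>

inductive homogeneous_sum :: "'a monoid \<Rightarrow> 'a monoid \<Rightarrow> 'a set \<Rightarrow> bool" for G S where
  trivial: "homogeneous_sum G S {\<one>\<^bsub>G\<^esub>}"
| add: "homogeneous_sum G S D \<Longrightarrow> subgroup L G \<Longrightarrow> pairwise_dependent G L \<Longrightarrow> S \<cong> G \<restriction>\<restriction> L \<Longrightarrow>
    D \<inter> L = {\<one>\<^bsub>G\<^esub>} \<Longrightarrow> homogeneous_sum G S (D <#>\<^bsub>G\<^esub> L)"

context plain_comm_group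
begin

text \<open>The composition rule for integer matrices acting on pairs through exponents.\<close>

lemma pow_pair:
  assumes "x \<in> carrier G" "y \<in> carrier G"
  shows "(x [^] (a::int) \<otimes> y [^] (b::int)) [^] (c::int) \<otimes> (x [^] (d::int) \<otimes> y [^] (e::int)) [^] (f::int)
    = x [^] (a * c + d * f) \<otimes> y [^] (b * c + e * f)"
  using assms by (simp add: int_pow_distrib int_pow_pow int_pow_mult m_ac)

lemma set_mult_comm:
  assumes "A \<subseteq> carrier G" "B \<subseteq> carrier G"
  shows "A <#> B = B <#> A"
proof -
  have "U <#> W \<subseteq> W <#> U" if "U \<subseteq> carrier G" "W \<subseteq> carrier G" for U W
  proof
    fix z assume "z \<in> U <#> W"
    then obtain u w where "u \<in> U" "w \<in> W" "z = u \<otimes> w" by (auto simp: set_mult_def)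
    then show "z \<in> W <#> U" using that m_comm[of u w] unfolding set_mult_def by blast
  qed
  then show ?thesis using assms by blast
qed

lemma set_mult_memI: "a \<in> A \<Longrightarrow> b \<in> B \<Longrightarrow> a \<otimes> b \<in> A <#> B"
  by (auto simp: set_mult_def)

lemma set_mult_memE:
  assumes "x \<in> A <#> B" obtains a b where "a \<in> A" "b \<in> B" "x = a \<otimes> b"
  using assms by (auto simp: set_mult_def)

lemma set_mult_unique:
  assumes "subgroup A G" "subgroup B G" "A \<inter> B = {\<one>}" "a \<in> A" "b \<in> B" "a \<otimes> b = \<one>"
  shows "a = \<one>" "b = \<one>"
proof -
  have c: "a \<in> carrier G" "b \<in> carrier G" using subgroup.mem_carrier[OF assms(1,4)] subgroup.mem_carrier[OF assms(2,5)] by auto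
  have "a = inv b" using inv_equality[OF assms(6)] c by simp
  then have "a \<in> A \<inter> B" using assms(4) subgroup.m_inv_closed[OF assms(2,5)] by simp
  then show "a = \<one>" using assms(3) by simp
  then show "b = \<one>" using assms(6) c by simp
qed

text \<open>A relation between \<open>x\<close> and \<open>y\<close> can be divided by the gcd of
  its exponents because \<open>G\<close> is torsion-free. A Bezout identity for the coprime
  exponents then produces a generator of the group spanned by \<open>x\<close> and
  \<open>y\<close>.\<close>

lemma pairwise_dependent_common_root:
  assumes tf: "torsion_free G" and L: "subgroup L G" "pairwise_dependent G L" and xy: "x \<in> L" "y \<in> L"
  obtains c and m n u v :: int where "c \<in> L" "x = c [^] m" "y = c [^] n" "u * m + v * n = 1"
proof -
  have c: "x \<in> carrier G" "y \<in> carrier G" using xy subgroup.mem_carrier[OF L(1)] by auto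
  obtain p q :: int where pq: "p \<noteq> 0 \<or> q \<noteq> 0" "x [^] p = y [^] q"
    using L(2) xy unfolding pairwise_dependent_def by blast
  define g where "g = gcd p q"
  obtain p' q' where p': "p = p' * g" "q = q' * g" unfolding g_def by (metis dvd_def gcd_dvd1 gcd_dvd2 mult.commute)
  have g: "g \<noteq> 0" using pq(1) unfolding g_def by simp
  have "(x [^] p') [^] g = (y [^] q') [^] g" using pq(2) c by (simp add: p' int_pow_pow)
  then have eq: "x [^] p' = y [^] q'" using torsion_free_int_pow_inj[OF tf _ _ _ g] c by simp
  obtain u v where "u * p + v * q = g" unfolding g_def using bezout_int by blast
  then have "g * (u * p' + v * q') = g * 1" by (simp add: p' algebra_simps)
  then have uv: "u * p' + v * q' = 1" using g by simp
  \<comment> \<open>Additively: from \<open>p' x = q' y\<close> and \<open>u p' + v q' = 1\<close>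
    it follows that \<open>v x + u y\<close> times \<open>q'\<close> is \<open>x\<close>, and times
    \<open>p'\<close> is \<open>y\<close>.\<close>
  let ?c = "x [^] v \<otimes> y [^] u"
  have "?c [^] q' = x [^] (v * q') \<otimes> (y [^] q') [^] u"
    using c by (simp add: int_pow_distrib int_pow_pow mult.commute)
  also have "\<dots> = x [^] (u * p' + v * q')"
    using c by (simp add: eq[symmetric] int_pow_pow int_pow_mult[symmetric] algebra_simps)
  finally have 1: "?c [^] q' = x" using uv c by simp
  have "?c [^] p' = (x [^] p') [^] v \<otimes> y [^] (u * p')"
    using c by (simp add: int_pow_distrib int_pow_pow mult.commute)
  also have "\<dots> = y [^] (u * p' + v * q')"
    using c by (simp add: eq int_pow_pow int_pow_mult[symmetric] algebra_simps)
  finally have 2: "?c [^] p' = y" using uv c by simp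
  show thesis
    by (rule that[of ?c q' p' v u])
      (use 1 2 uv subgroup_int_pow_closed[OF L(1)] xy subgroup.m_closed[OF L(1)] in auto)
qed

lemma pairwise_dependent_hom_image:
  assumes L: "subgroup L G" "pairwise_dependent G L" and F: "F \<in> hom (G \<restriction>\<restriction> L) G"
  shows "pairwise_dependent G (F ` L)"
proof -
  interpret L: plain_comm_group "G \<restriction>\<restriction> L" by (rule restrict_plain_comm_group) fact
  have pow: "F (x [^] k) = F x [^] k" if "x \<in> L" for x and k :: int
    using hom_int_pow[OF F _ L.is_group is_group, of x k] int_pow_consistent[OF L(1), of x k] that by auto
  show ?thesis
    unfolding pairwise_dependent_def
  proof (intro ballI)
    fix x y assume "x \<in> F ` L" "y \<in> F ` L"
    then obtain a b where ab: "a \<in> L" "x = F a" "b \<in> L" "y = F b" by auto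
    then obtain m n :: int where "m \<noteq> 0 \<or> n \<noteq> 0" "a [^] m = b [^] n"
      using L(2) unfolding pairwise_dependent_def by blast
    then show "\<exists>(m::int) (n::int). (m \<noteq> 0 \<or> n \<noteq> 0) \<and> x [^] m = y [^] n"
      using ab pow by metis
  qed
qed

lemma injective_hom_image:
  assumes L: "subgroup L G" "pairwise_dependent G L" "S \<cong> G \<restriction>\<restriction> L" and F: "F \<in> hom (G \<restriction>\<restriction> L) G"
    and inj: "\<And>x. x \<in> L \<Longrightarrow> F x = \<one> \<Longrightarrow> x = \<one>"
  shows "subgroup (F ` L) G" "pairwise_dependent G (F ` L)" "S \<cong> G \<restriction>\<restriction> (F ` L)"
proof -
  interpret L: plain_comm_group "G \<restriction>\<restriction> L" by (rule restrict_plain_comm_group) fact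
  interpret F: group_hom "G \<restriction>\<restriction> L" G F by unfold_locales (rule F)
  show "subgroup (F ` L) G" using F.img_is_subgroup by simp
  show "pairwise_dependent G (F ` L)" by (rule pairwise_dependent_hom_image) fact+
  have "inj_on F L" using F.inj_on_one_iff inj by simp
  then have "F \<in> iso (G \<restriction>\<restriction> L) (G \<restriction>\<restriction> (F ` L))"
    using F by (auto simp: iso_def hom_def bij_betw_def)
  then have "G \<restriction>\<restriction> L \<cong> G \<restriction>\<restriction> (F ` L)" by (auto simp: is_iso_def)
  then show "S \<cong> G \<restriction>\<restriction> (F ` L)" using L(3) iso_trans by blast
qed

text \<open>The pair \<open>L\<close>, \<open>M\<close> is the image of \<open>L\<^sub>1\<close>, \<open>L\<^sub>2 \<cong> L\<^sub>1\<close> under a matrix of determinant 1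
  whose first column is given by the exponents of the two components of \<open>a\<close> over a common root.\<close>

lemma rank_one_pair_summand:
  assumes tf: "torsion_free G"
    and L1: "subgroup L1 G" "pairwise_dependent G L1" "S \<cong> G \<restriction>\<restriction> L1"
    and L2: "subgroup L2 G" "S \<cong> G \<restriction>\<restriction> L2" and S: "group S"
    and int: "L1 \<inter> L2 = {\<one>}" and a: "a \<in> L1 <#> L2"
  obtains L M where "subgroup L G" "pairwise_dependent G L" "S \<cong> G \<restriction>\<restriction> L"
    "subgroup M G" "pairwise_dependent G M" "S \<cong> G \<restriction>\<restriction> M"
    "L \<inter> M = {\<one>}" "L <#> M = L1 <#> L2" "a \<in> L"
proof -
  interpret L1: plain_comm_group "G \<restriction>\<restriction> L1" by (rule restrict_plain_comm_group) fact
  interpret L2: plain_comm_group "G \<restriction>\<restriction> L2" by (rule restrict_plain_comm_group) fact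
  have "G \<restriction>\<restriction> L1 \<cong> G \<restriction>\<restriction> L2" using L1(3) L2(2) group.iso_sym[OF S] iso_trans by blast
  then obtain h where h: "h \<in> iso (G \<restriction>\<restriction> L1) (G \<restriction>\<restriction> L2)" by (auto simp: is_iso_def)
  have hL: "h ` L1 = L2" "inj_on h L1" and hh: "h \<in> hom (G \<restriction>\<restriction> L1) (G \<restriction>\<restriction> L2)"
    using h by (auto simp: iso_def bij_betw_def)
  interpret h: group_hom "G \<restriction>\<restriction> L1" "G \<restriction>\<restriction> L2" h by unfold_locales (rule hh)
  have h2: "h x \<in> L2" if "x \<in> L1" for x using hL that by auto
  note c1 [simp] = subgroup.mem_carrier[OF L1(1)] and c2 [simp] = subgroup.mem_carrier[OF L2(1)]
  have hmult: "h (x \<otimes> y) = h x \<otimes> h y" if "x \<in> L1" "y \<in> L1" for x y using hh that by (auto simp: hom_def)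
  have hone: "x = \<one>" if "x \<in> L1" "h x = \<one>" for x using h.inj_on_one_iff hL(2) that by auto
  have hpow: "h (x [^] k) = h x [^] k" if "x \<in> L1" for x and k :: int
    using h.hom_int_pow[of x k] int_pow_consistent[OF L1(1), of x k] int_pow_consistent[OF L2(1), of "h x" k] h2 that
    by auto
  note cl1 = subgroup_int_pow_closed[OF L1(1)] subgroup.m_closed[OF L1(1)]
  note cl2 = subgroup_int_pow_closed[OF L2(1)] subgroup.m_closed[OF L2(1)]
  \<comment> \<open>The second component of \<open>a\<close> is pulled back along \<open>h\<close>,
    so that both components lie in \<open>L1\<close> and have a common root there.\<close>
  obtain a1 b where ab: "a1 \<in> L1" "b \<in> L1" "a = a1 \<otimes> h b"
    using a hL(1) by (metis imageE set_mult_memE)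
  obtain c and m n u v :: int where c: "c \<in> L1" "a1 = c [^] m" "b = c [^] n" "u * m + v * n = 1"
    using pairwise_dependent_common_root[OF tf L1(1,2) ab(1,2)] .
  \<comment> \<open>The columns of the matrix are \<open>(m, n)\<close> for \<open>F\<close> and
    \<open>(- v, u)\<close> for \<open>K\<close>; the Bezout identity in \<open>c\<close> is its
    determinant, and \<open>F c = a\<close>.\<close>
  define F where "F x = x [^] m \<otimes> h x [^] n" for x
  define K where "K x = x [^] (- v) \<otimes> h x [^] u" for x
  have hc: "h x \<in> carrier G" if "x \<in> L1" for x using h2[OF that] by simp
  have Fc: "F x \<in> carrier G" "K x \<in> carrier G" if "x \<in> L1" for x
    using that hc by (auto simp: F_def K_def)
  have Fhom: "F \<in> hom (G \<restriction>\<restriction> L1) G" "K \<in> hom (G \<restriction>\<restriction> L1) G"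
    using hc Fc by (auto intro!: homI simp: F_def K_def hmult int_pow_distrib m_ac)
  have FK: "F s \<otimes> K r = (s [^] m \<otimes> r [^] (- v)) \<otimes> h (s [^] n \<otimes> r [^] u)" if "s \<in> L1" "r \<in> L1" for s r
    using that hc cl1 by (simp add: F_def K_def hmult hpow m_ac)
  have FK1: "s = \<one>" "r = \<one>" if sr: "s \<in> L1" "r \<in> L1" "F s \<otimes> K r = \<one>" for s r
  proof -
    have in1: "s [^] m \<otimes> r [^] (- v) \<in> L1" "s [^] n \<otimes> r [^] u \<in> L1" using sr cl1 by auto
    from set_mult_unique[OF L1(1) L2(1) int in1(1) h2[OF in1(2)]] sr FK
    have 1: "s [^] m \<otimes> r [^] (- v) = \<one>" and "h (s [^] n \<otimes> r [^] u) = \<one>" by auto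
    then have 2: "s [^] n \<otimes> r [^] u = \<one>" using hone[OF in1(2)] by simp
    have "m * u + n * v = 1" "u * m + n * v = 1" using c(4) by (auto simp: algebra_simps)
    \<comment> \<open>The rows \<open>(u, v)\<close> and \<open>(- n, m)\<close> of the inverse
      matrix recover \<open>s\<close> and \<open>r\<close>.\<close>
    then show "s = \<one>" "r = \<one>"
      using pow_pair[of s r m "- v" u n u v] pow_pair[of s r m "- v" "- n" n u m] 1 2 sr
      by (auto simp: algebra_simps)
  qed
  have one1: "\<one> \<in> L1" using subgroup.one_closed[OF L1(1)] .
  have F1: "F \<one> = \<one>" "K \<one> = \<one>" using h.hom_one by (auto simp: F_def K_def)
  have Finj: "x = \<one>" if "x \<in> L1" "F x = \<one>" for x using FK1(1)[OF that(1) one1] F1 that by simp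
  have Kinj: "x = \<one>" if "x \<in> L1" "K x = \<one>" for x using FK1(2)[OF one1 that(1)] F1 that by simp
  note Fi = injective_hom_image[OF L1 Fhom(1) Finj]
  note Ki = injective_hom_image[OF L1 Fhom(2) Kinj]
  have "F ` L1 \<inter> K ` L1 = {\<one>}"
  proof -
    have "z = \<one>" if z: "z \<in> F ` L1" "z \<in> K ` L1" for z
    proof -
      obtain s r where sr: "s \<in> L1" "z = F s" "r \<in> L1" "z = K r" using z by auto
      have Kinv: "K (inv r) = inv (K r)"
        using group_hom.hom_inv[of "G \<restriction>\<restriction> L1" G K r] Fhom(2) sr m_inv_consistent[OF L1(1) sr(3)] L1.is_group is_group
        by (auto simp: group_hom_def group_hom_axioms_def)
      have "F s \<otimes> K (inv r) = z \<otimes> inv z" using sr Kinv by simp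
      also have "\<dots> = \<one>" using Fc sr by simp
      finally have "s = \<one>" using FK1(1)[OF sr(1) subgroup.m_inv_closed[OF L1(1) sr(3)]] by simp
      then show ?thesis using sr F1 by simp
    qed
    then show ?thesis using subgroup.one_closed[OF Fi(1)] subgroup.one_closed[OF Ki(1)] by blast
  qed
  moreover have "F ` L1 <#> K ` L1 = L1 <#> L2"
  proof
    show "F ` L1 <#> K ` L1 \<subseteq> L1 <#> L2"
    proof
      fix z assume "z \<in> F ` L1 <#> K ` L1"
      then obtain s r where sr: "s \<in> L1" "r \<in> L1" "z = F s \<otimes> K r" by (auto elim!: set_mult_memE)
      then show "z \<in> L1 <#> L2" using FK cl1 h2 by (auto intro!: set_mult_memI)
    qed
    show "L1 <#> L2 \<subseteq> F ` L1 <#> K ` L1"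
    proof
      fix z assume "z \<in> L1 <#> L2"
      then obtain x y where xy: "x \<in> L1" "y \<in> L1" "z = x \<otimes> h y" using hL(1) by (metis imageE set_mult_memE)
      \<comment> \<open>The inverse matrix applied to \<open>x\<close> and \<open>y\<close>.\<close>
      let ?s = "x [^] u \<otimes> y [^] v" and ?r = "x [^] (- n) \<otimes> y [^] m"
      have sr: "?s \<in> L1" "?r \<in> L1" using xy cl1 by auto
      have "?s [^] m \<otimes> ?r [^] (- v) = x" "?s [^] n \<otimes> ?r [^] u = y"
        using pow_pair[of x y u v m "- n" m "- v"] pow_pair[of x y u v n "- n" m u] xy c(4)
        by (auto simp: algebra_simps)
      then have "F ?s \<otimes> K ?r = z" using FK[OF sr] xy by simp
      then show "z \<in> F ` L1 <#> K ` L1" using sr by (metis image_eqI set_mult_memI)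
    qed
  qed
  moreover have "a \<in> F ` L1"
    using ab c by (intro image_eqI[of _ _ c]) (auto simp: F_def hpow)
  ultimately show thesis using that[of "F ` L1" "K ` L1"] Fi Ki by blast
qed

lemma set_mult_triple:
  assumes "subgroup A G" "subgroup B G" "subgroup C G" "A \<inter> B = {\<one>}" "(A <#> B) \<inter> C = {\<one>}"
  shows "A \<inter> (B <#> C) = {\<one>}"
proof -
  have "x = \<one>" if x: "x \<in> A" "x \<in> B <#> C" for x
  proof -
    obtain b c where bc: "b \<in> B" "c \<in> C" "x = b \<otimes> c" using x(2) by (rule set_mult_memE)
    note m = subgroup.mem_carrier[OF assms(1) x(1)] subgroup.mem_carrier[OF assms(2) bc(1)] subgroup.mem_carrier[OF assms(3) bc(2)]
    have "x \<otimes> inv b = c" using bc m by (simp add: m_comm[of b c] m_assoc)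
    moreover have "x \<otimes> inv b \<in> A <#> B"
      using x(1) bc(1) by (intro set_mult_memI subgroup.m_inv_closed[OF assms(2)])
    ultimately have "c \<in> (A <#> B) \<inter> C" using bc(2) by simp
    then have "c = \<one>" using assms(5) by simp
    then have "x \<in> A \<inter> B" using bc x(1) m by simp
    then show "x = \<one>" using assms(4) by simp
  qed
  moreover have "\<one> \<in> A" "\<one> \<in> B <#> C"
    using subgroup.one_closed assms set_mult_memI[of \<one> B \<one> C] by auto
  ultimately show ?thesis by blast
qed

lemma set_mult_int_subset:
  assumes "subgroup A G" "subgroup B G" "subgroup A' G" "A' \<subseteq> A" "A \<inter> B = {\<one>}"
  shows "A' \<inter> B = {\<one>}"
  using assms subgroup.one_closed by blast

lemma set_mult_one: "A \<subseteq> carrier G \<Longrightarrow> A <#> {\<one>} = A" "A \<subseteq> carrier G \<Longrightarrow> {\<one>} <#> A = A"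
  by (force simp: set_mult_def)+

lemma homogeneous_sum_subgroup: "homogeneous_sum G S D \<Longrightarrow> subgroup D G"
  by (induction rule: homogeneous_sum.induct) (auto simp: triv_subgroup mult_subgroups)

text \<open>By induction the \<open>D\<close>-part of \<open>a\<close> lies in a summand
  \<open>L1\<close> of \<open>D\<close>, so \<open>a\<close> lies in \<open>L1 <#> L2\<close>. There
  \<open>rank_one_pair_summand\<close> finds a new splitting into \<open>L\<close> and
  \<open>N\<close> with \<open>a\<close> in \<open>L\<close>, and \<open>N\<close> joins the old
  complement \<open>M\<close>.\<close>

lemma homogeneous_sum_rank_one_summand:
  assumes tf: "torsion_free G" and S: "group S"
  shows "homogeneous_sum G S D \<Longrightarrow> a \<in> D \<Longrightarrow> D = {\<one>} \<or>
    (\<exists>L M. subgroup L G \<and> pairwise_dependent G L \<and> S \<cong> G \<restriction>\<restriction> L \<and> homogeneous_sum G S M \<and>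
       M \<inter> L = {\<one>} \<and> M <#> L = D \<and> a \<in> L)"
proof (induction arbitrary: a rule: homogeneous_sum.induct)
  case trivial
  then show ?case by simp
next
  case (add D L2)
  have D: "subgroup D G" using add.hyps(1) by (rule homogeneous_sum_subgroup)
  obtain a' a2 where a: "a' \<in> D" "a2 \<in> L2" "a = a' \<otimes> a2" using add.prems by (rule set_mult_memE)
  consider "D = {\<one>}" | "D \<noteq> {\<one>}" by blast
  then show ?case
  proof cases
    case 1
    then have "D <#> L2 = L2" using set_mult_one subgroup.subset[OF add.hyps(2)] by simp
    then show ?thesis
      using add homogeneous_sum.trivial[of G S] 1 by (intro disjI2 exI[of _ L2] exI[of _ "{\<one>}"]) auto
  next
    case 2
    obtain L1 M where L1: "subgroup L1 G" "pairwise_dependent G L1" "S \<cong> G \<restriction>\<restriction> L1"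
      and M: "homogeneous_sum G S M" "M \<inter> L1 = {\<one>}" "M <#> L1 = D" "a' \<in> L1"
      using add.IH[OF a(1)] 2 by blast
    have Ms: "subgroup M G" using M(1) by (rule homogeneous_sum_subgroup)
    note subs = subgroup.subset[OF L1(1)] subgroup.subset[OF Ms] subgroup.subset[OF add.hyps(2)]
    have "L1 \<subseteq> D"
    proof
      fix x assume "x \<in> L1"
      then have "\<one> \<otimes> x \<in> M <#> L1" using subgroup.one_closed[OF Ms] by (rule set_mult_memI[rotated])
      then show "x \<in> D" using M(3) \<open>x \<in> L1\<close> subs(1) by auto
    qed
    then have int: "L1 \<inter> L2 = {\<one>}" using set_mult_int_subset[OF D add.hyps(2) L1(1)] add.hyps(5) by blast
    have "a \<in> L1 <#> L2" using a M(4) by (auto intro: set_mult_memI)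
    from rank_one_pair_summand[OF tf L1 add.hyps(2,4) S int this]
    obtain L N where L: "subgroup L G" "pairwise_dependent G L" "S \<cong> G \<restriction>\<restriction> L"
      and N: "subgroup N G" "pairwise_dependent G N" "S \<cong> G \<restriction>\<restriction> N"
      and LN: "L \<inter> N = {\<one>}" "L <#> N = L1 <#> L2" "a \<in> L" by blast
    note subs' = subgroup.subset[OF L(1)] subgroup.subset[OF N(1)]
    have NL: "N <#> L = L1 <#> L2" using LN(2) set_mult_comm subs' by simp
    \<comment> \<open>Directness of the triple \<open>M\<close>, \<open>L1\<close>,
      \<open>L2\<close> is now carried over to \<open>M\<close>, \<open>N\<close>, \<open>L\<close>
      by rebracketing.\<close>
    have "M \<inter> (L1 <#> L2) = {\<one>}"
      using set_mult_triple[OF Ms L1(1) add.hyps(2) M(2)] M(3) add.hyps(5) by simp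
    then have MNL: "M \<inter> (N <#> L) = {\<one>}" using NL by simp
    have "N \<subseteq> N <#> L"
    proof
      fix x assume "x \<in> N"
      then have "x \<otimes> \<one> \<in> N <#> L" using subgroup.one_closed[OF L(1)] by (rule set_mult_memI)
      then show "x \<in> N <#> L" using \<open>x \<in> N\<close> subs' by auto
    qed
    then have MN: "M \<inter> N = {\<one>}" using MNL subgroup.one_closed[OF Ms] subgroup.one_closed[OF N(1)] by blast
    have "L \<inter> (N <#> M) = {\<one>}"
    proof (rule set_mult_triple[OF L(1) N(1) Ms LN(1)])
      show "(L <#> N) \<inter> M = {\<one>}" using MNL NL LN(2) by (simp add: Int_commute)
    qed
    then have "(M <#> N) \<inter> L = {\<one>}" using set_mult_comm[OF subs(2) subs'(2)] by (simp add: Int_commute)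
    moreover have "(M <#> N) <#> L = D <#> L2"
      using set_mult_assoc[OF subs(2) subs'(2) subs'(1)] set_mult_assoc[OF subs(2) subs(1) subs(3)] NL M(3) by simp
    moreover have "homogeneous_sum G S (M <#> N)" using homogeneous_sum.add[OF M(1) N MN] .
    ultimately show ?thesis using L LN(3) by blast
  qed
qed

section \<open>Cyclic extensions of homogeneous sums\<close>

lemma power_membership:
  assumes K: "subgroup K G" and g: "g \<in> carrier G" and e: "(e::int) > 0" "g [^] e \<in> K"
  obtains d :: int where "d > 0" "\<And>k::int. g [^] k \<in> K \<longleftrightarrow> d dvd k"
proof -
  define P where "P n \<longleftrightarrow> n > 0 \<and> g [^] (int n) \<in> K" for n
  have "P (nat e)" using e by (simp add: P_def)
  \<comment> \<open>The least positive exponent generates the ideal of all exponents that lead into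
    \<open>K\<close>.\<close>
  define d where "d = (LEAST n. P n)"
  have d: "P d" "\<And>n. P n \<Longrightarrow> d \<le> n" unfolding d_def using \<open>P (nat e)\<close> by (auto intro: LeastI Least_le)
  have dK: "g [^] (int d * j) \<in> K" for j :: int
    using subgroup_int_pow_closed[OF K, of "g [^] int d" j] d(1) g by (simp add: P_def int_pow_pow)
  have "int d dvd k" if k: "g [^] k \<in> K" for k :: int
  proof -
    have "g [^] (k mod int d) = g [^] k \<otimes> inv (g [^] (int d * (k div int d)))"
      using g by (simp add: int_pow_diff[symmetric] minus_mult_div_eq_mod)
    also have "\<dots> \<in> K" using k dK by (intro subgroup.m_closed[OF K] subgroup.m_inv_closed[OF K])
    finally have in_K: "g [^] (k mod int d) \<in> K" .
    have "0 \<le> k mod int d" "k mod int d < int d" using d(1) by (auto simp: P_def)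
    then have "\<not> P (nat (k mod int d))" using d(2)[of "nat (k mod int d)"] by linarith
    then have "k mod int d = 0" using in_K \<open>0 \<le> k mod int d\<close> by (auto simp: P_def)
    then show ?thesis by auto
  qed
  moreover have "g [^] k \<in> K" if "int d dvd k" for k using that dK by (auto simp: dvd_def)
  ultimately show thesis using that[of "int d"] d(1) by (auto simp: P_def)
qed

lemma cyclic_span_subgroup: "h \<in> carrier G \<Longrightarrow> subgroup (cyclic_span G h) G"
  unfolding cyclic_span_def
  by (rule subgroupI) (auto simp: int_pow_mult[symmetric] int_pow_neg[symmetric])

text \<open>With \<open>d\<close> the order of \<open>h\<close> modulo \<open>L\<close>, the map \<open>x \<mapsto> x\<^sup>d\<close> is an isomorphism from the
  extended group onto \<open>L\<close>.\<close>

lemma rank_one_extension: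
  assumes tf: "torsion_free G"
    and L: "subgroup L G" "pairwise_dependent G L" "S \<cong> G \<restriction>\<restriction> L"
    and h: "h \<in> carrier G" "(e::int) > 0" "h [^] e \<in> L"
  defines "L' \<equiv> L <#> cyclic_span G h"
  shows "subgroup L' G" "pairwise_dependent G L'" "S \<cong> G \<restriction>\<restriction> L'"
    "\<exists>d::int. d > 0 \<and> (\<forall>x\<in>L'. x [^] d \<in> L)"
proof -
  have C: "subgroup (cyclic_span G h) G" using h(1) by (rule cyclic_span_subgroup)
  show L': "subgroup L' G" unfolding L'_def by (rule mult_subgroups) fact+
  obtain d where d: "d > 0" "\<And>k::int. h [^] k \<in> L \<longleftrightarrow> d dvd k"
    using power_membership[OF L(1) h] by blast
  have powL: "x [^] d \<in> L" if x: "x \<in> L'" for x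
  proof -
    obtain l k where lk: "l \<in> L" "x = l \<otimes> h [^] (k::int)"
      using x unfolding L'_def cyclic_span_def by (auto elim!: set_mult_memE)
    have "x [^] d = l [^] d \<otimes> h [^] (k * d)"
      using lk h(1) subgroup.mem_carrier[OF L(1)] by (simp add: int_pow_distrib int_pow_pow)
    then show ?thesis
      using lk d(2)[of "k * d"] subgroup_int_pow_closed[OF L(1)] subgroup.m_closed[OF L(1)] by auto
  qed
  then show "\<exists>d::int. d > 0 \<and> (\<forall>x\<in>L'. x [^] d \<in> L)" using d(1) by blast
  note mem [simp] = subgroup.mem_carrier[OF L']
  show dep: "pairwise_dependent G L'"
    unfolding pairwise_dependent_def
  proof (intro ballI)
    fix x y assume xy: "x \<in> L'" "y \<in> L'"
    obtain m n :: int where mn: "m \<noteq> 0 \<or> n \<noteq> 0" "(x [^] d) [^] m = (y [^] d) [^] n"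
      using L(2) powL xy unfolding pairwise_dependent_def by blast
    then have "x [^] (d * m) = y [^] (d * n)" using xy by (simp add: int_pow_pow)
    then show "\<exists>(m::int) (n::int). (m \<noteq> 0 \<or> n \<noteq> 0) \<and> x [^] m = y [^] n"
      using mn(1) d(1) by (intro exI[of _ "d * m"] exI[of _ "d * n"]) auto
  qed
  have LL': "L \<subseteq> L'"
  proof
    fix x assume "x \<in> L"
    then have "x \<otimes> \<one> \<in> L'" unfolding L'_def using subgroup.one_closed[OF C] by (rule set_mult_memI)
    then show "x \<in> L'" using \<open>x \<in> L\<close> subgroup.mem_carrier[OF L(1)] by simp
  qed
  have hL': "h \<in> L'"
  proof -
    have "h [^] (1::int) \<in> cyclic_span G h" unfolding cyclic_span_def by blast
    then have "\<one> \<otimes> h [^] (1::int) \<in> L'" unfolding L'_def by (rule set_mult_memI[OF subgroup.one_closed[OF L(1)]])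
    then show ?thesis using h(1) by simp
  qed
  interpret L': plain_comm_group "G \<restriction>\<restriction> L'" by (rule restrict_plain_comm_group) fact
  have "(\<lambda>x. x [^] d) \<in> iso (G \<restriction>\<restriction> L') (G \<restriction>\<restriction> L)"
  proof -
    have "inj_on (\<lambda>x. x [^] d) L'"
      using torsion_free_int_pow_inj[OF tf _ _ _ ] d(1) by (intro inj_onI) (metis less_irrefl mem)
    moreover have "(\<lambda>x. x [^] d) ` L' = L"
    proof
      show "(\<lambda>x. x [^] d) ` L' \<subseteq> L" using powL by auto
      show "L \<subseteq> (\<lambda>x. x [^] d) ` L'"
      proof
        fix z assume z: "z \<in> L"
        then obtain c and s t u v :: int where c: "c \<in> L'" "z = c [^] s" "h = c [^] t" "u * s + v * t = 1"
          using pairwise_dependent_common_root[OF tf L' dep _ hL'] LL' by blast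
        \<comment> \<open>This power of \<open>h\<close> lies in \<open>L\<close>, so
          \<open>d\<close> divides \<open>s\<close>, and \<open>z = c [^] s\<close> is a
          \<open>d\<close>-th power of an element of \<open>L'\<close>.\<close>
        have "h [^] s = z [^] t" using c by (simp add: int_pow_pow mult.commute)
        then have "h [^] s \<in> L" using z subgroup_int_pow_closed[OF L(1)] by simp
        then obtain j where "s = d * j" using d(2) by (auto simp: dvd_def)
        then have "z = (c [^] j) [^] d" using c by (simp add: int_pow_pow mult.commute)
        then show "z \<in> (\<lambda>x. x [^] d) ` L'" using subgroup_int_pow_closed[OF L' c(1)] by blast
      qed
    qed
    ultimately show ?thesis
      using powL by (auto simp: iso_def bij_betw_def hom_def int_pow_distrib)
  qed
  then have "G \<restriction>\<restriction> L' \<cong> G \<restriction>\<restriction> L" by (auto simp: is_iso_def)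
  then show "S \<cong> G \<restriction>\<restriction> L'" using L(3) L'.iso_sym iso_trans by blast
qed

text \<open>The extension changes a single summand: the one, \<open>L\<close>, that contains
  \<open>h [^] e\<close>. Enlarged by \<open>h\<close> it is still isomorphic to \<open>S\<close>,
  and it still meets the complement \<open>M\<close> trivially because its \<open>d\<close>-th
  powers lie in \<open>L\<close>.\<close>

lemma homogeneous_sum_cyclic_extension:
  assumes tf: "torsion_free G" and S: "group S" and D: "homogeneous_sum G S D"
    and h: "h \<in> carrier G" "(e::int) > 0" "h [^] e \<in> D"
  shows "homogeneous_sum G S (D <#> cyclic_span G h)"
proof (cases "D = {\<one>}")
  case True
  then have "h = \<one>" using h torsion_free_int[OF tf h(1), of e] by auto
  then have "cyclic_span G h = {\<one>}" by (auto simp: cyclic_span_def)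
  then show ?thesis using D True set_mult_one[of "{\<one>}"] by simp
next
  case False
  obtain L M where L: "subgroup L G" "pairwise_dependent G L" "S \<cong> G \<restriction>\<restriction> L"
    and M: "homogeneous_sum G S M" "M \<inter> L = {\<one>}" "M <#> L = D" "h [^] e \<in> L"
    using homogeneous_sum_rank_one_summand[OF tf S D h(3)] False by blast
  have Ms: "subgroup M G" using M(1) by (rule homogeneous_sum_subgroup)
  have C: "subgroup (cyclic_span G h) G" using h(1) by (rule cyclic_span_subgroup)
  let ?L = "L <#> cyclic_span G h"
  note L' = rank_one_extension[OF tf L h(1,2) M(4)]
  obtain d where d: "(d::int) > 0" "\<And>x. x \<in> ?L \<Longrightarrow> x [^] d \<in> L" using L'(4) by blast
  have "M \<inter> ?L = {\<one>}"
  proof -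
    have "x = \<one>" if x: "x \<in> M" "x \<in> ?L" for x
    proof -
      have "x [^] d \<in> M \<inter> L" using x d(2) subgroup_int_pow_closed[OF Ms] by blast
      then have "x [^] d = \<one>" using M(2) by simp
      then show ?thesis using torsion_free_int[OF tf subgroup.mem_carrier[OF Ms x(1)]] d(1) by auto
    qed
    then show ?thesis using subgroup.one_closed[OF Ms] subgroup.one_closed[OF L'(1)] by blast
  qed
  then have "homogeneous_sum G S (M <#> ?L)" by (rule homogeneous_sum.add[OF M(1) L'(1-3)])
  also have "M <#> ?L = D <#> cyclic_span G h"
    using set_mult_assoc[OF subgroup.subset[OF Ms] subgroup.subset[OF L(1)] subgroup.subset[OF C]] M(3) by simp
  finally show ?thesis .
qed

section \<open>From decompositions into rank-one groups to \<open>homogeneous_sum\<close>\<close>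

lemma rank_one_imp_pairwise_dependent:
  assumes E: "subgroup E G" "rank_one (G \<restriction>\<restriction> E)"
  shows "pairwise_dependent G E"
  unfolding pairwise_dependent_def
proof (intro ballI)
  fix x y assume xy: "x \<in> E" "y \<in> E"
  interpret E: plain_comm_group "G \<restriction>\<restriction> E" by (rule restrict_plain_comm_group) fact
  note c = subgroup.mem_carrier[OF E(1) xy(1)] subgroup.mem_carrier[OF E(1) xy(2)]
  show "\<exists>(m::int) (n::int). (m \<noteq> 0 \<or> n \<noteq> 0) \<and> x [^] m = y [^] n"
  proof (cases "x = y")
    case True then show ?thesis by (intro exI[of _ 1]) auto
  next
    case False
    have "\<not> int_independent (G \<restriction>\<restriction> E) {x, y}"
      using E.card_le_rk[of "{x, y}"] False E(2) by (auto simp: rank_one_def tffr_group_def)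
    then have "\<not> int_independent G {x, y}" using int_independent_restrict[OF E(1)] xy by blast
    then obtain k :: "'a \<Rightarrow> int" where "(\<Otimes>z\<in>{x, y}. z [^] k z) = \<one>" "k x \<noteq> 0 \<or> k y \<noteq> 0"
      using c by (auto simp: int_independent_def)
    then have k: "x [^] k x \<otimes> y [^] k y = \<one>" "k x \<noteq> 0 \<or> k y \<noteq> 0" using c False by auto
    then have "x [^] k x = y [^] (- k y)" using inv_equality[of "x [^] k x" "y [^] k y"] c by (simp add: int_pow_neg)
    then show ?thesis using k(2) by (intro exI[of _ "k x"] exI[of _ "- k y"]) auto
  qed
qed

lemma homogeneous_sum_restrict:
  assumes D: "subgroup D G" and S: "homogeneous_sum (G \<restriction>\<restriction> D) S A"
  shows "homogeneous_sum G S A"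
  using S
proof (induction rule: homogeneous_sum.induct)
  case trivial
  then show ?case using homogeneous_sum.trivial[of G S] by simp
next
  case (add A L)
  have "L \<subseteq> D" using subgroup.subset[OF add.hyps(2)] by simp
  then have "pairwise_dependent G L"
    using add.hyps(3) int_pow_consistent[OF D] unfolding pairwise_dependent_def by (metis subsetD)
  moreover have "A <#>\<^bsub>G \<restriction>\<restriction> D\<^esub> L = A <#> L" by (simp add: set_mult_def)
  ultimately show ?case
    using homogeneous_sum.add[OF add.IH incl_subgroup[OF D add.hyps(2)]] add.hyps by simp
qed

lemma internal_direct_sum_homogeneous_sum:
  assumes B: "internal_direct_sum G {..<m::nat} B"
    and r1: "\<And>i. i < m \<Longrightarrow> rank_one (G \<restriction>\<restriction> B i)" "\<And>i. i < m \<Longrightarrow> S \<cong> G \<restriction>\<restriction> B i"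
  shows "homogeneous_sum G S (carrier G)"
proof -
  obtain p where p: "proj_family G {..<m} B p" using internal_direct_sum_imp_proj_family[OF B] .
  \<comment> \<open>The sum of the first \<open>k\<close> summands, described as the common kernel
    of the remaining projections.\<close>
  define D where "D k = {x \<in> carrier G. \<forall>i. k \<le> i \<and> i < m \<longrightarrow> p i x = \<one>}" for k
  have "homogeneous_sum G S (D k)" if "k \<le> m" for k
    using that
  proof (induction k)
    case 0
    have "x = \<one>" if "x \<in> D 0" for x
    proof -
      have "x \<in> carrier G" "(\<Otimes>i\<in>{..<m}. p i x) = \<one>"
        using that unfolding D_def by (auto intro: finprod_one_eqI)
      then show ?thesis using proj_family_sum[OF p] by simp
    qed
    then have "D 0 = {\<one>}"
      using proj_family_hom[OF p] hom_one_end by (auto simp: D_def)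
    then show ?case using homogeneous_sum.trivial[of G S] by simp
  next
    case (Suc k)
    then have k: "k < m" "k \<in> {..<m}" by auto
    note s = proj_family_subgroup[OF p k(2)] and ph = proj_family_hom[OF p]
    note m = subgroup.mem_carrier[OF s]
    have "D k \<inter> B k = {\<one>}"
      using proj_family_id[OF p k(2)] subgroup.one_closed[OF s] hom_one_end[OF ph] k by (auto simp: D_def)
    with Suc k have "homogeneous_sum G S (D k <#> B k)"
      using homogeneous_sum.add[of G S "D k" "B k"] s rank_one_imp_pairwise_dependent[OF s] r1 by auto
    also have "D k <#> B k = D (Suc k)"
    proof
      show "D k <#> B k \<subseteq> D (Suc k)"
      proof
        fix z assume "z \<in> D k <#> B k"
        then obtain x y where xy: "x \<in> D k" "y \<in> B k" "z = x \<otimes> y" by (rule set_mult_memE)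
        have "p i z = \<one>" if "Suc k \<le> i" "i < m" for i
          using ph[of i] xy that proj_family_other[OF p, of i k y] m k by (auto simp: hom_def D_def)
        then show "z \<in> D (Suc k)" using xy m by (auto simp: D_def)
      qed
      show "D (Suc k) \<subseteq> D k <#> B k"
      proof
        fix z assume z: "z \<in> D (Suc k)"
        then have zc: "z \<in> carrier G" by (simp add: D_def)
        have pz: "p k z \<in> B k" using proj_family_in[OF p k(2) zc] .
        let ?x = "z \<otimes> inv (p k z)"
        have inv: "inv (p k z) \<in> B k" using subgroup.m_inv_closed[OF s pz] .
        have "p i ?x = \<one>" if i: "k \<le> i" "i < m" for i
        proof -
          have *: "p i ?x = p i z \<otimes> p i (inv (p k z))" using ph[of i] i zc m[OF inv] by (auto simp: hom_def)
          show ?thesis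
          proof (cases "i = k")
            case True then show ?thesis using * proj_family_id[OF p k(2) inv] m[OF pz] by simp
          next
            case False
            then have "p i z = \<one>" using z i by (auto simp: D_def)
            then show ?thesis using * proj_family_other[OF p _ k(2) False inv] i by simp
          qed
        qed
        then have "?x \<in> D k" using zc m[OF pz] by (auto simp: D_def)
        moreover have "z = ?x \<otimes> p k z" using zc m[OF pz] by (simp add: m_assoc)
        ultimately show "z \<in> D k <#> B k" using pz by (metis set_mult_memI)
      qed
    qed
    finally show ?case .
  qed
  moreover have "D m = carrier G" by (auto simp: D_def)
  ultimately show ?thesis by (metis order_refl)
qed

end

section \<open>Critical types of summands\<close>

text \<open>The regulator enters only through the maps \<open>q \<rho>\<close>. Up to the factor
  \<open>e\<close> they are orthogonal idempotents with sum 1, and they are central in the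
  endomorphism ring of \<open>G\<close>.\<close>

locale critical_projections = plain_comm_group +
  fixes T :: "'t set" and e :: int and q :: "'t \<Rightarrow> 'a \<Rightarrow> 'a"
  assumes torsion_free: "torsion_free G" and finite_rank: "finite_rank G"
    and finite_T: "finite T" and e_pos: "e > 0"
    and q_hom: "\<rho> \<in> T \<Longrightarrow> q \<rho> \<in> hom G G"
    and q_sum: "x \<in> carrier G \<Longrightarrow> (\<Otimes>\<rho>\<in>T. q \<rho> x) = x [^] e"
    and q_q: "\<rho> \<in> T \<Longrightarrow> \<sigma> \<in> T \<Longrightarrow> \<rho> \<noteq> \<sigma> \<Longrightarrow> x \<in> carrier G \<Longrightarrow> q \<sigma> (q \<rho> x) = \<one>"
    and q_commute: "f \<in> hom G G \<Longrightarrow> \<rho> \<in> T \<Longrightarrow> x \<in> carrier G \<Longrightarrow> f (q \<rho> x) = q \<rho> (f x)"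
begin

text \<open>In the intended instance this is the purification in \<open>G\<close> of the homogeneous
  component of type \<open>\<rho>\<close> of the regulator.\<close>

definition component :: "'t \<Rightarrow> 'a set" where
  "component \<rho> = {x \<in> carrier G. \<forall>\<sigma>\<in>T. \<sigma> \<noteq> \<rho> \<longrightarrow> q \<sigma> x = \<one>}"

definition typeset :: "'a set \<Rightarrow> 't set" where
  "typeset A = {\<rho> \<in> T. \<exists>x\<in>A. q \<rho> x \<noteq> \<one>}"

lemma q_closed: "\<rho> \<in> T \<Longrightarrow> x \<in> carrier G \<Longrightarrow> q \<rho> x \<in> carrier G"
  using q_hom hom_in_carrier by metis

lemma q_mult: "\<rho> \<in> T \<Longrightarrow> x \<in> carrier G \<Longrightarrow> y \<in> carrier G \<Longrightarrow> q \<rho> (x \<otimes> y) = q \<rho> x \<otimes> q \<rho> y"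
  using q_hom[of \<rho>] by (simp add: hom_def)

lemma q_pow: "\<rho> \<in> T \<Longrightarrow> x \<in> carrier G \<Longrightarrow> q \<rho> (x [^] (n::int)) = q \<rho> x [^] n"
  using hom_pow[OF q_hom] .

lemma q_one: "\<rho> \<in> T \<Longrightarrow> q \<rho> \<one> = \<one>"
  using hom_one_end[OF q_hom] .

lemma q_inv: "\<rho> \<in> T \<Longrightarrow> x \<in> carrier G \<Longrightarrow> q \<rho> (inv x) = inv (q \<rho> x)"
  using group_hom.hom_inv[of G G "q \<rho>" x] q_hom is_group by (simp add: group_hom_def group_hom_axioms_def)

lemma q_finprod: "\<rho> \<in> T \<Longrightarrow> f \<in> A \<rightarrow> carrier G \<Longrightarrow> q \<rho> (\<Otimes>i\<in>A. f i) = (\<Otimes>i\<in>A. q \<rho> (f i))"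
  using hom_finprod[OF _ _ q_hom] comm_group_axioms by auto

lemma q_component: "\<rho> \<in> T \<Longrightarrow> x \<in> component \<rho> \<Longrightarrow> q \<rho> x = x [^] e"
  using q_sum[of x] finprod_single[of T \<rho> "\<lambda>\<rho>. q \<rho> x"] finite_T q_closed by (auto simp: component_def)

lemma component_carrier: "x \<in> component \<rho> \<Longrightarrow> x \<in> carrier G"
  by (simp add: component_def)

lemma component_other: "x \<in> component \<rho> \<Longrightarrow> \<sigma> \<in> T \<Longrightarrow> \<sigma> \<noteq> \<rho> \<Longrightarrow> q \<sigma> x = \<one>"
  by (simp add: component_def)

lemma q_in_component: "\<rho> \<in> T \<Longrightarrow> x \<in> carrier G \<Longrightarrow> q \<rho> x \<in> component \<rho>"
  using q_closed q_q by (auto simp: component_def)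

lemma hom_component:
  assumes "f \<in> hom G G" "x \<in> component \<rho>"
  shows "f x \<in> component \<rho>"
  using assms q_commute[OF assms(1), of _ x, symmetric] hom_one_end[OF assms(1)] hom_in_carrier[OF assms(1)]
  by (auto simp: component_def)

text \<open>The product of all \<open>q \<rho> x\<close> is \<open>x [^] e\<close>, and
  \<open>G\<close> is torsion-free.\<close>

lemma q_faithful:
  assumes "x \<in> carrier G" "\<And>\<rho>. \<rho> \<in> T \<Longrightarrow> q \<rho> x = \<one>"
  shows "x = \<one>"
proof -
  have "x [^] e = \<one>" using q_sum[OF assms(1)] assms(2) finprod_one_eqI[of T] by metis
  then show ?thesis using torsion_free_int[OF torsion_free assms(1)] e_pos by auto
qed

lemma q_joint_inj:
  assumes "x \<in> carrier G" "y \<in> carrier G" "\<And>\<rho>. \<rho> \<in> T \<Longrightarrow> q \<rho> x = q \<rho> y"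
  shows "x = y"
proof -
  have "x \<otimes> inv y = \<one>"
  proof (rule q_faithful)
    fix \<rho> assume \<rho>: "\<rho> \<in> T"
    have "q \<rho> (x \<otimes> inv y) = q \<rho> x \<otimes> inv (q \<rho> y)"
      using q_mult[OF \<rho>, of x "inv y"] q_inv[OF \<rho>, of y] assms(1,2) by simp
    then show "q \<rho> (x \<otimes> inv y) = \<one>" using assms(3)[OF \<rho>] q_closed[OF \<rho> assms(2)] by simp
  qed (use assms(1,2) in simp)
  then show ?thesis using assms(1,2) by (rule mult_inv_eq_one_imp_eq)
qed

text \<open>A common source for the components and for the pieces into which a summand is split
  below; with trivial \<open>K \<rho>\<close> it gives intersections of kernels.\<close>

lemma q_preimage_subgroup:
  assumes B: "subgroup B G" and P: "P \<subseteq> T" and K: "\<And>\<rho>. \<rho> \<in> P \<Longrightarrow> subgroup (K \<rho>) G"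
  shows "subgroup {x \<in> B. \<forall>\<rho>\<in>P. q \<rho> x \<in> K \<rho>} G"
proof (rule subgroupI)
  note [simp] = subgroup.mem_carrier[OF B]
  show "{x \<in> B. \<forall>\<rho>\<in>P. q \<rho> x \<in> K \<rho>} \<subseteq> carrier G" by auto
  have "\<one> \<in> {x \<in> B. \<forall>\<rho>\<in>P. q \<rho> x \<in> K \<rho>}"
    using subgroup.one_closed[OF B] subgroup.one_closed[OF K] q_one P by auto
  then show "{x \<in> B. \<forall>\<rho>\<in>P. q \<rho> x \<in> K \<rho>} \<noteq> {}" by blast
  fix x assume x: "x \<in> {x \<in> B. \<forall>\<rho>\<in>P. q \<rho> x \<in> K \<rho>}"
  show "inv x \<in> {x \<in> B. \<forall>\<rho>\<in>P. q \<rho> x \<in> K \<rho>}"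
    using x P q_inv subgroup.m_inv_closed[OF B] subgroup.m_inv_closed[OF K] by (auto simp: subset_iff)
  fix y assume y: "y \<in> {x \<in> B. \<forall>\<rho>\<in>P. q \<rho> x \<in> K \<rho>}"
  show "x \<otimes> y \<in> {x \<in> B. \<forall>\<rho>\<in>P. q \<rho> x \<in> K \<rho>}"
    using x y P q_mult subgroup.m_closed[OF B] subgroup.m_closed[OF K] by (auto simp: subset_iff)
qed

text \<open>Nontrivial elements of \<open>B\<close> taken from different components are independent,
  and each type in \<open>typeset B\<close> supplies one.\<close>

lemma card_typeset_le_rk:
  assumes B: "subgroup B G" and qB: "\<And>\<rho> x. \<rho> \<in> T \<Longrightarrow> x \<in> B \<Longrightarrow> q \<rho> x \<in> B"
  shows "card (typeset B) \<le> rk (G \<restriction>\<restriction> B)"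
proof -
  have "\<exists>x. x \<in> B \<and> q \<rho> x \<noteq> \<one>" if "\<rho> \<in> typeset B" for \<rho> using that by (auto simp: typeset_def)
  then obtain w where w: "\<And>\<rho>. \<rho> \<in> typeset B \<Longrightarrow> w \<rho> \<in> B \<and> q \<rho> (w \<rho>) \<noteq> \<one>" by metis
  define y where "y \<rho> = q \<rho> (w \<rho>)" for \<rho>
  have TT: "\<rho> \<in> T" if "\<rho> \<in> typeset B" for \<rho> using that by (simp add: typeset_def)
  have y: "y \<rho> \<in> B" "y \<rho> \<noteq> \<one>" "y \<rho> \<in> component \<rho>" "y \<rho> \<in> carrier G" if "\<rho> \<in> typeset B" for \<rho>
    using w[OF that] qB TT[OF that] q_in_component subgroup.mem_carrier[OF B] by (auto simp: y_def)
  have qy: "q \<rho> (y \<rho>) \<noteq> \<one>" if "\<rho> \<in> typeset B" for \<rho>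
    using q_component[OF TT y(3)] torsion_free_int[OF torsion_free y(4)] y(2) that e_pos by auto
  have inj: "inj_on y (typeset B)"
    using qy component_other[OF y(3)] TT by (intro inj_onI) metis
  have fin: "finite (typeset B)" using finite_T by (simp add: typeset_def)
  have "int_independent G (y ` typeset B)"
    unfolding int_independent_def
  proof (intro conjI allI impI ballI)
    show "finite (y ` typeset B)" "y ` typeset B \<subseteq> carrier G" using fin y by auto
    fix c :: "'a \<Rightarrow> int" and z
    assume eq: "(\<Otimes>x\<in>y ` typeset B. x [^] c x) = \<one>" and z: "z \<in> y ` typeset B"
    then obtain \<rho> where \<rho>: "\<rho> \<in> typeset B" "z = y \<rho>" by auto
    \<comment> \<open>Applying \<open>q \<rho>\<close> to the relation leaves only the term of the
      element from the component of \<open>\<rho>\<close>.\<close>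
    have "\<one> = q \<rho> (\<Otimes>x\<in>y ` typeset B. x [^] c x)" using eq q_one TT \<rho> by simp
    also have "\<dots> = (\<Otimes>x\<in>y ` typeset B. q \<rho> (x [^] c x))"
      using TT \<rho> y by (intro q_finprod) auto
    also have "\<dots> = q \<rho> (z [^] c z)"
    proof (rule finprod_single)
      show "(\<lambda>x. q \<rho> (x [^] c x)) \<in> y ` typeset B \<rightarrow> carrier G" using q_closed TT \<rho> y by auto
      fix x assume x: "x \<in> y ` typeset B" "x \<noteq> z"
      then obtain \<sigma> where \<sigma>: "\<sigma> \<in> typeset B" "x = y \<sigma>" by auto
      then have "q \<rho> x = \<one>" using component_other[OF y(3)[OF \<sigma>(1)] TT[OF \<rho>(1)]] x \<rho> by auto
      then show "q \<rho> (x [^] c x) = \<one>" using q_pow[OF TT[OF \<rho>(1)] y(4)[OF \<sigma>(1)]] \<sigma> by simp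
    qed (use fin z in auto)
    also have "\<dots> = (q \<rho> z) [^] c z" using q_pow TT \<rho> y by simp
    finally show "c z = 0"
      using torsion_free_int[OF torsion_free, of "q \<rho> z" "c z"] qy \<rho> q_closed TT y by metis
  qed
  then have "card (y ` typeset B) \<le> rk (G \<restriction>\<restriction> B)"
    using y by (intro card_le_rk_restrict[OF finite_rank B]) auto
  then show ?thesis using card_image[OF inj] by simp
qed

text \<open>The projection \<open>c\<close> of \<open>G\<close> onto the sum of those
  \<open>A i\<close> with types in \<open>U\<close> acts as the projection onto the
  \<open>U\<close>-part. It maps \<open>B\<close> into itself, hence splits \<open>B\<close> into a
  part with types in \<open>U\<close> and a part with types outside; one of them is trivial.\<close>

lemma indecomposable_typeset_separation:
  assumes p: "proj_family G I A p"
    and U: "\<And>i. i \<in> I \<Longrightarrow> typeset (A i) \<subseteq> U \<or> typeset (A i) \<inter> U = {}"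
    and B: "subgroup B G" "indecomposable (G \<restriction>\<restriction> B)"
    and f: "f \<in> hom G G" "\<And>x. x \<in> carrier G \<Longrightarrow> f x \<in> B" "\<And>x. x \<in> B \<Longrightarrow> f x = x"
  shows "typeset B \<subseteq> U \<or> typeset B \<inter> U = {}"
proof -
  note [simp] = subgroup.mem_carrier[OF B(1)]
  define J where "J = {i \<in> I. typeset (A i) \<subseteq> U}"
  define c where "c x = (\<Otimes>i\<in>J. p i x)" for x
  have JI: "J \<subseteq> I" "finite I" using proj_family_finite[OF p] by (auto simp: J_def)
  have pc: "p i x \<in> carrier G" if "i \<in> I" "x \<in> carrier G" for i x using proj_family_closed[OF p that] .
  have cc: "c x \<in> carrier G" if "x \<in> carrier G" for x
    unfolding c_def using pc that JI by (intro finprod_closed) auto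
  have qp: "q \<rho> (p i x) = \<one>" if "i \<in> I" "x \<in> carrier G" "\<rho> \<in> T" "\<rho> \<notin> typeset (A i)" for i x \<rho>
    using proj_family_in[OF p that(1,2)] that by (auto simp: typeset_def)
  have qc: "q \<rho> (c x) = (if \<rho> \<in> U then q \<rho> x else \<one>)" if x: "x \<in> carrier G" and \<rho>: "\<rho> \<in> T" for x \<rho>
  proof -
    have e1: "q \<rho> (c x) = (\<Otimes>i\<in>J. q \<rho> (p i x))"
      unfolding c_def using pc x JI \<rho> by (intro q_finprod) auto
    show ?thesis
    proof (cases "\<rho> \<in> U")
      case True
      have "(\<Otimes>i\<in>J. q \<rho> (p i x)) = (\<Otimes>i\<in>I. q \<rho> (p i x))"
      proof (rule finprod_mono_neutral_cong_left)
        show "q \<rho> (p i x) = \<one>" if "i \<in> I - J" for i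
          using that U[of i] True x \<rho> by (intro qp) (auto simp: J_def)
      qed (use JI pc q_closed x \<rho> in auto)
      also have "\<dots> = q \<rho> (\<Otimes>i\<in>I. p i x)" using pc x \<rho> by (intro q_finprod[symmetric]) auto
      also have "\<dots> = q \<rho> x" using proj_family_sum[OF p x] by simp
      finally show ?thesis using e1 True by simp
    next
      case False
      then have "(\<Otimes>i\<in>J. q \<rho> (p i x)) = \<one>"
        using x \<rho> by (intro finprod_one_eqI qp) (auto simp: J_def)
      then show ?thesis using e1 False by simp
    qed
  qed
  \<comment> \<open>Since \<open>f\<close> commutes with every \<open>q \<rho>\<close>, the elements
    \<open>f (c x)\<close> and \<open>c x\<close> have the same image under all of them.\<close>
  have cB: "c x \<in> B" if x: "x \<in> B" for x
  proof -
    have "f (c x) = c x"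
    proof (rule q_joint_inj)
      fix \<rho> assume \<rho>: "\<rho> \<in> T"
      have "q \<rho> (f (c x)) = f (q \<rho> (c x))" using q_commute[OF f(1) \<rho>] cc x by simp
      also have "\<dots> = q \<rho> (c x)" using qc[of x \<rho>] q_commute[OF f(1) \<rho>, of x] f(3) hom_one_end[OF f(1)] x \<rho> by auto
      finally show "q \<rho> (f (c x)) = q \<rho> (c x)" .
    qed (use cc x hom_in_carrier[OF f(1)] in auto)
    then show ?thesis using f(2)[of "c x"] cc[of x] x by simp
  qed
  define B1 where "B1 = {x \<in> B. \<forall>\<rho>\<in>T - U. q \<rho> x \<in> {\<one>}}"
  define B2 where "B2 = {x \<in> B. \<forall>\<rho>\<in>T \<inter> U. q \<rho> x \<in> {\<one>}}"
  have sub: "B1 \<subseteq> B" "B2 \<subseteq> B" by (auto simp: B1_def B2_def)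
  have s: "subgroup B1 G" "subgroup B2 G"
    unfolding B1_def B2_def by (intro q_preimage_subgroup B(1) triv_subgroup; auto)+
  have c1: "c x \<in> B1" if "x \<in> B" for x using cB qc that by (auto simp: B1_def)
  have c2: "inv (c x) \<otimes> x \<in> B2" if x: "x \<in> B" for x
  proof -
    have "q \<rho> (inv (c x) \<otimes> x) = \<one>" if \<rho>: "\<rho> \<in> T" "\<rho> \<in> U" for \<rho>
      using q_mult[of \<rho> "inv (c x)" x] q_inv[of \<rho> "c x"] qc[of x \<rho>] \<rho> x cc[of x] q_closed[of \<rho> x] by simp
    then show ?thesis
      using subgroup.m_closed[OF B(1) subgroup.m_inv_closed[OF B(1) cB[OF x]] x] by (auto simp: B2_def)
  qed
  have cx: "x = c x \<otimes> (inv (c x) \<otimes> x)" if "x \<in> B" for x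
    using cc[of x] that by (simp add: m_assoc[symmetric])
  have "direct_sum2 (G \<restriction>\<restriction> B) B1 B2"
    unfolding direct_sum2_def
  proof (intro conjI)
    show "subgroup B1 (G \<restriction>\<restriction> B)" "subgroup B2 (G \<restriction>\<restriction> B)"
      by (intro subgroup_incl s B(1) sub)+
    have "x = \<one>" if "x \<in> B1" "x \<in> B2" for x
      by (rule q_faithful) (use that in \<open>auto simp: B1_def B2_def\<close>)
    then have "B1 \<inter> B2 = {\<one>}" using subgroup.one_closed[OF s(1)] subgroup.one_closed[OF s(2)] by blast
    then show "B1 \<inter> B2 = {\<one>\<^bsub>G \<restriction>\<restriction> B\<^esub>}" by simp
    have "B1 <#> B2 = B"
    proof
      show "B1 <#> B2 \<subseteq> B" using sub subgroup.m_closed[OF B(1)] by (auto simp: set_mult_def)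
      show "B \<subseteq> B1 <#> B2" using cx c1 c2 set_mult_memI by (metis subsetI)
    qed
    then show "B1 <#>\<^bsub>G \<restriction>\<restriction> B\<^esub> B2 = carrier (G \<restriction>\<restriction> B)"
      by (simp add: set_mult_def)
  qed
  then have "B1 = {\<one>\<^bsub>G \<restriction>\<restriction> B\<^esub>} \<or> B2 = {\<one>\<^bsub>G \<restriction>\<restriction> B\<^esub>}"
    using B(2) unfolding indecomposable_def by blast
  then consider "B1 = {\<one>}" | "B2 = {\<one>}" by auto
  then show ?thesis
  proof cases
    case 1
    have "q \<rho> x = \<one>" if x: "x \<in> B" and \<rho>: "\<rho> \<in> T" "\<rho> \<in> U" for x \<rho>
    proof -
      have "c x = \<one>" using 1 c1[OF x] by blast
      then show ?thesis using qc[of x \<rho>] \<rho> x q_one by simp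
    qed
    then show ?thesis by (auto simp: typeset_def)
  next
    case 2
    have "q \<rho> x = \<one>" if x: "x \<in> B" and \<rho>: "\<rho> \<in> T" "\<rho> \<notin> U" for x \<rho>
    proof -
      have "inv (c x) \<otimes> x = \<one>" using 2 c2[OF x] by blast
      then have "x = c x" using cx[OF x] cc[of x] x by simp
      then show ?thesis using qc[of x \<rho>] x \<rho> by simp
    qed
    then show ?thesis by (auto simp: typeset_def)
  qed
qed

end

text \<open>\<open>generates\<close> is what remains of the cyclic quotient by the regulator, and
  \<open>component_summand\<close> is the special case of Baer's theorem for one element of a
  component.\<close>

locale cyclic_critical_projections = critical_projections G T e q
  for G :: "'a monoid" (structure) and T :: "'t set" and e q +
  fixes g :: 'a
  assumes g_closed: "g \<in> carrier G"
    and generates: "x \<in> carrier G \<Longrightarrow>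
      \<exists>(k::int) r. (\<forall>\<rho>\<in>T. r \<rho> \<in> component \<rho>) \<and> x = g [^] k \<otimes> (\<Otimes>\<rho>\<in>T. r \<rho>)"
    and component_summand: "\<rho> \<in> T \<Longrightarrow> a \<in> component \<rho> \<Longrightarrow> a \<noteq> \<one> \<Longrightarrow>
      \<exists>L M. subgroup L G \<and> subgroup M G \<and> pairwise_dependent G L \<and> L \<inter> M = {\<one>} \<and>
        L <#> M = component \<rho> \<and> a \<in> L"
begin

text \<open>The data for splitting \<open>B\<close> at one type: \<open>L\<close> is a part of
  \<open>B\<close> of rank at most one that catches \<open>q \<rho> b\<close>, with \<open>a\<close>
  generating it up to powers. Its partner \<open>M\<close> is taken in the component of
  \<open>G\<close>, not of \<open>B\<close>. Outside \<open>typeset B\<close> all of it may be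
  trivial.\<close>

definition adapted_splitting :: "'a set \<Rightarrow> 'a \<Rightarrow> 't \<Rightarrow> 'a set \<Rightarrow> 'a set \<Rightarrow> 'a \<Rightarrow> bool" where
  "adapted_splitting B b \<rho> L M a \<longleftrightarrow> subgroup L G \<and> subgroup M G \<and> L \<inter> M = {\<one>} \<and> L \<subseteq> B \<and> L \<subseteq> component \<rho> \<and>
    M \<subseteq> component \<rho> \<and> a \<in> L \<and> (\<forall>x\<in>L. \<exists>(m::int) (n::int). m \<noteq> 0 \<and> x [^] m = a [^] n) \<and> q \<rho> b \<in> L \<and>
    (\<forall>x\<in>B \<inter> component \<rho>. \<exists>l\<in>L. \<exists>y\<in>M. x = l \<otimes> y) \<and> (\<rho> \<in> typeset B \<longrightarrow> L \<noteq> {\<one>})"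

lemma component_splitting:
  assumes B: "subgroup B G"
    and f: "f \<in> hom G G" "\<And>x. x \<in> carrier G \<Longrightarrow> f x \<in> B" "\<And>x. x \<in> B \<Longrightarrow> f x = x"
    and b: "b \<in> B" and \<rho>: "\<rho> \<in> T"
  shows "\<exists>L M a. adapted_splitting B b \<rho> L M a"
proof (cases "\<rho> \<in> typeset B")
  case False
  have qB: "q \<rho> x = \<one>" if "x \<in> B" for x using False that \<rho> by (auto simp: typeset_def)
  have "x = \<one>" if x: "x \<in> B \<inter> component \<rho>" for x
  proof -
    have "x [^] e = \<one>" using q_component[OF \<rho>, of x] qB x by simp
    then show ?thesis using torsion_free_int[OF torsion_free, of x e] x component_carrier e_pos by auto
  qed
  then have dec: "\<forall>x\<in>B \<inter> component \<rho>. \<exists>l\<in>{\<one>}. \<exists>y\<in>{\<one>}. x = l \<otimes> y"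
    by (metis l_one one_closed singletonI)
  have one: "{\<one>} \<subseteq> component \<rho>" using q_one by (auto simp: component_def)
  have dep: "\<forall>x\<in>{\<one>}. \<exists>(m::int) (n::int). m \<noteq> 0 \<and> x [^] m = \<one> [^] n"
    by (intro ballI exI[of _ 1]) simp
  show ?thesis
  proof (rule exI[of _ "{\<one>}"], rule exI[of _ "{\<one>}"], rule exI[of _ \<one>], unfold adapted_splitting_def, intro conjI impI)
    show "subgroup {\<one>} G" "subgroup {\<one>} G" by (rule triv_subgroup)+
    show "{\<one>} \<subseteq> B" using subgroup.one_closed[OF B] by simp
    show "q \<rho> b \<in> {\<one>}" using qB[OF b] by simp
    show "{\<one>} \<noteq> {\<one>}" if "\<rho> \<in> typeset B" using that False by simp
  qed (rule Int_absorb one dep dec singletonI)+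
next
  case True
  note [simp] = subgroup.mem_carrier[OF B]
  have qB: "q \<rho> x \<in> B" if "x \<in> B" for x
    using q_commute[OF f(1) \<rho>, of x] f(2)[of "q \<rho> x"] f(3)[OF that] q_closed[OF \<rho>] that by simp
  obtain x0 where x0: "x0 \<in> B" "q \<rho> x0 \<noteq> \<one>" using True by (auto simp: typeset_def)
  \<comment> \<open>If \<open>q \<rho> b\<close> is trivial, another nontrivial element of the image
    of \<open>B\<close> takes its place, so that \<open>L\<close> is nontrivial for every type of
    \<open>B\<close>.\<close>
  define a where "a = (if q \<rho> b \<noteq> \<one> then q \<rho> b else q \<rho> x0)"
  have a: "a \<in> B" "a \<in> component \<rho>" "a \<noteq> \<one>" and ba: "q \<rho> b = \<one> \<or> q \<rho> b = a"
    using qB b x0 q_in_component[OF \<rho>] by (auto simp: a_def)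
  obtain L M where LM: "subgroup L G" "subgroup M G" "pairwise_dependent G L" "L \<inter> M = {\<one>}"
    "L <#> M = component \<rho>" "a \<in> L"
    using component_summand[OF \<rho> a(2,3)] by blast
  note [simp] = subgroup.mem_carrier[OF LM(1)] subgroup.mem_carrier[OF LM(2)]
  have dep: "\<exists>(m::int) (n::int). m \<noteq> 0 \<and> x [^] m = a [^] n" if "x \<in> L" for x
  proof -
    obtain m n :: int where mn: "m \<noteq> 0 \<or> n \<noteq> 0" "x [^] m = a [^] n"
      using bspec[OF bspec[OF LM(3)[unfolded pairwise_dependent_def] \<open>x \<in> L\<close>] LM(6)] by (elim exE conjE)
    have "m \<noteq> 0"
    proof
      assume m: "m = 0"
      then have "a [^] n = \<one>" using mn(2) int_pow_0[of G x] by metis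
      moreover have "n \<noteq> 0" using mn(1) m by simp
      ultimately show False using torsion_free_int[OF torsion_free component_carrier[OF a(2)]] a(3) by metis
    qed
    then show ?thesis using mn(2) by metis
  qed
  \<comment> \<open>A nonzero power of each element of \<open>L\<close> is a power of
    \<open>a\<close> and hence fixed by \<open>f\<close>; torsion-freeness makes \<open>f\<close>
    fix the element itself.\<close>
  have "L \<subseteq> B"
  proof
    fix x assume x: "x \<in> L"
    obtain m n :: int where mn: "m \<noteq> 0" "x [^] m = a [^] n" using dep[OF x] by blast
    have "f x [^] m = f (x [^] m)" using hom_pow[OF f(1), of x m] x by simp
    also have "\<dots> = x [^] m" using mn f(3)[of "a [^] n"] subgroup_int_pow_closed[OF B a(1)] by simp
    finally have "f x = x"
      using torsion_free_int_pow_inj[OF torsion_free _ _ _ mn(1), of "f x" x] x hom_in_carrier[OF f(1)] by simp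
    then show "x \<in> B" using f(2)[of x] x by simp
  qed
  moreover have "L \<subseteq> component \<rho>"
    using LM(5) set_mult_memI[of _ L \<one> M] subgroup.one_closed[OF LM(2)] by fastforce
  moreover have "M \<subseteq> component \<rho>"
    using LM(5) set_mult_memI[of \<one> L _ M] subgroup.one_closed[OF LM(1)] by fastforce
  moreover have "q \<rho> b \<in> L" using ba LM(6) subgroup.one_closed[OF LM(1)] by auto
  moreover have "\<exists>l\<in>L. \<exists>y\<in>M. x = l \<otimes> y" if "x \<in> B \<inter> component \<rho>" for x
    using that LM(5) by (metis IntD2 set_mult_memE)
  moreover have "L \<noteq> {\<one>}" using LM(6) a(3) by auto
  ultimately show ?thesis
    unfolding adapted_splitting_def
    by (intro exI[of _ L] exI[of _ M] exI[of _ a] conjI ballI impI LM(1,2,4,6) dep)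
qed

text \<open>\<open>B\<close> is generated by \<open>b\<close>, whose images lie in the groups
  \<open>L \<rho>\<close>, and by homogeneous elements, which split along \<open>L \<rho>\<close>
  and \<open>M \<rho>\<close>. So \<open>B\<close> is the direct sum of \<open>V\<close> and
  \<open>W\<close>, and indecomposability leaves \<open>V\<close> alone. Then one element
  \<open>a \<rho>\<close> per type spans \<open>B\<close> up to powers.\<close>

lemma rk_le_card_typeset:
  assumes B: "subgroup B G" "indecomposable (G \<restriction>\<restriction> B)" "B \<noteq> {\<one>}"
    and f: "f \<in> hom G G" "\<And>x. x \<in> carrier G \<Longrightarrow> f x \<in> B" "\<And>x. x \<in> B \<Longrightarrow> f x = x"
  shows "rk (G \<restriction>\<restriction> B) \<le> card (typeset B)"
proof -
  note [simp] = subgroup.mem_carrier[OF B(1)]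
  define b where "b = f g"
  have b: "b \<in> B" using f(2) g_closed by (simp add: b_def)
  have "\<exists>L M a. adapted_splitting B b \<rho> L M a" if "\<rho> \<in> T" for \<rho>
    by (rule component_splitting[OF B(1) f b that])
  then obtain L M a where split: "\<And>\<rho>. \<rho> \<in> T \<Longrightarrow> adapted_splitting B b \<rho> (L \<rho>) (M \<rho>) (a \<rho>)"
    by metis
  have Ls: "subgroup (L \<rho>) G" and Ms: "subgroup (M \<rho>) G" and LM: "L \<rho> \<inter> M \<rho> = {\<one>}"
    and LB: "L \<rho> \<subseteq> B" and LH: "L \<rho> \<subseteq> component \<rho>" and MH: "M \<rho> \<subseteq> component \<rho>"
    and aL: "a \<rho> \<in> L \<rho>" and dep: "\<And>x. x \<in> L \<rho> \<Longrightarrow> \<exists>(m::int) (n::int). m \<noteq> 0 \<and> x [^] m = a \<rho> [^] n"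
    and qb: "q \<rho> b \<in> L \<rho>" and dec: "\<And>x. x \<in> B \<Longrightarrow> x \<in> component \<rho> \<Longrightarrow> \<exists>l\<in>L \<rho>. \<exists>y\<in>M \<rho>. x = l \<otimes> y"
    and nt: "\<rho> \<in> typeset B \<Longrightarrow> L \<rho> \<noteq> {\<one>}" if "\<rho> \<in> T" for \<rho>
    using split[OF that] unfolding adapted_splitting_def by auto
  have q_comp_prod: "q \<sigma> (\<Otimes>\<rho>\<in>T. r \<rho>) = r \<sigma> [^] e" if \<sigma>: "\<sigma> \<in> T" and r: "\<And>\<rho>. \<rho> \<in> T \<Longrightarrow> r \<rho> \<in> component \<rho>" for \<sigma> r
  proof -
    have "q \<sigma> (\<Otimes>\<rho>\<in>T. r \<rho>) = (\<Otimes>\<rho>\<in>T. q \<sigma> (r \<rho>))"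
      using r component_carrier \<sigma> by (intro q_finprod) auto
    also have "\<dots> = q \<sigma> (r \<sigma>)"
    proof (rule finprod_single[OF finite_T \<sigma>])
      show "(\<lambda>\<rho>. q \<sigma> (r \<rho>)) \<in> T \<rightarrow> carrier G" using q_closed[OF \<sigma> component_carrier[OF r]] by auto
      show "q \<sigma> (r \<rho>) = \<one>" if "\<rho> \<in> T" "\<rho> \<noteq> \<sigma>" for \<rho> using component_other[OF r] \<sigma> that by auto
    qed
    also have "\<dots> = r \<sigma> [^] e" using q_component[OF \<sigma> r[OF \<sigma>]] .
    finally show ?thesis .
  qed
  define V where "V = {x \<in> B. \<forall>\<rho>\<in>T. q \<rho> x \<in> L \<rho>}"
  define W where "W = {x \<in> B. \<forall>\<rho>\<in>T. q \<rho> x \<in> M \<rho>}"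
  have s: "subgroup V G" "subgroup W G"
    unfolding V_def W_def by (intro q_preimage_subgroup B(1) order_refl Ls Ms; assumption)+
  have sub: "V \<subseteq> B" "W \<subseteq> B" by (auto simp: V_def W_def)
  have decomp: "\<exists>v\<in>V. \<exists>w\<in>W. x = v \<otimes> w" if x: "x \<in> B" for x
  proof -
    obtain k :: int and r where r: "\<And>\<rho>. \<rho> \<in> T \<Longrightarrow> r \<rho> \<in> component \<rho>" "x = g [^] k \<otimes> (\<Otimes>\<rho>\<in>T. r \<rho>)"
      using generates[of x] x by auto
    have rc: "r \<in> T \<rightarrow> carrier G" using r(1) component_carrier by auto
    have fr: "f (r \<rho>) \<in> B" "f (r \<rho>) \<in> component \<rho>" if "\<rho> \<in> T" for \<rho>
      using r(1)[OF that] component_carrier f(2) hom_component[OF f(1)] by auto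
    \<comment> \<open>The projection \<open>f\<close> turns \<open>g\<close> into \<open>b\<close>
      and moves each \<open>r \<rho>\<close> into \<open>B\<close> without leaving its
      component.\<close>
    have "x = f x" using f(3)[OF x] by simp
    also have "\<dots> = f (g [^] k) \<otimes> f (\<Otimes>\<rho>\<in>T. r \<rho>)"
      unfolding r(2) using f(1) g_closed finprod_closed[OF rc] by (simp add: hom_def)
    also have "f (g [^] k) = b [^] k" unfolding b_def using hom_pow[OF f(1) g_closed] .
    also have "f (\<Otimes>\<rho>\<in>T. r \<rho>) = (\<Otimes>\<rho>\<in>T. f (r \<rho>))"
      using hom_finprod[OF comm_group_axioms comm_group_axioms f(1) rc] .
    finally have x1: "x = b [^] k \<otimes> (\<Otimes>\<rho>\<in>T. f (r \<rho>))" .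
    have "\<exists>l y. l \<in> L \<rho> \<and> y \<in> M \<rho> \<and> f (r \<rho>) = l \<otimes> y" if "\<rho> \<in> T" for \<rho>
      using dec[OF that fr[OF that]] by blast
    then obtain l y where ly: "\<And>\<rho>. \<rho> \<in> T \<Longrightarrow> l \<rho> \<in> L \<rho> \<and> y \<rho> \<in> M \<rho> \<and> f (r \<rho>) = l \<rho> \<otimes> y \<rho>" by metis
    have lc: "l \<rho> \<in> component \<rho>" "y \<rho> \<in> component \<rho>" "l \<rho> \<in> carrier G" "y \<rho> \<in> carrier G" "l \<rho> \<in> B" if "\<rho> \<in> T" for \<rho>
      using ly[OF that] LH[OF that] MH[OF that] LB[OF that] component_carrier by auto
    have lyc: "l \<in> T \<rightarrow> carrier G" "y \<in> T \<rightarrow> carrier G" using lc by auto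
    have "(\<Otimes>\<rho>\<in>T. f (r \<rho>)) = (\<Otimes>\<rho>\<in>T. l \<rho> \<otimes> y \<rho>)"
      using ly lc by (intro finprod_cong') auto
    also have "\<dots> = (\<Otimes>\<rho>\<in>T. l \<rho>) \<otimes> (\<Otimes>\<rho>\<in>T. y \<rho>)" using lyc by simp
    finally have prod: "(\<Otimes>\<rho>\<in>T. f (r \<rho>)) = (\<Otimes>\<rho>\<in>T. l \<rho>) \<otimes> (\<Otimes>\<rho>\<in>T. y \<rho>)" .
    \<comment> \<open>\<open>v\<close> collects the power of \<open>b\<close> and the parts in
      \<open>L \<rho>\<close>, \<open>w\<close> the parts in \<open>M \<rho>\<close>.\<close>
    define v where "v = b [^] k \<otimes> (\<Otimes>\<rho>\<in>T. l \<rho>)"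
    define w where "w = (\<Otimes>\<rho>\<in>T. y \<rho>)"
    note lyf = finprod_closed[OF lyc(1)] finprod_closed[OF lyc(2)]
    have xvw: "x = v \<otimes> w" unfolding x1 prod v_def w_def using b lyf by (simp add: m_assoc)
    have vB: "v \<in> B"
      unfolding v_def using finprod_in_subgroup[OF B(1), of l T] lc subgroup_int_pow_closed[OF B(1) b]
      by (intro subgroup.m_closed[OF B(1)]) auto
    have wc: "w \<in> carrier G" using lyf by (simp add: w_def)
    \<comment> \<open>The groups \<open>M \<rho>\<close> are not assumed to lie in \<open>B\<close>;
      \<open>w\<close> belongs to \<open>B\<close> because \<open>x\<close> and \<open>v\<close>
      do.\<close>
    have "w = inv v \<otimes> x" unfolding xvw using vB wc by (simp add: m_assoc[symmetric])
    then have wB: "w \<in> B" using subgroup.m_closed[OF B(1) subgroup.m_inv_closed[OF B(1) vB] x] by simp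
    have "q \<sigma> v \<in> L \<sigma>" if \<sigma>: "\<sigma> \<in> T" for \<sigma>
    proof -
      have "q \<sigma> v = q \<sigma> b [^] k \<otimes> l \<sigma> [^] e"
        unfolding v_def using q_mult[OF \<sigma>] q_pow[OF \<sigma>] b lyf q_comp_prod[OF \<sigma> lc(1)] by simp
      then show ?thesis
        using qb[OF \<sigma>] ly[OF \<sigma>] subgroup_int_pow_closed[OF Ls[OF \<sigma>]] subgroup.m_closed[OF Ls[OF \<sigma>]] by simp
    qed
    moreover have "q \<sigma> w \<in> M \<sigma>" if \<sigma>: "\<sigma> \<in> T" for \<sigma>
      unfolding w_def using q_comp_prod[OF \<sigma> lc(2)] ly[OF \<sigma>] subgroup_int_pow_closed[OF Ms[OF \<sigma>]] by simp
    ultimately have "v \<in> V" "w \<in> W" using vB wB by (auto simp: V_def W_def)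
    then show ?thesis using xvw by blast
  qed
  have "direct_sum2 (G \<restriction>\<restriction> B) V W"
    unfolding direct_sum2_def
  proof (intro conjI)
    show "subgroup V (G \<restriction>\<restriction> B)" "subgroup W (G \<restriction>\<restriction> B)"
      by (intro subgroup_incl s B(1) sub)+
    have "x = \<one>" if "x \<in> V" "x \<in> W" for x
      by (rule q_faithful) (use that LM in \<open>auto simp: V_def W_def\<close>)
    then have "V \<inter> W = {\<one>}" using subgroup.one_closed[OF s(1)] subgroup.one_closed[OF s(2)] by blast
    then show "V \<inter> W = {\<one>\<^bsub>G \<restriction>\<restriction> B\<^esub>}" by simp
    have "V <#> W = B"
    proof
      show "V <#> W \<subseteq> B" using sub subgroup.m_closed[OF B(1)] by (auto simp: set_mult_def)
      show "B \<subseteq> V <#> W" using decomp set_mult_memI by (metis subsetI)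
    qed
    then show "V <#>\<^bsub>G \<restriction>\<restriction> B\<^esub> W = carrier (G \<restriction>\<restriction> B)"
      by (simp add: set_mult_def)
  qed
  then have VW: "V = {\<one>\<^bsub>G \<restriction>\<restriction> B\<^esub>} \<or> W = {\<one>\<^bsub>G \<restriction>\<restriction> B\<^esub>}"
    using B(2) unfolding indecomposable_def by blast
  \<comment> \<open>For a type \<open>\<rho>\<close> of \<open>B\<close> the nontrivial group
    \<open>L \<rho>\<close> is contained in \<open>V\<close>.\<close>
  have "V \<noteq> {\<one>}"
  proof -
    obtain x where x: "x \<in> B" "x \<noteq> \<one>" using B(3) subgroup.one_closed[OF B(1)] by blast
    then obtain \<rho> where \<rho>: "\<rho> \<in> T" "q \<rho> x \<noteq> \<one>" using q_faithful[of x] by auto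
    then have "\<rho> \<in> typeset B" using x by (auto simp: typeset_def)
    then obtain l where l: "l \<in> L \<rho>" "l \<noteq> \<one>"
      using nt[OF \<rho>(1)] subgroup.one_closed[OF Ls[OF \<rho>(1)]] by blast
    have lH: "l \<in> component \<rho>" using l LH \<rho> by auto
    have "q \<sigma> l \<in> L \<sigma>" if \<sigma>: "\<sigma> \<in> T" for \<sigma>
    proof (cases "\<sigma> = \<rho>")
      case True
      then show ?thesis using q_component[OF \<rho>(1) lH] subgroup_int_pow_closed[OF Ls[OF \<rho>(1)] l(1)] by simp
    next
      case False
      then show ?thesis using component_other[OF lH \<sigma>] subgroup.one_closed[OF Ls[OF \<sigma>]] by simp
    qed
    then have "l \<in> V" using LB[OF \<rho>(1)] l by (auto simp: V_def)
    then show ?thesis using l by auto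
  qed
  then have "W = {\<one>}" using VW by simp
  have BV: "q \<rho> x \<in> L \<rho>" if "x \<in> B" "\<rho> \<in> T" for x \<rho>
  proof -
    have "x \<in> V" using decomp[OF that(1)] \<open>W = {\<one>}\<close> sub by auto
    then show ?thesis using that by (simp add: V_def)
  qed
  have TT: "typeset B \<subseteq> T" "finite (typeset B)" using finite_T by (auto simp: typeset_def)
  have ac: "a \<rho> \<in> carrier G" if "\<rho> \<in> T" for \<rho> using aL[OF that] LB[OF that] by auto
  show ?thesis
  proof (rule rk_restrict_le_card[OF finite_rank B(1) TT(2)])
    show "a \<in> typeset B \<rightarrow> carrier G" using ac TT by auto
    fix x assume x: "x \<in> B"
    have "\<exists>(m::int) (n::int). m \<noteq> 0 \<and> q \<rho> x [^] m = a \<rho> [^] n" if "\<rho> \<in> typeset B" for \<rho>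
      using dep[OF _ BV[OF x]] TT that by blast
    then obtain m n where mn: "\<And>\<rho>. \<rho> \<in> typeset B \<Longrightarrow> (m \<rho> :: int) \<noteq> 0 \<and> q \<rho> x [^] m \<rho> = a \<rho> [^] (n \<rho> :: int)" by metis
    \<comment> \<open>A common exponent for all types: each \<open>q \<rho> x [^] N\<close> is a
      power of \<open>a \<rho>\<close>, with exponent \<open>c \<rho>\<close>.\<close>
    define N where "N = (\<Prod>\<rho>\<in>typeset B. m \<rho>)"
    have N: "N \<noteq> 0" using mn TT by (simp add: N_def)
    define c where "c \<rho> = n \<rho> * (\<Prod>\<sigma>\<in>typeset B - {\<rho>}. m \<sigma>)" for \<rho>
    have qN: "q \<rho> x [^] N = a \<rho> [^] c \<rho>" if \<rho>: "\<rho> \<in> typeset B" for \<rho>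
    proof -
      have "N = m \<rho> * (\<Prod>\<sigma>\<in>typeset B - {\<rho>}. m \<sigma>)" unfolding N_def using TT \<rho> by (simp add: prod.remove)
      moreover have "q \<rho> x \<in> carrier G" "a \<rho> \<in> carrier G" using q_closed ac \<rho> TT x by auto
      ultimately show ?thesis using mn[OF \<rho>] by (simp add: c_def int_pow_pow[symmetric])
    qed
    have "x [^] e = (\<Otimes>\<rho>\<in>T. q \<rho> x)" using q_sum[of x] x by simp
    also have "\<dots> = (\<Otimes>\<rho>\<in>typeset B. q \<rho> x)"
    proof (rule finprod_mono_neutral_cong_right[OF finite_T TT(1)])
      show "q \<rho> x = \<one>" if "\<rho> \<in> T - typeset B" for \<rho> using that x by (auto simp: typeset_def)
    qed (use q_closed x in auto)
    finally have "x [^] (e * N) = (\<Otimes>\<rho>\<in>typeset B. q \<rho> x) [^] N" using x by (simp add: int_pow_pow[symmetric])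
    also have "\<dots> = (\<Otimes>\<rho>\<in>typeset B. q \<rho> x [^] N)" using q_closed x TT by (intro int_pow_finprod) auto
    also have "\<dots> = (\<Otimes>\<rho>\<in>typeset B. a \<rho> [^] c \<rho>)" using qN ac TT by (intro finprod_cong') auto
    finally show "\<exists>m c. m \<noteq> (0::int) \<and> x [^] m = (\<Otimes>z\<in>typeset B. a z [^] (c z :: int))"
      using N e_pos by (intro exI[of _ "e * N"] exI[of _ c]) auto
  qed
qed

theorem rank_plus_summands_le:
  "max_indec_rank G + max_num_summands G \<le> rk G + 1"
proof -
  define t where "t = max_num_summands G"
  obtain A where A: "indec_decomposition G t A"
    using max_num_summands_attained[OF torsion_free finite_rank] by (auto simp: t_def)
  have ids: "internal_direct_sum G {..<t} A" and nz: "\<And>i. i < t \<Longrightarrow> A i \<noteq> {\<one>}"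
    using A by (auto simp: indec_decomposition_def)
  obtain p where p: "proj_family G {..<t} A p" using internal_direct_sum_imp_proj_family[OF ids] .
  have As: "subgroup (A i) G" if "i < t" for i using proj_family_subgroup[OF p] that by simp
  obtain B where B: "direct_summand G B" "indecomposable (G \<restriction>\<restriction> B)" "rk (G \<restriction>\<restriction> B) = max_indec_rank G"
    using max_indec_rank_attained[OF finite_rank] by blast
  have t_le: "t \<le> rk G" using indec_decomposition_le_rk[OF torsion_free finite_rank A] .
  show ?thesis
  proof (cases "B = {\<one>}")
    case True
    then show ?thesis using B(3) rk_trivial t_le by (simp add: t_def)
  next
    case False
    obtain C where BC: "direct_sum2 G B C" using B(1) by (auto simp: direct_summand_def)
    then have Bs: "subgroup B G" by (simp add: direct_sum2_def)
    obtain f where f: "f \<in> hom G G" "\<And>x. x \<in> carrier G \<Longrightarrow> f x \<in> B" "\<And>x. x \<in> B \<Longrightarrow> f x = x"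
      using direct_sum2_projection[OF BC] by metis
    have pos: "1 \<le> rk (G \<restriction>\<restriction> A i)" if "i < t" for i
      using rk_restrict_pos[OF torsion_free finite_rank As[OF that] nz[OF that]] .
    have Ti: "card (typeset (A i)) \<le> rk (G \<restriction>\<restriction> A i)" if i: "i < t" for i
    proof (rule card_typeset_le_rk[OF As[OF i]])
      fix \<rho> x assume \<rho>: "\<rho> \<in> T" and x: "x \<in> A i"
      have xc: "x \<in> carrier G" using subgroup.mem_carrier[OF As[OF i] x] .
      \<comment> \<open>The projection onto \<open>A i\<close> is an endomorphism and so commutes
        with \<open>q \<rho>\<close>; hence \<open>A i\<close> is invariant under
        \<open>q \<rho>\<close>.\<close>
      have "p i (q \<rho> x) = q \<rho> x"
        using q_commute[OF proj_family_hom[OF p] \<rho> xc, of i] proj_family_id[OF p _ x] i by simp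
      then show "q \<rho> x \<in> A i" using proj_family_in[OF p _ q_closed[OF \<rho> xc], of i] i by simp
    qed
    have "rk (G \<restriction>\<restriction> B) \<le> card (typeset B)"
      by (rule rk_le_card_typeset[OF Bs B(2) False f])
    also have "\<dots> \<le> 1 + (\<Sum>i<t. card (typeset (A i)) - 1)"
    proof (rule connected_hypergraph_card)
      show "typeset B \<subseteq> U \<or> typeset B \<inter> U = {}"
        if "\<And>i. i \<in> {..<t} \<Longrightarrow> typeset (A i) \<subseteq> U \<or> typeset (A i) \<inter> U = {}" for U
        by (rule indecomposable_typeset_separation[OF p that Bs B(2) f])
    qed (use finite_T in \<open>auto simp: typeset_def\<close>)
    also have "\<dots> \<le> 1 + (\<Sum>i<t. rk (G \<restriction>\<restriction> A i) - 1)"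
      using Ti by (intro add_left_mono sum_mono diff_le_mono) auto
    \<comment> \<open>One is added back for each of the \<open>t\<close> summands; as their ranks
      are positive, the truncated differences become ranks again.\<close>
    finally have "max_indec_rank G + t \<le> 1 + (\<Sum>i<t. rk (G \<restriction>\<restriction> A i) - 1) + (\<Sum>i<t. 1)" using B(3) by simp
    also have "\<dots> = 1 + (\<Sum>i<t. rk (G \<restriction>\<restriction> A i) - 1 + 1)" by (simp only: sum.distrib add.assoc)
    also have "\<dots> = 1 + (\<Sum>i<t. rk (G \<restriction>\<restriction> A i))" using pos by (intro arg_cong2[of _ _ _ _ "(+)"] sum.cong le_add_diff_inverse2) auto
    also have "\<dots> \<le> 1 + rk G" using sum_rk_le_rk[OF finite_rank ids] by simp
    finally show ?thesis by (simp add: t_def)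
  qed
qed

end

section \<open>The regulator of a block-rigid group\<close>

text \<open>Restricted to a rank-one summand of \<open>A\<close> and projected to one of
  \<open>B\<close>, the map \<open>h\<close> is a homomorphism from a group of type
  \<open>\<rho>\<close> to one of type \<open>\<sigma>\<close>. A nonzero one would witness
  \<open>type_le \<rho> \<sigma>\<close>.\<close>

lemma homogeneous_cd_hom_trivial:
  assumes A: "homogeneous_cd A \<rho>" and B: "homogeneous_cd B \<sigma>" and nle: "\<not> type_le \<rho> \<sigma>"
    and h: "h \<in> hom A B" and x: "x \<in> carrier A"
  shows "h x = \<one>\<^bsub>B\<^esub>"
proof -
  interpret A: plain_comm_group A using A by (simp add: homogeneous_cd_def plain_comm_group_def)
  interpret B: plain_comm_group B using B by (simp add: homogeneous_cd_def plain_comm_group_def)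
  obtain m E where E: "internal_direct_sum A {..<m::nat} E" "\<And>i. i < m \<Longrightarrow> A \<restriction>\<restriction> E i \<in> \<rho>"
    using A by (auto simp: homogeneous_cd_def)
  obtain n F where F: "internal_direct_sum B {..<n::nat} F" "\<And>i. i < n \<Longrightarrow> B \<restriction>\<restriction> F i \<in> \<sigma>"
    using B by (auto simp: homogeneous_cd_def)
  obtain p where p: "proj_family A {..<m} E p" using A.internal_direct_sum_imp_proj_family[OF E(1)] .
  obtain r where r: "proj_family B {..<n} F r" using B.internal_direct_sum_imp_proj_family[OF F(1)] .
  have Ec: "y \<in> carrier A" if "i < m" "y \<in> E i" for i y
    using subgroup.mem_carrier[OF A.proj_family_subgroup[OF p]] that by auto
  have hc: "h y \<in> carrier B" if "y \<in> carrier A" for y using hom_in_carrier[OF h that] .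
  have triv: "h y = \<one>\<^bsub>B\<^esub>" if i: "i < m" and y: "y \<in> E i" for i y
  proof -
    have "r j (h y) = \<one>\<^bsub>B\<^esub>" if j: "j < n" for j
    proof (rule ccontr)
      assume ne: "r j (h y) \<noteq> \<one>\<^bsub>B\<^esub>"
      have "(\<lambda>y. r j (h y)) \<in> hom (A \<restriction>\<restriction> E i) (B \<restriction>\<restriction> F j)"
      proof (rule homI)
        fix u v assume "u \<in> carrier (A \<restriction>\<restriction> E i)" "v \<in> carrier (A \<restriction>\<restriction> E i)"
        then have uv: "u \<in> carrier A" "v \<in> carrier A" using Ec[OF i] by auto
        show "r j (h u) \<in> carrier (B \<restriction>\<restriction> F j)"
          using B.proj_family_in[OF r _ hc[OF uv(1)], of j] j by simp
        have "h (u \<otimes>\<^bsub>A\<^esub> v) = h u \<otimes>\<^bsub>B\<^esub> h v" using h uv by (simp add: hom_def)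
        then show "r j (h (u \<otimes>\<^bsub>A \<restriction>\<restriction> E i\<^esub> v)) = r j (h u) \<otimes>\<^bsub>B \<restriction>\<restriction> F j\<^esub> r j (h v)"
          using B.proj_family_hom[OF r, of j] j hc uv by (simp add: hom_def)
      qed
      then have "type_le \<rho> \<sigma>"
        unfolding type_le_def using E(2)[OF i] F(2)[OF j] y ne
        by (intro bexI[of _ "A \<restriction>\<restriction> E i"] bexI[of _ "B \<restriction>\<restriction> F j"] bexI[of _ "\<lambda>y. r j (h y)"] bexI[of _ y]) auto
      with nle show False ..
    qed
    then have "(\<Otimes>\<^bsub>B\<^esub>j\<in>{..<n}. r j (h y)) = \<one>\<^bsub>B\<^esub>" by (intro B.finprod_one_eqI) simp
    then show ?thesis using B.proj_family_sum[OF r hc[OF Ec[OF i y]]] by simp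
  qed
  have "h x = h (\<Otimes>\<^bsub>A\<^esub>i\<in>{..<m}. p i x)" using A.proj_family_sum[OF p x] by simp
  also have "\<dots> = (\<Otimes>\<^bsub>B\<^esub>i\<in>{..<m}. h (p i x))"
    using A.proj_family_closed[OF p _ x]
    by (intro hom_finprod[OF A.comm_group_axioms B.comm_group_axioms h]) auto
  also have "\<dots> = \<one>\<^bsub>B\<^esub>"
    using triv A.proj_family_in[OF p _ x] by (intro B.finprod_one_eqI) simp
  finally show ?thesis .
qed

text \<open>Supplies the fixed group \<open>S\<close> of \<open>homogeneous_sum\<close> for a given
  type.\<close>

lemma grp_types_representative:
  fixes \<rho> :: "'a monoid set"
  assumes "\<rho> \<in> grp_types"
  obtains S :: "'a monoid" where "group S" "\<And>E. E \<in> \<rho> \<Longrightarrow> rank_one E \<and> S \<cong> E"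
proof -
  obtain S :: "'a monoid" where "S \<in> {A. rank_one A}" "\<rho> = {(A, B). rank_one A \<and> rank_one B \<and> A \<cong> B} `` {S}"
    using assms unfolding grp_types_def by (rule quotientE)
  then have S: "rank_one S" "\<rho> = {B. rank_one B \<and> S \<cong> B}" by auto
  have "group S" using S(1) by (auto simp: rank_one_def tffr_group_def comm_group_def)
  then show thesis using S that by auto
qed

context plain_comm_group
begin

text \<open>Lagrange's theorem in the quotient by \<open>A\<close>, whose order is the
  index.\<close>

lemma finite_index_pow:
  assumes A: "subgroup A G" and x: "x \<in> carrier G"
  shows "x [^] card (rcosets A) \<in> A"
proof -
  interpret N: normal A G using A by (rule subgroup_imp_normal)
  interpret Q: group "G Mod A" by (rule N.factorgroup_is_group)
  have "(A #> x) [^]\<^bsub>G Mod A\<^esub> order (G Mod A) = \<one>\<^bsub>G Mod A\<^esub>"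
    using x by (intro Q.pow_order_eq_1) (auto simp: carrier_FactGroup)
  then have "A #> (x [^] order (G Mod A)) = A" using N.FactGroup_pow[OF x] by simp
  from coset_join1[OF this _ A] have "x [^] order (G Mod A) \<in> A" using x by simp
  then show ?thesis by (simp add: order_def FactGroup_def)
qed

text \<open>All regulating subgroups share the least index, so one exponent works for each of them
  and hence for their intersection.\<close>

lemma regulator_subgroup_bounded:
  assumes "almost_completely_decomposable G"
  obtains m :: nat where "m > 0" "subgroup (regulator G) G"
    "\<And>x. x \<in> carrier G \<Longrightarrow> x [^] m \<in> regulator G"
proof -
  define idx where "idx A = card (rcosets A)" for A
  obtain A0 where "cd_finite_index G A0" using assms by (auto simp: almost_completely_decomposable_def)
  then obtain A where A: "cd_finite_index G A" "\<And>B. cd_finite_index G B \<Longrightarrow> idx A \<le> idx B"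
    using ex_has_least_nat[of "cd_finite_index G" A0 idx] by blast
  then have reg: "regulating G A" by (simp add: regulating_def idx_def)
  have idx: "idx B = idx A" if "regulating G B" for B
    using that reg by (auto simp: regulating_def idx_def intro: le_antisym)
  have sub: "subgroup B G" if "regulating G B" for B
    using that by (auto simp: regulating_def cd_finite_index_def)
  show thesis
  proof (rule that[of "idx A"])
    have "A \<in> rcosets A" using subgroup.subgroup_in_rcosets[OF sub[OF reg] is_group] .
    then show "idx A > 0"
      using A(1) by (auto simp: idx_def cd_finite_index_def card_gt_0_iff)
    show "subgroup (regulator G) G"
      unfolding regulator_def using reg sub by (intro subgroups_Inter) auto
    fix x assume x: "x \<in> carrier G"
    have "x [^] idx A \<in> B" if "regulating G B" for B
      using finite_index_pow[OF sub[OF that] x] idx[OF that] by (simp add: idx_def)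
    then show "x [^] idx A \<in> regulator G" by (auto simp: regulator_def)
  qed
qed

lemma cyclic_quotient_generator:
  assumes R: "subgroup R G" and cyc: "cyclic_group (G Mod R)"
  obtains g where "g \<in> carrier G" "\<And>x. x \<in> carrier G \<Longrightarrow> \<exists>(k::int). \<exists>r\<in>R. x = r \<otimes> g [^] k"
proof -
  interpret N: normal R G using R by (rule subgroup_imp_normal)
  interpret Q: group "G Mod R" by (rule N.factorgroup_is_group)
  obtain c where c: "c \<in> carrier (G Mod R)" "carrier (G Mod R) = range (\<lambda>n::int. c [^]\<^bsub>G Mod R\<^esub> n)"
    using cyc Q.cyclic_group by auto
  obtain g where g: "g \<in> carrier G" "c = R #> g" using c(1) by (auto simp: carrier_FactGroup)
  show thesis
  proof (rule that[OF g(1)])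
    fix x assume x: "x \<in> carrier G"
    then have "R #> x \<in> carrier (G Mod R)" by (auto simp: carrier_FactGroup)
    then obtain k :: int where "R #> x = c [^]\<^bsub>G Mod R\<^esub> k" using c(2) by auto
    then have "R #> x = R #> (g [^] k)" using N.FactGroup_int_pow[OF g(1)] g(2) by simp
    then have "x \<in> R #> (g [^] k)" using rcos_self[OF x R] by simp
    then show "\<exists>(k::int). \<exists>r\<in>R. x = r \<otimes> g [^] k" by (auto simp: r_coset_def)
  qed
qed

text \<open>Centrality follows from the vanishing of \<open>q \<sigma>\<close> after
  \<open>f\<close> after \<open>q \<rho>\<close>: inserting the sum of all projections on either
  side of \<open>f\<close> shows that \<open>q \<sigma> (f x) [^] e\<close> and
  \<open>f (q \<sigma> x) [^] e\<close> both equal \<open>q \<sigma> (f (q \<sigma> x))\<close>.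
  Orthogonality is the case of the identity.\<close>

lemma critical_projectionsI:
  assumes tf: "torsion_free G" and "finite_rank G" and T: "finite T" and e: "e > 0"
    and qh: "\<And>\<rho>. \<rho> \<in> T \<Longrightarrow> q \<rho> \<in> hom G G"
    and qs: "\<And>x. x \<in> carrier G \<Longrightarrow> (\<Otimes>\<rho>\<in>T. q \<rho> x) = x [^] e"
    and qf: "\<And>f \<rho> \<sigma> x. f \<in> hom G G \<Longrightarrow> \<rho> \<in> T \<Longrightarrow> \<sigma> \<in> T \<Longrightarrow> \<rho> \<noteq> \<sigma> \<Longrightarrow> x \<in> carrier G \<Longrightarrow> q \<sigma> (f (q \<rho> x)) = \<one>"
  shows "critical_projections G T e q"
proof unfold_locales
  show "q \<sigma> (q \<rho> x) = \<one>" if "\<rho> \<in> T" "\<sigma> \<in> T" "\<rho> \<noteq> \<sigma>" "x \<in> carrier G" for \<rho> \<sigma> x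
    using qf[of "\<lambda>x. x" \<rho> \<sigma> x] that by (simp add: hom_def)
  fix f \<sigma> x assume f: "f \<in> hom G G" and \<sigma>: "\<sigma> \<in> T" and x: "x \<in> carrier G"
  have qc: "q \<rho> y \<in> carrier G" if "\<rho> \<in> T" "y \<in> carrier G" for \<rho> y using hom_in_carrier[OF qh[OF that(1)] that(2)] .
  have fc: "f y \<in> carrier G" if "y \<in> carrier G" for y using hom_in_carrier[OF f that] .
  have "q \<sigma> (f x) [^] e = q \<sigma> (f (x [^] e))" using hom_pow[OF qh[OF \<sigma>] fc[OF x]] hom_pow[OF f x] by simp
  also have "x [^] e = (\<Otimes>\<rho>\<in>T. q \<rho> x)" using qs[OF x] by simp
  also have "f \<dots> = (\<Otimes>\<rho>\<in>T. f (q \<rho> x))"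
    using qc x by (intro hom_finprod[OF comm_group_axioms comm_group_axioms f]) auto
  also have "q \<sigma> \<dots> = (\<Otimes>\<rho>\<in>T. q \<sigma> (f (q \<rho> x)))"
    using qc fc x by (intro hom_finprod[OF comm_group_axioms comm_group_axioms qh[OF \<sigma>]]) auto
  also have "\<dots> = q \<sigma> (f (q \<sigma> x))"
    using qf[OF f] qc fc x \<sigma> by (intro finprod_single[OF T \<sigma>]) auto
  also have "\<dots> = (\<Otimes>\<tau>\<in>T. q \<tau> (f (q \<sigma> x)))"
  proof (rule finprod_single[OF T \<sigma>, symmetric])
    show "q \<tau> (f (q \<sigma> x)) = \<one>" if "\<tau> \<in> T" "\<tau> \<noteq> \<sigma>" for \<tau>
      using qf[OF f \<sigma> that(1) _ x] that(2) by simp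
  qed (use qc fc x \<sigma> in auto)
  also have "\<dots> = f (q \<sigma> x) [^] e" using qs fc qc \<sigma> x by simp
  finally have "f (q \<sigma> x) [^] e = q \<sigma> (f x) [^] e" by simp
  then show "f (q \<sigma> x) = q \<sigma> (f x)"
    using torsion_free_int_pow_inj[OF tf fc[OF qc[OF \<sigma> x]] qc[OF \<sigma> fc[OF x]]] e by simp
qed (use assms in auto)

text \<open>The components of \<open>G\<close> may exceed the homogeneous components
  \<open>D \<rho>\<close> of the regulator. The cyclic quotient makes each of them a cyclic
  extension of \<open>D \<rho>\<close>, and therefore again a direct sum of copies of one rank-one
  group.\<close>

theorem class_B_cyclic_critical_projections:
  assumes G: "G \<in> \<B>"
  shows "\<exists>(T :: 'a monoid set set) e q g. cyclic_critical_projections G T e q g"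
proof -
  have acd: "almost_completely_decomposable G" and br: "block_rigid G" and cyc: "cyclic_group (G Mod regulator G)"
    using G by (auto simp: class_B_def)
  have tf: "torsion_free G" and fr: "finite_rank G"
    using acd by (auto simp: almost_completely_decomposable_def tffr_group_def)
  define R where "R = regulator G"
  obtain m :: nat where m: "m > 0" and Rs: "subgroup R G" and mR: "\<And>x. x \<in> carrier G \<Longrightarrow> x [^] m \<in> R"
    using regulator_subgroup_bounded[OF acd] unfolding R_def by blast
  define e where "e = int m"
  have e: "e > 0" and eR: "\<And>x. x \<in> carrier G \<Longrightarrow> x [^] e \<in> R"
    using m mR by (auto simp: e_def int_pow_int)
  obtain g where g: "g \<in> carrier G" "\<And>x. x \<in> carrier G \<Longrightarrow> \<exists>(k::int). \<exists>r\<in>R. x = r \<otimes> g [^] k"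
    using cyclic_quotient_generator[OF Rs] cyc unfolding R_def by blast
  obtain T where "is_critical_typeset (G \<restriction>\<restriction> R) T" and anti: "type_antichain T"
    using br unfolding block_rigid_def R_def by blast
  then obtain D where T: "T \<subseteq> grp_types" and D: "internal_direct_sum (G \<restriction>\<restriction> R) T D"
    and hcd: "\<And>\<rho>. \<rho> \<in> T \<Longrightarrow> homogeneous_cd (G \<restriction>\<restriction> D \<rho>) \<rho>"
    by (auto simp: is_critical_typeset_def)
  interpret R: plain_comm_group "G \<restriction>\<restriction> R" by (rule restrict_plain_comm_group) fact
  obtain p where p: "proj_family (G \<restriction>\<restriction> R) T D p" using R.internal_direct_sum_imp_proj_family[OF D] .
  have finT: "finite T" using R.proj_family_finite[OF p] .
  note Rc [simp] = subgroup.mem_carrier[OF Rs]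
  have Ds: "subgroup (D \<rho>) G" if "\<rho> \<in> T" for \<rho>
    using incl_subgroup[OF Rs R.proj_family_subgroup[OF p that]] .
  have DR: "D \<rho> \<subseteq> R" if "\<rho> \<in> T" for \<rho>
    using subgroup.subset[OF R.proj_family_subgroup[OF p that]] by simp
  have Dc: "x \<in> carrier G" if "\<rho> \<in> T" "x \<in> D \<rho>" for \<rho> x
    using Rc[OF subsetD[OF DR that(2)]] that(1) by simp
  have pD: "p \<rho> x \<in> D \<rho>" if "\<rho> \<in> T" "x \<in> R" for \<rho> x using R.proj_family_in[OF p that(1)] that by simp
  have pid: "p \<rho> x = x" if "\<rho> \<in> T" "x \<in> D \<rho>" for \<rho> x using R.proj_family_id[OF p that] .
  have poth: "p \<sigma> x = \<one>" if "\<sigma> \<in> T" "\<rho> \<in> T" "\<sigma> \<noteq> \<rho>" "x \<in> D \<rho>" for \<rho> \<sigma> x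
    using R.proj_family_other[OF p that] by simp
  have psum: "(\<Otimes>\<rho>\<in>T. p \<rho> x) = x" if "x \<in> R" for x
    using R.proj_family_sum[OF p, of x] finprod_restrict[OF Rs, of "\<lambda>\<rho>. p \<rho> x" T] pD DR that by force
  have pmult: "p \<rho> (x \<otimes> y) = p \<rho> x \<otimes> p \<rho> y" if "\<rho> \<in> T" "x \<in> R" "y \<in> R" for \<rho> x y
    using R.proj_family_hom[OF p that(1)] that by (simp add: hom_def)
  have ppow: "p \<rho> (x [^] (k::int)) = p \<rho> x [^] k" if "\<rho> \<in> T" "x \<in> R" for \<rho> x k
    using R.hom_pow[OF R.proj_family_hom[OF p that(1)], of x k] that(2)
      int_pow_consistent[OF Rs that(2), of k] int_pow_consistent[OF Rs subsetD[OF DR[OF that(1)] pD[OF that]], of k]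
    by simp
  \<comment> \<open>The power \<open>x [^] e\<close> lies in \<open>R\<close>, the domain of the
    projections \<open>p \<rho>\<close>.\<close>
  define q where "q \<rho> x = p \<rho> (x [^] e)" for \<rho> x
  have qD: "q \<rho> x \<in> D \<rho>" if "\<rho> \<in> T" "x \<in> carrier G" for \<rho> x unfolding q_def using pD eR that by simp
  have qh: "q \<rho> \<in> hom G G" if "\<rho> \<in> T" for \<rho>
    using Dc[OF that qD[OF that]] pmult[OF that] eR by (intro homI) (auto simp: q_def int_pow_distrib)
  \<comment> \<open>On \<open>D \<rho>\<close> this composite is a homomorphism to
    \<open>D \<sigma>\<close>; distinct critical types are incomparable, so it vanishes.\<close>
  have Dhom: "q \<sigma> (f x) = \<one>" if f: "f \<in> hom G G" and \<rho>: "\<rho> \<in> T" "\<sigma> \<in> T" "\<rho> \<noteq> \<sigma>" and x: "x \<in> D \<rho>" for f \<rho> \<sigma> x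
  proof -
    have fc: "f y \<in> carrier G" if "y \<in> D \<rho>" for y using hom_in_carrier[OF f Dc[OF \<rho>(1) that]] .
    have "(\<lambda>x. q \<sigma> (f x)) \<in> hom (G \<restriction>\<restriction> D \<rho>) (G \<restriction>\<restriction> D \<sigma>)"
      using qD[OF \<rho>(2) fc] f qh[OF \<rho>(2)] Dc[OF \<rho>(1)] fc by (intro homI) (auto simp: hom_def)
    moreover have "\<not> type_le \<rho> \<sigma>" using anti \<rho> by (auto simp: type_antichain_def)
    ultimately show ?thesis
      using homogeneous_cd_hom_trivial[OF hcd[OF \<rho>(1)] hcd[OF \<rho>(2)]] x by fastforce
  qed
  interpret critical_projections G T e q
  proof (rule critical_projectionsI[OF tf fr finT e qh])
    show "(\<Otimes>\<rho>\<in>T. q \<rho> x) = x [^] e" if "x \<in> carrier G" for x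
      unfolding q_def using psum eR that by simp
    show "q \<sigma> (f (q \<rho> x)) = \<one>" if "f \<in> hom G G" "\<rho> \<in> T" "\<sigma> \<in> T" "\<rho> \<noteq> \<sigma>" "x \<in> carrier G" for f \<rho> \<sigma> x
      using Dhom[OF that(1-4) qD[OF that(2,5)]] .
  qed
  have D_comp: "D \<rho> \<subseteq> component \<rho>" if \<rho>: "\<rho> \<in> T" for \<rho>
  proof
    fix x assume x: "x \<in> D \<rho>"
    have "q \<sigma> x = \<one>" if "\<sigma> \<in> T" "\<sigma> \<noteq> \<rho>" for \<sigma>
      using Dhom[of "\<lambda>x. x" \<rho> \<sigma> x] \<rho> that x by (auto simp: hom_def)
    then show "x \<in> component \<rho>" using Dc[OF \<rho> x] by (simp add: component_def)
  qed
  \<comment> \<open>Inside \<open>R\<close> a component is no larger than \<open>D \<rho>\<close>: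
    the other projections of \<open>x\<close> have trivial \<open>e\<close>-th power.\<close>
  have comp_R: "x \<in> D \<rho>" if \<rho>: "\<rho> \<in> T" and x: "x \<in> component \<rho>" "x \<in> R" for \<rho> x
  proof -
    have pc: "p \<sigma> x \<in> carrier G" if "\<sigma> \<in> T" for \<sigma> using pD[OF that x(2)] Dc[OF that] by simp
    have "p \<sigma> x = \<one>" if \<sigma>: "\<sigma> \<in> T" "\<sigma> \<noteq> \<rho>" for \<sigma>
    proof -
      have "p \<sigma> x [^] e = \<one>" using component_other[OF x(1) \<sigma>] ppow[OF \<sigma>(1) x(2)] by (simp add: q_def)
      then show ?thesis using torsion_free_int[OF tf pc[OF \<sigma>(1)]] e by auto
    qed
    then have "(\<Otimes>\<sigma>\<in>T. p \<sigma> x) = p \<rho> x" using pc by (intro finprod_single[OF finT \<rho>]) auto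
    then show ?thesis using psum[OF x(2)] pD[OF \<rho> x(2)] by simp
  qed
  have comp_pow: "x [^] e \<in> D \<rho>" if "\<rho> \<in> T" "x \<in> component \<rho>" for \<rho> x
    using q_component[OF that] qD[OF that(1) component_carrier[OF that(2)]] by simp
  have comp_sub: "subgroup (component \<rho>) G" for \<rho>
  proof -
    have "component \<rho> = {x \<in> carrier G. \<forall>\<sigma>\<in>T - {\<rho>}. q \<sigma> x \<in> {\<one>}}" by (auto simp: component_def)
    also have "subgroup \<dots> G" by (intro q_preimage_subgroup subgroup_self triv_subgroup) auto
    finally show ?thesis .
  qed
  have comp_gen: "\<exists>h\<in>component \<rho>. component \<rho> = D \<rho> <#> cyclic_span G h" if \<rho>: "\<rho> \<in> T" for \<rho>
  proof -
    note cs = comp_sub[of \<rho>]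
    have K: "subgroup (component \<rho> <#> R) G" using mult_subgroups[OF cs Rs] .
    have RK: "r \<in> component \<rho> <#> R" if "r \<in> R" for r
      using set_mult_memI[OF subgroup.one_closed[OF cs] that] that by simp
    obtain d :: int where d: "d > 0" "\<And>k::int. g [^] k \<in> component \<rho> <#> R \<longleftrightarrow> d dvd k"
      \<comment> \<open>\<open>d\<close> is the order of \<open>g\<close> modulo
        \<open>component \<rho> <#> R\<close>; the factor of \<open>g [^] d\<close> in the component
        becomes the generator \<open>h\<close>.\<close>
      using power_membership[OF K g(1) e RK[OF eR[OF g(1)]]] by blast
    have "g [^] d \<in> component \<rho> <#> R" using d(2) by simp
    then obtain h r where hr: "h \<in> component \<rho>" "r \<in> R" "g [^] d = h \<otimes> r" by (rule set_mult_memE)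
    have hc: "h \<in> carrier G" using component_carrier[OF hr(1)] .
    have "component \<rho> \<subseteq> D \<rho> <#> cyclic_span G h"
    proof
      fix x assume x: "x \<in> component \<rho>"
      have xc: "x \<in> carrier G" using component_carrier[OF x] .
      \<comment> \<open>Modulo \<open>R\<close>, \<open>x\<close> is a power of \<open>g\<close>
        whose exponent is a multiple of \<open>d\<close>. So \<open>x\<close> differs from a power
        of \<open>h\<close> by an element of \<open>R\<close> in the component, that is, of
        \<open>D \<rho>\<close>.\<close>
      obtain k :: int and s where ks: "s \<in> R" "x = s \<otimes> g [^] k" using g(2)[OF xc] by blast
      have "g [^] k = x \<otimes> inv s" using ks g(1) by (simp add: m_comm[of s] m_assoc)
      also have "\<dots> \<in> component \<rho> <#> R" using x subgroup.m_inv_closed[OF Rs ks(1)] by (rule set_mult_memI)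
      finally obtain j where j: "k = d * j" using d(2) by (auto simp: dvd_def)
      have gk: "g [^] k = h [^] j \<otimes> r [^] j"
        using hr hc g(1) by (simp add: j int_pow_pow[symmetric] int_pow_distrib)
      let ?y = "s \<otimes> r [^] j"
      have yR: "?y \<in> R" using ks(1) subgroup_int_pow_closed[OF Rs hr(2)] by (rule subgroup.m_closed[OF Rs])
      have xy: "x = ?y \<otimes> h [^] j" using ks gk hr(2) hc by (simp add: m_ac)
      have "?y = x \<otimes> inv (h [^] j)" unfolding xy using yR hc by (simp add: m_assoc)
      also have "\<dots> \<in> component \<rho>"
        using x subgroup.m_closed[OF cs] subgroup.m_inv_closed[OF cs] subgroup_int_pow_closed[OF cs hr(1)] by blast
      finally have "?y \<in> D \<rho>" using comp_R[OF \<rho> _ yR] by simp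
      then have "?y \<otimes> h [^] j \<in> D \<rho> <#> cyclic_span G h" by (rule set_mult_memI) (simp add: cyclic_span_def)
      then show "x \<in> D \<rho> <#> cyclic_span G h" using xy by simp
    qed
    moreover have "D \<rho> <#> cyclic_span G h \<subseteq> component \<rho>"
      using D_comp[OF \<rho>] subgroup.m_closed[OF cs] subgroup_int_pow_closed[OF cs hr(1)]
      by (auto simp: set_mult_def cyclic_span_def)
    ultimately show ?thesis using hr(1) by blast
  qed
  have "cyclic_critical_projections G T e q g"
  proof unfold_locales
    show "g \<in> carrier G" by (rule g(1))
  next
    fix x assume x: "x \<in> carrier G"
    obtain k :: int and r where kr: "r \<in> R" "x = r \<otimes> g [^] k" using g(2)[OF x] by blast
    have "x = g [^] k \<otimes> (\<Otimes>\<rho>\<in>T. p \<rho> r)" using kr g(1) by (simp add: psum m_comm)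
    moreover have "\<forall>\<rho>\<in>T. p \<rho> r \<in> component \<rho>" using pD[OF _ kr(1)] D_comp by blast
    ultimately show "\<exists>(k::int) r. (\<forall>\<rho>\<in>T. r \<rho> \<in> component \<rho>) \<and> x = g [^] k \<otimes> (\<Otimes>\<rho>\<in>T. r \<rho>)"
      by (intro exI[of _ k] exI[of _ "\<lambda>\<rho>. p \<rho> r"] conjI)
  next
    fix \<rho> a assume \<rho>: "\<rho> \<in> T" and a: "a \<in> component \<rho>" "a \<noteq> \<one>"
    obtain S :: "'a monoid" where S: "group S" "\<And>E. E \<in> \<rho> \<Longrightarrow> rank_one E \<and> S \<cong> E"
      using grp_types_representative T \<rho> by blast
    interpret D: plain_comm_group "G \<restriction>\<restriction> D \<rho>" by (rule restrict_plain_comm_group[OF Ds[OF \<rho>]])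
    obtain l E where E: "internal_direct_sum (G \<restriction>\<restriction> D \<rho>) {..<l::nat} E"
      "\<And>i. i < l \<Longrightarrow> G \<restriction>\<restriction> D \<rho> \<restriction>\<restriction> E i \<in> \<rho>"
      using hcd[OF \<rho>] unfolding homogeneous_cd_def by blast
    have "homogeneous_sum (G \<restriction>\<restriction> D \<rho>) S (carrier (G \<restriction>\<restriction> D \<rho>))"
      by (rule D.internal_direct_sum_homogeneous_sum[OF E(1)]) (use S(2) E(2) in blast)+
    then have "homogeneous_sum G S (D \<rho>)" using homogeneous_sum_restrict[OF Ds[OF \<rho>]] by simp
    moreover obtain h where h: "h \<in> component \<rho>" "component \<rho> = D \<rho> <#> cyclic_span G h"
      using comp_gen[OF \<rho>] by blast
    \<comment> \<open>The \<open>e\<close>-th power of \<open>h\<close> lies in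
      \<open>D \<rho>\<close>, so adjoining \<open>h\<close> keeps a direct sum of copies of
      \<open>S\<close>.\<close>
    ultimately have H: "homogeneous_sum G S (component \<rho>)"
      using homogeneous_sum_cyclic_extension[OF tf S(1) _ component_carrier[OF h(1)] e comp_pow[OF \<rho> h(1)]] by simp
    have "component \<rho> \<noteq> {\<one>}" using a by auto
    then obtain L M where LM: "subgroup L G" "pairwise_dependent G L" "homogeneous_sum G S M"
      "M \<inter> L = {\<one>}" "M <#> L = component \<rho>" "a \<in> L"
      using homogeneous_sum_rank_one_summand[OF tf S(1) H a(1)] by blast
    have Ms: "subgroup M G" using LM(3) by (rule homogeneous_sum_subgroup)
    have "L <#> M = component \<rho>"
      using LM(5) set_mult_comm[OF subgroup.subset[OF LM(1)] subgroup.subset[OF Ms]] by simp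
    moreover have "L \<inter> M = {\<one>}" using LM(4) by (simp add: Int_commute)
    ultimately show "\<exists>L M. subgroup L G \<and> subgroup M G \<and> pairwise_dependent G L \<and> L \<inter> M = {\<one>} \<and>
        L <#> M = component \<rho> \<and> a \<in> L"
      using LM Ms by blast
  qed
  then show ?thesis by blast
qed

end

theorem proposition3p1:
  shows "(\<forall>G :: 'a monoid. G \<in> \<B> \<longrightarrow>
            max_indec_rank G + max_num_summands G \<le> rk G + 1) \<and>
         (\<forall>(G :: 'b monoid) (n :: nat) (k :: nat).
            tffr_group G \<longrightarrow> 1 \<le> k \<longrightarrow> k \<le> n \<longrightarrow> \<P> G = \<C> n k \<longrightarrow>
            max_indec_rank G + max_num_summands G = n + 1)"
proof (intro conjI allI impI)
  fix G :: "'a monoid" assume G: "G \<in> \<B>"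
  then have "comm_group G"
    by (simp add: class_B_def almost_completely_decomposable_def tffr_group_def)
  then interpret plain_comm_group G by (simp only: plain_comm_group_def)
  obtain T :: "'a monoid set set" and e q g where "cyclic_critical_projections G T e q g"
    using class_B_cyclic_critical_projections[OF G] by blast
  then show "max_indec_rank G + max_num_summands G \<le> rk G + 1"
    by (rule cyclic_critical_projections.rank_plus_summands_le)
next
  fix G :: "'b monoid" and n k :: nat
  assume G: "tffr_group G" and nk: "1 \<le> k" "k \<le> n" "\<P> G = \<C> n k"
  then interpret plain_comm_group G by (simp add: tffr_group_def plain_comm_group_def)
  show "max_indec_rank G + max_num_summands G = n + 1"
    using G nk by (intro rank_plus_summands_of_full_partition_set) (auto simp: tffr_group_def)
qed

end
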